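(* Let $\mathfrak k$ be a bundle of ideals on a Lie algebroid $A\Rightarrow M$, and let $E\subset TA$ be an IM connection for $\mathfrak k$, with corresponding pair $(\mathcal C,v)\in\mathcal A(A;\mathfrak k)$. For all $p,q\ge 0$, the model isomorphism $\mathrm{ev}\colon\Gamma_{\mathrm{ext}}(\mathbb M_q,\Lambda^p\mathbb A_q^* )\to W^{p,q}(A;\mathfrak k)$ commutes with the horizontal projections: $$\mathrm{ev}\circ h^*=h^*\circ\mathrm{ev},$$ where $h^*$ on the left is the horizontal projection of exterior cochains defined by $E$, and $h^*$ on the right is the horizontal projection of Weil cochains defined by $(\mathcal C,v)$.
   Context: Bundle of ideals: a vector subbundle $\mathfrak k\subset\ker\rho\subset A$ ($\rho$ the anchor) with $[\Gamma(A),\Gamma(\mathfrak k)]\subset\Gamma(\mathfrak k)$; it is a representation of $A$ by $\nabla^A_\alpha\xi=[\alpha,\xi]$. Let $\pi\colon A\to M$ be the bundle projection, $\varphi\colon A\to A/\mathfrak k$ the quotient. Weil cochains: $W^{p,q}(A;\mathfrak k)$ is the set of sequences $c=(c_0,\dots,c_p)$ of $\mathbb R$-multilinear alternating maps $c_k\colon\Gamma(A)^{p-k}\to\Omega^{q-k}(M;S^k(A^* )\otimes\mathfrak k)$ (negative-degree forms are zero), written $c_k(\alpha_1,\dots,\alpha_{p-k}|\beta_1,\dots,\beta_k)$, with $c_k(f\alpha_1,\alpha_2,\dots|\cdot)=fc_k(\alpha_1,\alpha_2,\dots|\cdot)+\mathrm df\wedge c_{k+1}(\alpha_2,\dots|\alpha_1,\cdot)$.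 Tangent double vector bundle: $TA$ is a vector bundle over $A$ (addition $+_A$) and over $TM$ (projection $\mathrm d\pi$, addition $+_{TM}=\mathrm d(+)$, zero section $0_{TM}=\mathrm d0$), and $TA\Rightarrow TM$ is the tangent Lie algebroid. An IM connection as a distribution is a wide VB-subalgebroid $E\subset TA$ (over $A$ and $TM$) with $TA=E\oplus_A\ker\mathrm d\varphi$. Let $v^{TA}\colon TA\to\ker\mathrm d\varphi$ be the projection along $E$ and $h(X)=X-_Av^{TA}(X)$. With $i\colon A\oplus_M\mathfrak k\xrightarrow{\cong}\ker\mathrm d\varphi$, $i(a,\xi)=\frac{d}{d\lambda}|_0(a+\lambda\xi)$, and $\nu=i^{-1}\circ v^{TA}$, the corresponding pair is $\mathcal C(\alpha)(w)=\mathrm{pr}_{\mathfrak k}\,\nu(\mathrm d\alpha(w))$, $v(\alpha_x)=\mathrm{pr}_{\mathfrak k}\,\nu\big(\frac d{d\lambda}|_0\lambda\alpha_x\big)$ for $\alpha\in\Gamma(A)$, $w\in T_xM$. It satisfies $v|_{\mathfrak k}=\mathrm{id}$, $\mathcal C(f\alpha)=f\mathcal C(\alpha)+\mathrm df\otimes v(\alpha)$, and is infinitesimally multiplicative, i.e. an element of the set $\mathcal A(A;\mathfrak k)$ of IM connections. On $A$ write $h=\mathrm{id}-v$. Exterior cochains: $\mathbb A_q=\oplus^q_ATA\oplus_A\pi^*\mathfrak k^*$ with elements $(X_1,\dots,X_q,(a,\zeta))$, $X_i\in T_aA$, $\zeta\in\mathfrak k^*_{\pi(a)}$; $\mathbb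 M_q=\oplus^q_MTM\oplus_M\mathfrak k^*$. $\mathbb A_q$ is a vector bundle over $A$ (Whitney sum), and over $\mathbb M_q$ with projection $(\mathrm d\pi X_1,\dots,\mathrm d\pi X_q,\zeta)$ and addition $(X_i,(a,\zeta))+(X_i',(a',\zeta))=(X_i+_{TM}X_i',(a+a',\zeta))$. A section $\omega\in\Gamma(\mathbb M_q,\Lambda^p\mathbb A_q^* )$ (dual taken over $\mathbb M_q$) is an exterior cochain, $\omega\in\Gamma_{\mathrm{ext}}(\mathbb M_q,\Lambda^p\mathbb A_q^* )$, if: it is skew-symmetric, $(\sigma_A)^*\omega=\mathrm{sgn}(\sigma)\omega$ for $\sigma\in S_q$ permuting the $q$ components of $\oplus_A^qTA$; $(q+1)$-homogeneous, $(h_A^\lambda)^*\omega=\lambda^{q+1}\omega$, $h^\lambda_A$ being scalar multiplication of $\mathbb A_q\to A$; and simple, i.e. its pullbacks along the $q+1$ maps inserting a zero (of the fibration over $A$) in the $i$-th slot, $i=1,\dots,q+1$, vanish. Horizontal projection of exterior cochains: $(h^*\omega)(X^1,\dots,X^p)=\omega(hX^1,\dots,hX^p)$, where $h(X_1,\dots,X_q,(a,\zeta))=(hX_1,\dots,hX_q,(a,\zeta))$. Evaluation map: for $\alpha\in\Gamma(A)$ define sections of $\mathbb A_q\to\mathbb M_q$ at $(w_1,\dots,w_q,\zeta)$ over $x$ by $\mathbb T\alpha=(\mathrm d\alpha(w_1),\dots,\mathrm d\alpha(w_q),(\alpha_x,\zeta))$ and $\mathbb Z_i\alpha=\big(0_{TM}(w_1),\dots,0_{TM}(w_i)+_A\frac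 d{d\lambda}|_0\lambda\alpha_x,\dots,0_{TM}(w_q),(0_x,\zeta)\big)$. Then $\mathrm{ev}(\omega)=(c_0(\omega),\dots,c_p(\omega))$ with $$c_k(\omega)(\underline\alpha|\underline\beta)(w_1,\dots,w_{q-k},\zeta)=\omega(\mathbb Z_1\beta_1,\dots,\mathbb Z_k\beta_k,\mathbb T\alpha_1,\dots,\mathbb T\alpha_{p-k})(0_x,\dots,0_x,w_1,\dots,w_{q-k},\zeta)$$ for $k\le q$ and $c_k(\omega)=0$ for $k>q$; such functions, multilinear and skew in the $w$'s and linear in $\zeta$, are identified with elements of $\Omega^{q-k}(M;\mathfrak k)$. Horizontal projection of Weil cochains: $$(h^*c)_k(\alpha_1,\dots,\alpha_{p-k}|\beta_1,\dots,\beta_k)=\sum_{j=k}^p(-1)^{j-k}\sum_{\sigma\in S_{(j-k,p-j)}}\mathrm{sgn}(\sigma)\,c_j(\alpha_{\sigma(j-k+1)},\dots,\alpha_{\sigma(p-k)}|h\beta_1,\dots,h\beta_k,\cdot)\dot\wedge(\mathcal C\alpha_{\sigma(1)},\dots,\mathcal C\alpha_{\sigma(j-k)}),$$ with $S_{(a,b)}$ the $(a,b)$-shuffles, and for $\gamma\in\Omega^m(M;S^\ell(A^* )\otimes\mathfrak k)$, $\vartheta_i\in\Omega^1(M;\mathfrak k)$: $\big(\gamma\dot\wedge(\vartheta_1,\dots,\vartheta_\ell)\big)(X_1,\dots,X_{m+\ell})=\frac1{m!}\sum_{\sigma\in S_{m+\ell}}\mathrm{sgn}(\sigma)\gamma\big(\vartheta_1(X_{\sigma(1)}),\dots,\vartheta_\ell(X_{\sigma(\ell)})\big)(X_{\sigma(\ell+1)},\dots,X_{\sigma(\ell+m)})$.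 *)

theory Defs
  imports "HOL-Analysis.Analysis" "HOL-Combinatorics.Permutations" "HOL-Algebra.FiniteProduct"
begin

section \<open>Smooth functions and smooth manifolds\<close>

fun Ck_on :: "nat \<Rightarrow> 'a::real_normed_vector set \<Rightarrow> ('a \<Rightarrow> 'b::real_normed_vector) \<Rightarrow> bool" where
  "Ck_on 0 S f \<longleftrightarrow> continuous_on S f"
| "Ck_on (Suc n) S f \<longleftrightarrow> (\<forall>x\<in>S. f differentiable at x) \<and>
     (\<forall>v. Ck_on n S (\<lambda>x. frechet_derivative f (at x) v))"

text \<open>Only used for open \<open>S\<close>, and for functions that depend on finitely many real coordinates only,
  where it is the usual notion of smoothness.\<close>

definition smooth_on :: "'a::real_normed_vector set \<Rightarrow> ('a \<Rightarrow> 'b::real_normed_vector) \<Rightarrow> bool" where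
  "smooth_on S f \<longleftrightarrow> (\<forall>n. Ck_on n S f)"

text \<open>A chart is a pair (domain, coordinate map); values of the coordinate map outside its domain
  are irrelevant. The model spaces are finite-dimensional normed spaces, not \<open>euclidean_space\<close>,
  so that dimension and rank zero are allowed.\<close>

type_synonym ('p, 'e) chart = "'p set \<times> ('p \<Rightarrow> 'e)"

abbreviation chart_inv :: "('p, 'e) chart \<Rightarrow> 'e \<Rightarrow> 'p" where
  "chart_inv c \<equiv> inv_into (fst c) (snd c)"

definition points :: "('p, 'e) chart set \<Rightarrow> 'p set" where
  "points At = \<Union> (fst ` At)"

definition compatible :: "('p, 'e::real_normed_vector) chart \<Rightarrow> ('p, 'e) chart \<Rightarrow> bool" where
  "compatible c d \<longleftrightarrow> open (snd c ` (fst c \<inter> fst d)) \<and>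
     smooth_on (snd c ` (fst c \<inter> fst d)) (snd d \<circ> chart_inv c)"

definition smooth_atlas :: "('p, 'e::real_normed_vector) chart set \<Rightarrow> bool" where
  "smooth_atlas At \<longleftrightarrow> (\<exists>B::'e set. finite B \<and> span B = UNIV) \<and>
     (\<forall>c\<in>At. inj_on (snd c) (fst c)) \<and> (\<forall>c\<in>At. \<forall>d\<in>At. compatible c d)"

definition smooth_chart :: "('p, 'e::real_normed_vector) chart set \<Rightarrow> ('p, 'e) chart \<Rightarrow> bool" where
  "smooth_chart At c \<longleftrightarrow> fst c \<subseteq> points At \<and> inj_on (snd c) (fst c) \<and>
     (\<forall>d\<in>At. compatible c d \<and> compatible d c)"

definition mopen :: "('p, 'e::real_normed_vector) chart set \<Rightarrow> 'p set \<Rightarrow> bool" where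
  "mopen At S \<longleftrightarrow> S \<subseteq> points At \<and> (\<forall>c\<in>At. open (snd c ` (S \<inter> fst c)))"

definition manifold :: "('p, 'e::real_normed_vector) chart set \<Rightarrow> bool" where
  "manifold At \<longleftrightarrow> smooth_atlas At \<and>
     Hausdorff_space (topology_generated_by (Collect (mopen At))) \<and>
     second_countable (topology_generated_by (Collect (mopen At)))"

definition smooth_map :: "('p, 'e::real_normed_vector) chart set \<Rightarrow> ('q, 'd::real_normed_vector) chart set
    \<Rightarrow> 'p set \<Rightarrow> ('p \<Rightarrow> 'q) \<Rightarrow> bool" where
  "smooth_map At Bt W f \<longleftrightarrow> (\<forall>x\<in>W. \<exists>c\<in>At. \<exists>d\<in>Bt. \<exists>N.
     x \<in> fst c \<and> open N \<and> snd c x \<in> N \<and> N \<subseteq> snd c ` (fst c \<inter> W) \<and>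
     f ` chart_inv c ` N \<subseteq> fst d \<and> smooth_on N (snd d \<circ> f \<circ> chart_inv c))"

definition real_atlas :: "(real, real) chart set" where
  "real_atlas = {(UNIV, id)}"

section \<open>Tangent vectors\<close>

text \<open>A tangent vector at \<open>p\<close> assigns to every chart around \<open>p\<close> a coordinate vector, such that the
  coordinate vectors are related by the derivatives of the transition maps (and \<open>0\<close> to every other
  argument, so that tangent vectors are determined by their coordinates).\<close>

type_synonym ('p, 'e) tvec = "'p \<times> (('p, 'e) chart \<Rightarrow> 'e)"

definition tangent :: "('p, 'e::real_normed_vector) chart set \<Rightarrow> ('p, 'e) tvec set" where
  "tangent At = {X. fst X \<in> points At \<and>
     (\<forall>c. c \<notin> At \<or> fst X \<notin> fst c \<longrightarrow> snd X c = 0) \<and>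
     (\<forall>c\<in>At. \<forall>d\<in>At. fst X \<in> fst c \<longrightarrow> fst X \<in> fst d \<longrightarrow>
        snd X d = frechet_derivative (snd d \<circ> chart_inv c) (at (snd c (fst X))) (snd X c))}"

definition tadd :: "('p, 'e::real_normed_vector) tvec \<Rightarrow> ('p, 'e) tvec \<Rightarrow> ('p, 'e) tvec" where
  "tadd X Y = (fst X, \<lambda>c. snd X c + snd Y c)"

definition tscale :: "real \<Rightarrow> ('p, 'e::real_normed_vector) tvec \<Rightarrow> ('p, 'e) tvec" where
  "tscale r X = (fst X, \<lambda>c. r *\<^sub>R snd X c)"

definition tzero :: "'p \<Rightarrow> ('p, 'e::real_normed_vector) tvec" where
  "tzero p = (p, \<lambda>c. 0)"

definition tsub :: "('p, 'e::real_normed_vector) tvec \<Rightarrow> ('p, 'e) tvec \<Rightarrow> ('p, 'e) tvec" where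
  "tsub X Y = tadd X (tscale (-1) Y)"

definition differential :: "('p, 'e::real_normed_vector) chart set \<Rightarrow> ('q, 'd::real_normed_vector) chart set
    \<Rightarrow> ('p \<Rightarrow> 'q) \<Rightarrow> ('p, 'e) tvec \<Rightarrow> ('q, 'd) tvec" where
  "differential At Bt f X =
     (let p = fst X; c = (SOME c. c \<in> At \<and> p \<in> fst c)
      in (f p, \<lambda>d. if d \<in> Bt \<and> f p \<in> fst d
            then frechet_derivative (snd d \<circ> f \<circ> chart_inv c) (at (snd c p)) (snd X c) else 0))"

text \<open>The velocity at time \<open>0\<close> of a curve.\<close>

definition velocity :: "('p, 'e::real_normed_vector) chart set \<Rightarrow> (real \<Rightarrow> 'p) \<Rightarrow> ('p, 'e) tvec" where
  "velocity At \<gamma> = (\<gamma> 0, \<lambda>c. if c \<in> At \<and> \<gamma> 0 \<in> fst c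
      then vector_derivative (snd c \<circ> \<gamma>) (at 0) else 0)"

definition dderiv :: "('p, 'e::real_normed_vector) chart set \<Rightarrow> ('p \<Rightarrow> real) \<Rightarrow> ('p, 'e) tvec \<Rightarrow> real" where
  "dderiv At f X = snd (differential At real_atlas f X) (UNIV, id)"

definition tangent_chart :: "('p, 'e::real_normed_vector) chart set \<Rightarrow> ('p, 'e) chart
    \<Rightarrow> (('p, 'e) tvec, 'e \<times> 'e) chart" where
  "tangent_chart At c = ({X \<in> tangent At. fst X \<in> fst c}, \<lambda>X. (snd c (fst X), snd X c))"

definition tangent_atlas :: "('p, 'e::real_normed_vector) chart set \<Rightarrow> (('p, 'e) tvec, 'e \<times> 'e) chart set" where
  "tangent_atlas At = tangent_chart At ` At"

text \<open>The canonical flip of the double tangent bundle: in every chart of the tangent bundle induced by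
  a chart of the base, it is \<open>(x, v, y, u) \<mapsto> (x, y, v, u)\<close>.\<close>

definition canonical_flip :: "('p, 'e::real_normed_vector) chart set
    \<Rightarrow> (('p, 'e) tvec, 'e \<times> 'e) tvec \<Rightarrow> (('p, 'e) tvec, 'e \<times> 'e) tvec" where
  "canonical_flip At Z =
     (let Y = differential (tangent_atlas At) At fst Z
      in (Y, \<lambda>c. if c \<in> tangent_atlas At \<and> Y \<in> fst c
            then (snd (snd c (fst Z)), snd (snd Z c)) else 0))"

section \<open>Vector bundles\<close>

record ('b, 'e, 't, 'd) vbundle =
  base :: "('b, 'e) chart set"
  total :: "('t, 'd) chart set"
  proj :: "'t \<Rightarrow> 'b"
  add :: "'t \<Rightarrow> 't \<Rightarrow> 't"
  scl :: "real \<Rightarrow> 't \<Rightarrow> 't"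
  zero :: "'b \<Rightarrow> 't"

abbreviation fibre :: "('b, 'e, 't, 'd) vbundle \<Rightarrow> 'b \<Rightarrow> 't set" where
  "fibre V x \<equiv> {a \<in> points (total V). proj V a = x}"

text \<open>The atlas of the total space consists of bundle charts, i.e. of local trivializations
  (with typical fibre \<open>'f\<close>) over the domains of smooth charts of the base.\<close>

definition vector_bundle :: "('m, 'e::real_normed_vector, 'a, 'e \<times> 'f::real_normed_vector) vbundle \<Rightarrow> bool" where
  "vector_bundle V \<longleftrightarrow> manifold (base V) \<and> smooth_atlas (total V) \<and>
     proj V ` points (total V) = points (base V) \<and>
     (\<forall>x\<in>points (base V). zero V x \<in> fibre V x) \<and>
     (\<forall>a\<in>points (total V). \<forall>r. scl V r a \<in> fibre V (proj V a)) \<and>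
     (\<forall>a\<in>points (total V). \<forall>b\<in>fibre V (proj V a). add V a b \<in> fibre V (proj V a)) \<and>
     (\<forall>d\<in>total V. \<exists>c. smooth_chart (base V) c \<and>
        fst d = {a \<in> points (total V). proj V a \<in> fst c} \<and>
        snd d ` fst d = snd c ` fst c \<times> UNIV \<and>
        (\<forall>a\<in>fst d. fst (snd d a) = snd c (proj V a)) \<and>
        (\<forall>a\<in>fst d. \<forall>r. snd (snd d (scl V r a)) = r *\<^sub>R snd (snd d a)) \<and>
        (\<forall>a\<in>fst d. \<forall>b\<in>fibre V (proj V a).
           snd (snd d (add V a b)) = snd (snd d a) + snd (snd d b)) \<and>
        (\<forall>x\<in>fst c. snd (snd d (zero V x)) = 0))"

definition sections :: "('b, 'e::real_normed_vector, 't, 'd::real_normed_vector) vbundle \<Rightarrow> ('b \<Rightarrow> 't) set" where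
  "sections V = {s \<in> extensional (points (base V)).
     smooth_map (base V) (total V) (points (base V)) s \<and>
     (\<forall>x\<in>points (base V). proj V (s x) = x)}"

definition smooth_functions :: "('b, 'e::real_normed_vector, 't, 'd) vbundle \<Rightarrow> ('b \<Rightarrow> real) set" where
  "smooth_functions V = {f. smooth_map (base V) real_atlas (points (base V)) f}"

definition sec_add :: "('b, 'e, 't, 'd) vbundle \<Rightarrow> ('b \<Rightarrow> 't) \<Rightarrow> ('b \<Rightarrow> 't) \<Rightarrow> ('b \<Rightarrow> 't)" where
  "sec_add V s t = restrict (\<lambda>x. add V (s x) (t x)) (points (base V))"

definition sec_mult :: "('b, 'e, 't, 'd) vbundle \<Rightarrow> ('b \<Rightarrow> real) \<Rightarrow> ('b \<Rightarrow> 't) \<Rightarrow> ('b \<Rightarrow> 't)" where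
  "sec_mult V f s = restrict (\<lambda>x. scl V (f x) (s x)) (points (base V))"

definition sec_zero :: "('b, 'e, 't, 'd) vbundle \<Rightarrow> ('b \<Rightarrow> 't)" where
  "sec_zero V = restrict (zero V) (points (base V))"

primrec lincomb :: "('b, 'e, 't, 'd) vbundle \<Rightarrow> (nat \<Rightarrow> 'b \<Rightarrow> 't) \<Rightarrow> 'b \<Rightarrow> (nat \<Rightarrow> real) \<Rightarrow> nat \<Rightarrow> 't" where
  "lincomb V s x c 0 = zero V x"
| "lincomb V s x c (Suc n) = add V (lincomb V s x c n) (scl V (c n) (s n x))"

text \<open>A vector subbundle (over the same base) is a subset that around every point of the base admits
  a smooth local frame, i.e. smooth local sections of the ambient bundle that form a basis of the
  fibre of the subset at each point.\<close>

definition vector_subbundle :: "('b, 'e::real_normed_vector, 't, 'd::real_normed_vector) vbundle \<Rightarrow> 't set \<Rightarrow> bool" where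
  "vector_subbundle V S \<longleftrightarrow> S \<subseteq> points (total V) \<and>
     (\<forall>x\<in>points (base V). \<exists>W n s. mopen (base V) W \<and> x \<in> W \<and>
        (\<forall>i<n. smooth_map (base V) (total V) W (s i) \<and> (\<forall>y\<in>W. s i y \<in> S \<and> proj V (s i y) = y)) \<and>
        (\<forall>y\<in>W. bij_betw (\<lambda>c. lincomb V s y c n) ({..<n} \<rightarrow>\<^sub>E UNIV) {a \<in> S. proj V a = y}))"

section \<open>Lie algebroids and bundles of ideals\<close>

definition lie_algebroid_structure :: "('b, 'e::real_normed_vector, 't, 'd::real_normed_vector) vbundle
    \<Rightarrow> ('t \<Rightarrow> ('b, 'e) tvec) \<Rightarrow> (('b \<Rightarrow> 't) \<Rightarrow> ('b \<Rightarrow> 't) \<Rightarrow> ('b \<Rightarrow> 't)) \<Rightarrow> bool" where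
  "lie_algebroid_structure V \<rho> br \<longleftrightarrow>
     smooth_map (total V) (tangent_atlas (base V)) (points (total V)) \<rho> \<and>
     (\<forall>a\<in>points (total V). \<rho> a \<in> tangent (base V) \<and> fst (\<rho> a) = proj V a) \<and>
     (\<forall>a\<in>points (total V). \<forall>r. \<rho> (scl V r a) = tscale r (\<rho> a)) \<and>
     (\<forall>a\<in>points (total V). \<forall>b\<in>fibre V (proj V a). \<rho> (add V a b) = tadd (\<rho> a) (\<rho> b)) \<and>
     (\<forall>\<alpha>\<in>sections V. br \<alpha> \<alpha> = sec_zero V) \<and>
     (\<forall>\<alpha>\<in>sections V. \<forall>\<beta>\<in>sections V. br \<alpha> \<beta> \<in> sections V) \<and>
     (\<forall>\<alpha>\<in>sections V. \<forall>\<beta>\<in>sections V. \<forall>\<gamma>\<in>sections V.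
        br (sec_add V \<alpha> \<beta>) \<gamma> = sec_add V (br \<alpha> \<gamma>) (br \<beta> \<gamma>) \<and>
        br \<gamma> (sec_add V \<alpha> \<beta>) = sec_add V (br \<gamma> \<alpha>) (br \<gamma> \<beta>) \<and>
        sec_add V (br \<alpha> (br \<beta> \<gamma>)) (sec_add V (br \<beta> (br \<gamma> \<alpha>)) (br \<gamma> (br \<alpha> \<beta>))) = sec_zero V) \<and>
     (\<forall>\<alpha>\<in>sections V. \<forall>\<beta>\<in>sections V. \<forall>f\<in>smooth_functions V.
        br \<alpha> (sec_mult V f \<beta>) =
          sec_add V (sec_mult V f (br \<alpha> \<beta>)) (sec_mult V (\<lambda>x. dderiv (base V) f (\<rho> (\<alpha> x))) \<beta>))"

definition lie_algebroid :: "('m, 'e::real_normed_vector, 'a, 'e \<times> 'f::real_normed_vector) vbundle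
    \<Rightarrow> ('a \<Rightarrow> ('m, 'e) tvec) \<Rightarrow> (('m \<Rightarrow> 'a) \<Rightarrow> ('m \<Rightarrow> 'a) \<Rightarrow> ('m \<Rightarrow> 'a)) \<Rightarrow> bool" where
  "lie_algebroid A \<rho> br \<longleftrightarrow> vector_bundle A \<and> lie_algebroid_structure A \<rho> br"

definition bundle_of_ideals :: "('m, 'e::real_normed_vector, 'a, 'e \<times> 'f::real_normed_vector) vbundle
    \<Rightarrow> ('a \<Rightarrow> ('m, 'e) tvec) \<Rightarrow> (('m \<Rightarrow> 'a) \<Rightarrow> ('m \<Rightarrow> 'a) \<Rightarrow> ('m \<Rightarrow> 'a)) \<Rightarrow> 'a set \<Rightarrow> bool" where
  "bundle_of_ideals A \<rho> br k \<longleftrightarrow> vector_subbundle A k \<and>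
     (\<forall>\<xi>\<in>k. \<rho> \<xi> = tzero (proj A \<xi>)) \<and>
     (\<forall>\<alpha>\<in>sections A. \<forall>\<xi>\<in>sections A. \<xi> ` points (base A) \<subseteq> k \<longrightarrow> br \<alpha> \<xi> ` points (base A) \<subseteq> k)"

text \<open>\<open>Q\<close> with the map \<open>\<phi>\<close> is a quotient vector bundle of \<open>A\<close> by \<open>k\<close>. It is unique up to isomorphism.\<close>

definition quotient_bundle :: "('m, 'e::real_normed_vector, 'a, 'e \<times> 'f::real_normed_vector) vbundle
    \<Rightarrow> 'a set \<Rightarrow> ('m, 'e, 'b, 'e \<times> 'g::real_normed_vector) vbundle \<Rightarrow> ('a \<Rightarrow> 'b) \<Rightarrow> bool" where
  "quotient_bundle A k Q \<phi> \<longleftrightarrow> vector_bundle Q \<and> base Q = base A \<and>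
     smooth_map (total A) (total Q) (points (total A)) \<phi> \<and>
     \<phi> ` points (total A) = points (total Q) \<and>
     (\<forall>a\<in>points (total A). proj Q (\<phi> a) = proj A a) \<and>
     (\<forall>a\<in>points (total A). \<forall>r. \<phi> (scl A r a) = scl Q r (\<phi> a)) \<and>
     (\<forall>a\<in>points (total A). \<forall>b\<in>fibre A (proj A a). \<phi> (add A a b) = add Q (\<phi> a) (\<phi> b)) \<and>
     {a \<in> points (total A). \<phi> a = zero Q (proj A a)} = k"

section \<open>The tangent double vector bundle and the tangent Lie algebroid\<close>

definition TA_over_A :: "('m, 'e, 'a, 'd::real_normed_vector) vbundle
    \<Rightarrow> ('a, 'd, ('a, 'd) tvec, 'd \<times> 'd) vbundle" where
  "TA_over_A A = \<lparr>base = total A, total = tangent_atlas (total A),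
     proj = fst, add = tadd, scl = tscale, zero = tzero\<rparr>"

text \<open>The atlas of the Whitney sum of a vector bundle with itself.\<close>

definition whitney_atlas :: "('m, 'e, 'a, 'e \<times> 'f) vbundle \<Rightarrow> ('a \<times> 'a, 'e \<times> 'f \<times> 'f) chart set" where
  "whitney_atlas A = (\<lambda>d. ({(a, b). a \<in> fst d \<and> b \<in> fst d \<and> proj A a = proj A b},
     \<lambda>(a, b). (fst (snd d a), snd (snd d a), snd (snd d b)))) ` total A"

text \<open>Addition over \<open>TM\<close> is the differential of the addition of \<open>A\<close>, where a pair of tangent vectors
  with the same projection to \<open>TM\<close> is regarded as a tangent vector of the Whitney sum.\<close>

definition TM_add :: "('m, 'e::real_normed_vector, 'a, 'e \<times> 'f::real_normed_vector) vbundle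
    \<Rightarrow> ('a, 'e \<times> 'f) tvec \<Rightarrow> ('a, 'e \<times> 'f) tvec \<Rightarrow> ('a, 'e \<times> 'f) tvec" where
  "TM_add A X Y = differential (whitney_atlas A) (total A) (\<lambda>(a, b). add A a b)
     (THE Z. Z \<in> tangent (whitney_atlas A) \<and>
        differential (whitney_atlas A) (total A) fst Z = X \<and>
        differential (whitney_atlas A) (total A) snd Z = Y)"

definition TA_over_TM :: "('m, 'e::real_normed_vector, 'a, 'e \<times> 'f::real_normed_vector) vbundle
    \<Rightarrow> (('m, 'e) tvec, 'e \<times> 'e, ('a, 'e \<times> 'f) tvec, ('e \<times> 'f) \<times> ('e \<times> 'f)) vbundle" where
  "TA_over_TM A = \<lparr>base = tangent_atlas (base A), total = tangent_atlas (total A),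
     proj = differential (total A) (base A) (proj A),
     add = TM_add A,
     scl = (\<lambda>r. differential (total A) (total A) (scl A r)),
     zero = differential (base A) (total A) (zero A)\<rparr>"

definition core_vec :: "('m, 'e::real_normed_vector, 'a, 'e \<times> 'f::real_normed_vector) vbundle
    \<Rightarrow> 'a \<Rightarrow> ('a, 'e \<times> 'f) tvec" where
  "core_vec A a = velocity (total A) (\<lambda>t. scl A t a)"

definition tangent_lift :: "('m, 'e::real_normed_vector, 'a, 'e \<times> 'f::real_normed_vector) vbundle
    \<Rightarrow> ('m \<Rightarrow> 'a) \<Rightarrow> ('m, 'e) tvec \<Rightarrow> ('a, 'e \<times> 'f) tvec" where
  "tangent_lift A \<alpha> = restrict (differential (base A) (total A) \<alpha>) (tangent (base A))"

definition core_lift :: "('m, 'e::real_normed_vector, 'a, 'e \<times> 'f::real_normed_vector) vbundle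
    \<Rightarrow> ('m \<Rightarrow> 'a) \<Rightarrow> ('m, 'e) tvec \<Rightarrow> ('a, 'e \<times> 'f) tvec" where
  "core_lift A \<alpha> = restrict (\<lambda>w. tadd (zero (TA_over_TM A) w) (core_vec A (\<alpha> (fst w)))) (tangent (base A))"

text \<open>The bracket of the tangent Lie algebroid is the unique one satisfying the following
  (its values on arguments that are not smooth sections are irrelevant).\<close>

definition tangent_bracket :: "('m, 'e::real_normed_vector, 'a, 'e \<times> 'f::real_normed_vector) vbundle
    \<Rightarrow> ('a \<Rightarrow> ('m, 'e) tvec) \<Rightarrow> (('m \<Rightarrow> 'a) \<Rightarrow> ('m \<Rightarrow> 'a) \<Rightarrow> ('m \<Rightarrow> 'a))
    \<Rightarrow> ((('m, 'e) tvec \<Rightarrow> ('a, 'e \<times> 'f) tvec) \<Rightarrow> (('m, 'e) tvec \<Rightarrow> ('a, 'e \<times> 'f) tvec)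
         \<Rightarrow> (('m, 'e) tvec \<Rightarrow> ('a, 'e \<times> 'f) tvec)) \<Rightarrow> bool" where
  "tangent_bracket A \<rho> br tbr \<longleftrightarrow>
     lie_algebroid_structure (TA_over_TM A)
       (canonical_flip (base A) \<circ> differential (total A) (tangent_atlas (base A)) \<rho>) tbr \<and>
     (\<forall>\<alpha>\<in>sections A. \<forall>\<beta>\<in>sections A.
        tbr (tangent_lift A \<alpha>) (tangent_lift A \<beta>) = tangent_lift A (br \<alpha> \<beta>) \<and>
        tbr (tangent_lift A \<alpha>) (core_lift A \<beta>) = core_lift A (br \<alpha> \<beta>) \<and>
        tbr (core_lift A \<alpha>) (core_lift A \<beta>) = sec_zero (TA_over_TM A))"

section \<open>IM connections\<close>

definition ker_quot :: "('m, 'e::real_normed_vector, 'a, 'e \<times> 'f::real_normed_vector) vbundle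
    \<Rightarrow> ('m, 'e, 'b, 'e \<times> 'g::real_normed_vector) vbundle \<Rightarrow> ('a \<Rightarrow> 'b) \<Rightarrow> ('a, 'e \<times> 'f) tvec set" where
  "ker_quot A Q \<phi> = {X \<in> tangent (total A). differential (total A) (total Q) \<phi> X = tzero (\<phi> (fst X))}"

definition IM_connection :: "('m, 'e::real_normed_vector, 'a, 'e \<times> 'f::real_normed_vector) vbundle
    \<Rightarrow> ('a \<Rightarrow> ('m, 'e) tvec) \<Rightarrow> (('m \<Rightarrow> 'a) \<Rightarrow> ('m \<Rightarrow> 'a) \<Rightarrow> ('m \<Rightarrow> 'a))
    \<Rightarrow> ('m, 'e, 'b, 'e \<times> 'g::real_normed_vector) vbundle \<Rightarrow> ('a \<Rightarrow> 'b) \<Rightarrow> ('a, 'e \<times> 'f) tvec set \<Rightarrow> bool" where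
  "IM_connection A \<rho> br Q \<phi> E \<longleftrightarrow>
     vector_subbundle (TA_over_A A) E \<and> vector_subbundle (TA_over_TM A) E \<and>
     (\<forall>tbr. tangent_bracket A \<rho> br tbr \<longrightarrow>
        (\<forall>s\<in>sections (TA_over_TM A). \<forall>t\<in>sections (TA_over_TM A).
           s ` tangent (base A) \<subseteq> E \<longrightarrow> t ` tangent (base A) \<subseteq> E \<longrightarrow> tbr s t ` tangent (base A) \<subseteq> E)) \<and>
     (\<forall>X\<in>tangent (total A). \<exists>!YZ. fst YZ \<in> E \<and> snd YZ \<in> ker_quot A Q \<phi> \<and>
        fst (fst YZ) = fst X \<and> fst (snd YZ) = fst X \<and> X = tadd (fst YZ) (snd YZ))"

definition ver_TA :: "('m, 'e::real_normed_vector, 'a, 'e \<times> 'f::real_normed_vector) vbundle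
    \<Rightarrow> ('m, 'e, 'b, 'e \<times> 'g::real_normed_vector) vbundle \<Rightarrow> ('a \<Rightarrow> 'b) \<Rightarrow> ('a, 'e \<times> 'f) tvec set
    \<Rightarrow> ('a, 'e \<times> 'f) tvec \<Rightarrow> ('a, 'e \<times> 'f) tvec" where
  "ver_TA A Q \<phi> E X = (THE Z. Z \<in> ker_quot A Q \<phi> \<and> fst Z = fst X \<and>
     (\<exists>Y\<in>E. fst Y = fst X \<and> X = tadd Y Z))"

definition hor_TA :: "('m, 'e::real_normed_vector, 'a, 'e \<times> 'f::real_normed_vector) vbundle
    \<Rightarrow> ('m, 'e, 'b, 'e \<times> 'g::real_normed_vector) vbundle \<Rightarrow> ('a \<Rightarrow> 'b) \<Rightarrow> ('a, 'e \<times> 'f) tvec set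
    \<Rightarrow> ('a, 'e \<times> 'f) tvec \<Rightarrow> ('a, 'e \<times> 'f) tvec" where
  "hor_TA A Q \<phi> E X = tsub X (ver_TA A Q \<phi> E X)"

definition vert_iso :: "('m, 'e::real_normed_vector, 'a, 'e \<times> 'f::real_normed_vector) vbundle
    \<Rightarrow> 'a \<times> 'a \<Rightarrow> ('a, 'e \<times> 'f) tvec" where
  "vert_iso A = (\<lambda>(a, \<xi>). velocity (total A) (\<lambda>t. add A a (scl A t \<xi>)))"

definition nu :: "('m, 'e::real_normed_vector, 'a, 'e \<times> 'f::real_normed_vector) vbundle \<Rightarrow> 'a set
    \<Rightarrow> ('m, 'e, 'b, 'e \<times> 'g::real_normed_vector) vbundle \<Rightarrow> ('a \<Rightarrow> 'b) \<Rightarrow> ('a, 'e \<times> 'f) tvec set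
    \<Rightarrow> ('a, 'e \<times> 'f) tvec \<Rightarrow> 'a \<times> 'a" where
  "nu A k Q \<phi> E X = inv_into {(a, \<xi>). a \<in> points (total A) \<and> \<xi> \<in> k \<and> proj A a = proj A \<xi>}
     (vert_iso A) (ver_TA A Q \<phi> E X)"

text \<open>The pair \<open>(C, v)\<close> corresponding to \<open>E\<close>.\<close>

definition pair_C :: "('m, 'e::real_normed_vector, 'a, 'e \<times> 'f::real_normed_vector) vbundle \<Rightarrow> 'a set
    \<Rightarrow> ('m, 'e, 'b, 'e \<times> 'g::real_normed_vector) vbundle \<Rightarrow> ('a \<Rightarrow> 'b) \<Rightarrow> ('a, 'e \<times> 'f) tvec set
    \<Rightarrow> ('m \<Rightarrow> 'a) \<Rightarrow> ('m, 'e) tvec \<Rightarrow> 'a" where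
  "pair_C A k Q \<phi> E \<alpha> w = snd (nu A k Q \<phi> E (differential (base A) (total A) \<alpha> w))"

definition pair_v :: "('m, 'e::real_normed_vector, 'a, 'e \<times> 'f::real_normed_vector) vbundle \<Rightarrow> 'a set
    \<Rightarrow> ('m, 'e, 'b, 'e \<times> 'g::real_normed_vector) vbundle \<Rightarrow> ('a \<Rightarrow> 'b) \<Rightarrow> ('a, 'e \<times> 'f) tvec set
    \<Rightarrow> 'a \<Rightarrow> 'a" where
  "pair_v A k Q \<phi> E a = snd (nu A k Q \<phi> E (core_vec A a))"

section \<open>Exterior cochains\<close>

text \<open>The fibre of the dual bundle of \<open>k\<close>; functionals are extended by \<open>0\<close> outside the fibre of \<open>k\<close>.\<close>

definition k_dual :: "('m, 'e, 'a, 'd) vbundle \<Rightarrow> 'a set \<Rightarrow> 'm \<Rightarrow> ('a \<Rightarrow> real) set" where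
  "k_dual A k x = {\<zeta>. (\<forall>\<xi>. \<xi> \<notin> k \<or> proj A \<xi> \<noteq> x \<longrightarrow> \<zeta> \<xi> = 0) \<and>
     (\<forall>\<xi>\<in>k. \<forall>r. proj A \<xi> = x \<longrightarrow> \<zeta> (scl A r \<xi>) = r * \<zeta> \<xi>) \<and>
     (\<forall>\<xi>\<in>k. \<forall>\<eta>\<in>k. proj A \<xi> = x \<longrightarrow> proj A \<eta> = x \<longrightarrow> \<zeta> (add A \<xi> \<eta>) = \<zeta> \<xi> + \<zeta> \<eta>)}"

type_synonym ('a, 'd) Aq_point = "('a, 'd) tvec list \<times> 'a \<times> ('a \<Rightarrow> real)"
type_synonym ('m, 'e, 'a) Mq_point = "('m, 'e) tvec list \<times> 'm \<times> ('a \<Rightarrow> real)"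

definition Aq :: "('m, 'e, 'a, 'd::real_normed_vector) vbundle \<Rightarrow> 'a set \<Rightarrow> nat \<Rightarrow> ('a, 'd) Aq_point set" where
  "Aq A k q = {(Xs, a, \<zeta>). length Xs = q \<and> a \<in> points (total A) \<and>
     (\<forall>X\<in>set Xs. X \<in> tangent (total A) \<and> fst X = a) \<and> \<zeta> \<in> k_dual A k (proj A a)}"

definition Mq :: "('m, 'e::real_normed_vector, 'a, 'd) vbundle \<Rightarrow> 'a set \<Rightarrow> nat \<Rightarrow> ('m, 'e, 'a) Mq_point set" where
  "Mq A k q = {(ws, x, \<zeta>). length ws = q \<and> x \<in> points (base A) \<and>
     (\<forall>w\<in>set ws. w \<in> tangent (base A) \<and> fst w = x) \<and> \<zeta> \<in> k_dual A k x}"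

definition Aq_proj :: "('m, 'e::real_normed_vector, 'a, 'd::real_normed_vector) vbundle
    \<Rightarrow> ('a, 'd) Aq_point \<Rightarrow> ('m, 'e, 'a) Mq_point" where
  "Aq_proj A = (\<lambda>(Xs, a, \<zeta>). (map (differential (total A) (base A) (proj A)) Xs, proj A a, \<zeta>))"

text \<open>The vector bundle operations over \<open>Mq\<close> (\<open>Aq_add\<close>, \<open>Aq_scl\<close>), and the scalar multiplication
  of the vector bundle \<open>Aq\<close> over \<open>A\<close> (\<open>Aq_hscl\<close>) together with the map it covers (\<open>Mq_hscl\<close>).\<close>

definition Aq_add :: "('m, 'e::real_normed_vector, 'a, 'e \<times> 'f::real_normed_vector) vbundle
    \<Rightarrow> ('a, 'e \<times> 'f) Aq_point \<Rightarrow> ('a, 'e \<times> 'f) Aq_point \<Rightarrow> ('a, 'e \<times> 'f) Aq_point" where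
  "Aq_add A = (\<lambda>(Xs, a, \<zeta>) (Ys, b, _). (map2 (add (TA_over_TM A)) Xs Ys, add A a b, \<zeta>))"

definition Aq_scl :: "('m, 'e::real_normed_vector, 'a, 'e \<times> 'f::real_normed_vector) vbundle
    \<Rightarrow> real \<Rightarrow> ('a, 'e \<times> 'f) Aq_point \<Rightarrow> ('a, 'e \<times> 'f) Aq_point" where
  "Aq_scl A r = (\<lambda>(Xs, a, \<zeta>). (map (scl (TA_over_TM A) r) Xs, scl A r a, \<zeta>))"

definition Aq_hscl :: "real \<Rightarrow> ('a, 'd::real_normed_vector) Aq_point \<Rightarrow> ('a, 'd) Aq_point" where
  "Aq_hscl r = (\<lambda>(Xs, a, \<zeta>). (map (tscale r) Xs, a, \<lambda>\<xi>. r * \<zeta> \<xi>))"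

definition Mq_hscl :: "real \<Rightarrow> ('m, 'e::real_normed_vector, 'a) Mq_point \<Rightarrow> ('m, 'e, 'a) Mq_point" where
  "Mq_hscl r = (\<lambda>(ws, x, \<zeta>). (map (tscale r) ws, x, \<lambda>\<xi>. r * \<zeta> \<xi>))"

text \<open>A section \<open>\<omega>\<close> takes a point of \<open>Mq\<close> and a list of \<open>p\<close> elements of the fibre of \<open>Aq\<close> over it.\<close>

type_synonym ('m, 'e, 'a, 'd) cochain = "('m, 'e, 'a) Mq_point \<Rightarrow> ('a, 'd) Aq_point list \<Rightarrow> real"

definition Aq_tuples :: "('m, 'e::real_normed_vector, 'a, 'd::real_normed_vector) vbundle \<Rightarrow> 'a set
    \<Rightarrow> nat \<Rightarrow> nat \<Rightarrow> ('m, 'e, 'a) Mq_point \<Rightarrow> ('a, 'd) Aq_point list set" where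
  "Aq_tuples A k p q \<mu> = {Xs. length Xs = p \<and> set Xs \<subseteq> {X \<in> Aq A k q. Aq_proj A X = \<mu>}}"

definition multilinear_alternating :: "('m, 'e::real_normed_vector, 'a, 'e \<times> 'f::real_normed_vector) vbundle
    \<Rightarrow> 'a set \<Rightarrow> nat \<Rightarrow> nat \<Rightarrow> ('m, 'e, 'a, 'e \<times> 'f) cochain \<Rightarrow> bool" where
  "multilinear_alternating A k p q \<omega> \<longleftrightarrow> (\<forall>\<mu>\<in>Mq A k q. \<forall>Xs\<in>Aq_tuples A k p q \<mu>.
     (\<forall>i<p. \<forall>Y\<in>Aq A k q. Aq_proj A Y = \<mu> \<longrightarrow>
        \<omega> \<mu> (Xs[i := Aq_add A (Xs ! i) Y]) = \<omega> \<mu> Xs + \<omega> \<mu> (Xs[i := Y])) \<and>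
     (\<forall>i<p. \<forall>r. \<omega> \<mu> (Xs[i := Aq_scl A r (Xs ! i)]) = r * \<omega> \<mu> Xs) \<and>
     (\<forall>i<p. \<forall>j<p. i \<noteq> j \<longrightarrow> Xs ! i = Xs ! j \<longrightarrow> \<omega> \<mu> Xs = 0))"

text \<open>Smoothness of \<open>\<omega>\<close> as a function on the \<open>p\<close>-fold fibre product of \<open>Aq\<close> over \<open>Mq\<close>, expressed in the
  coordinates induced by a bundle chart \<open>d\<close> of \<open>A\<close>: the point \<open>x\<close> of the base, the components
  \<open>w 0, ..., w (q - 1)\<close> of the tangent vectors of \<open>M\<close>, the functional \<open>L\<close>, the fibre components
  \<open>a j\<close> of the points of \<open>A\<close>, and the fibre components \<open>b j i\<close> of the tangent vectors of \<open>A\<close>.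
  Since \<open>p\<close> and \<open>q\<close> are not type parameters, finite families of coordinates are written as initial
  segments of bounded sequences, on whose remaining entries the function does not depend.
  Likewise \<open>L\<close> ranges over the dual of the whole typical fibre of \<open>A\<close>, and only its restriction to \<open>k\<close>
  enters, that is, we pull back along a surjective submersion.\<close>

definition smooth_cochain :: "('m, 'e::real_normed_vector, 'a, 'e \<times> 'f::real_normed_vector) vbundle
    \<Rightarrow> 'a set \<Rightarrow> nat \<Rightarrow> nat \<Rightarrow> ('m, 'e, 'a, 'e \<times> 'f) cochain \<Rightarrow> bool" where
  "smooth_cochain A k p q \<omega> \<longleftrightarrow> (\<forall>d\<in>total A.
     smooth_on {(x, w :: nat \<Rightarrow>\<^sub>C 'e, L :: 'f \<Rightarrow>\<^sub>L real, a :: nat \<Rightarrow>\<^sub>C 'f, b :: nat \<Rightarrow>\<^sub>C nat \<Rightarrow>\<^sub>C 'f).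
         (x, 0) \<in> snd d ` fst d}
       (\<lambda>(x, w, L, a, b).
          let pt = (\<lambda>y. chart_inv d (x, y));
              tv = (\<lambda>y u. chart_inv (tangent_chart (total A) d) ((x, y), u));
              \<zeta> = (\<lambda>\<xi>. if \<xi> \<in> k \<and> proj A \<xi> = proj A (pt 0)
                        then blinfun_apply L (snd (snd d \<xi>)) else 0)
          in \<omega> (map (\<lambda>i. differential (total A) (base A) (proj A) (tv 0 (apply_bcontfun w i, 0))) [0..<q],
                 proj A (pt 0), \<zeta>)
               (map (\<lambda>j. (map (\<lambda>i. tv (apply_bcontfun a j)
                                   (apply_bcontfun w i, apply_bcontfun (apply_bcontfun b j) i)) [0..<q],
                          pt (apply_bcontfun a j), \<zeta>)) [0..<p])))"

definition skew_cochain :: "('m, 'e::real_normed_vector, 'a, 'd::real_normed_vector) vbundle \<Rightarrow> 'a set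
    \<Rightarrow> nat \<Rightarrow> nat \<Rightarrow> ('m, 'e, 'a, 'd) cochain \<Rightarrow> bool" where
  "skew_cochain A k p q \<omega> \<longleftrightarrow> (\<forall>\<sigma>. \<sigma> permutes {..<q} \<longrightarrow>
     (\<forall>\<mu>\<in>Mq A k q. \<forall>Xs\<in>Aq_tuples A k p q \<mu>.
        \<omega> (apfst (permute_list \<sigma>) \<mu>) (map (apfst (permute_list \<sigma>)) Xs) = of_int (sign \<sigma>) * \<omega> \<mu> Xs))"

definition homogeneous_cochain :: "('m, 'e::real_normed_vector, 'a, 'd::real_normed_vector) vbundle \<Rightarrow> 'a set
    \<Rightarrow> nat \<Rightarrow> nat \<Rightarrow> ('m, 'e, 'a, 'd) cochain \<Rightarrow> bool" where
  "homogeneous_cochain A k p q \<omega> \<longleftrightarrow> (\<forall>r. \<forall>\<mu>\<in>Mq A k q. \<forall>Xs\<in>Aq_tuples A k p q \<mu>.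
     \<omega> (Mq_hscl r \<mu>) (map (Aq_hscl r) Xs) = r ^ (q + 1) * \<omega> \<mu> Xs)"

text \<open>\<open>\<omega>\<close> vanishes on the images of the maps inserting a zero in one of the \<open>q + 1\<close> slots;
  the last slot is the one of the dual of \<open>k\<close>.\<close>

definition simple_cochain :: "('m, 'e::real_normed_vector, 'a, 'd::real_normed_vector) vbundle \<Rightarrow> 'a set
    \<Rightarrow> nat \<Rightarrow> nat \<Rightarrow> ('m, 'e, 'a, 'd) cochain \<Rightarrow> bool" where
  "simple_cochain A k p q \<omega> \<longleftrightarrow> (\<forall>ws x \<zeta>. (ws, x, \<zeta>) \<in> Mq A k q \<longrightarrow>
     (\<forall>Xs\<in>Aq_tuples A k p q (ws, x, \<zeta>).
        (\<forall>i<q. ws ! i = tzero x \<and> (\<forall>(Ys, a, _)\<in>set Xs. Ys ! i = tzero a) \<longrightarrow> \<omega> (ws, x, \<zeta>) Xs = 0) \<and>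
        (\<zeta> = (\<lambda>\<xi>. 0) \<longrightarrow> \<omega> (ws, x, \<zeta>) Xs = 0)))"

definition ext_cochains :: "('m, 'e::real_normed_vector, 'a, 'e \<times> 'f::real_normed_vector) vbundle \<Rightarrow> 'a set
    \<Rightarrow> nat \<Rightarrow> nat \<Rightarrow> ('m, 'e, 'a, 'e \<times> 'f) cochain set" where
  "ext_cochains A k p q = {\<omega>. multilinear_alternating A k p q \<omega> \<and> smooth_cochain A k p q \<omega> \<and>
     skew_cochain A k p q \<omega> \<and> homogeneous_cochain A k p q \<omega> \<and> simple_cochain A k p q \<omega>}"

definition hor_ext :: "('m, 'e::real_normed_vector, 'a, 'e \<times> 'f::real_normed_vector) vbundle
    \<Rightarrow> ('m, 'e, 'b, 'e \<times> 'g::real_normed_vector) vbundle \<Rightarrow> ('a \<Rightarrow> 'b) \<Rightarrow> ('a, 'e \<times> 'f) tvec set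
    \<Rightarrow> ('m, 'e, 'a, 'e \<times> 'f) cochain \<Rightarrow> ('m, 'e, 'a, 'e \<times> 'f) cochain" where
  "hor_ext A Q \<phi> E \<omega> = (\<lambda>\<mu> Xs. \<omega> \<mu> (map (apfst (map (hor_TA A Q \<phi> E))) Xs))"

section \<open>Weil cochains\<close>

text \<open>A Weil cochain \<open>c\<close> is evaluated as \<open>c j \<alpha>s x \<beta>s ws\<close>, an element of the fibre of \<open>k\<close> at \<open>x\<close>, where
  \<open>\<alpha>s\<close> is a list of \<open>p - j\<close> sections of \<open>A\<close>, \<open>\<beta>s\<close> a list of \<open>j\<close> elements of the fibre of \<open>A\<close> at \<open>x\<close>
  and \<open>ws\<close> a list of \<open>q - j\<close> tangent vectors at \<open>x\<close> (the empty list if \<open>j > q\<close>, where the form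
  has negative degree and the value is zero). Outside of such arguments the value is \<open>undefined\<close>.\<close>

type_synonym ('m, 'e, 'a) weil = "nat \<Rightarrow> ('m \<Rightarrow> 'a) list \<Rightarrow> 'm \<Rightarrow> 'a list \<Rightarrow> ('m, 'e) tvec list \<Rightarrow> 'a"

definition weil_args :: "('m, 'e::real_normed_vector, 'a, 'd::real_normed_vector) vbundle \<Rightarrow> nat \<Rightarrow> nat
    \<Rightarrow> nat \<Rightarrow> ('m \<Rightarrow> 'a) list \<Rightarrow> 'm \<Rightarrow> 'a list \<Rightarrow> ('m, 'e) tvec list \<Rightarrow> bool" where
  "weil_args A p q j \<alpha>s x \<beta>s ws \<longleftrightarrow> j \<le> p \<and> length \<alpha>s = p - j \<and> set \<alpha>s \<subseteq> sections A \<and>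
     x \<in> points (base A) \<and> length \<beta>s = j \<and> set \<beta>s \<subseteq> fibre A x \<and>
     length ws = q - j \<and> set ws \<subseteq> {w \<in> tangent (base A). fst w = x}"

text \<open>The identification of linear functions on the dual of the fibre of \<open>k\<close> with elements of the fibre.\<close>

definition bidual_elem :: "('m, 'e, 'a, 'd) vbundle \<Rightarrow> 'a set \<Rightarrow> 'm \<Rightarrow> (('a \<Rightarrow> real) \<Rightarrow> real) \<Rightarrow> 'a" where
  "bidual_elem A k x F = (THE \<xi>. \<xi> \<in> k \<and> proj A \<xi> = x \<and> (\<forall>\<zeta>\<in>k_dual A k x. \<zeta> \<xi> = F \<zeta>))"

definition T_lift :: "('m, 'e::real_normed_vector, 'a, 'd::real_normed_vector) vbundle
    \<Rightarrow> ('m \<Rightarrow> 'a) \<Rightarrow> ('m, 'e, 'a) Mq_point \<Rightarrow> ('a, 'd) Aq_point" where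
  "T_lift A \<alpha> = (\<lambda>(ws, x, \<zeta>). (map (differential (base A) (total A) \<alpha>) ws, \<alpha> x, \<zeta>))"

definition Z_lift :: "('m, 'e::real_normed_vector, 'a, 'e \<times> 'f::real_normed_vector) vbundle \<Rightarrow> nat
    \<Rightarrow> 'a \<Rightarrow> ('m, 'e, 'a) Mq_point \<Rightarrow> ('a, 'e \<times> 'f) Aq_point" where
  "Z_lift A i \<beta> = (\<lambda>(ws, x, \<zeta>).
     (map (\<lambda>l. if l = i then tadd (zero (TA_over_TM A) (ws ! l)) (core_vec A \<beta>)
               else zero (TA_over_TM A) (ws ! l)) [0..<length ws],
      zero A x, \<zeta>))"

definition ev :: "('m, 'e::real_normed_vector, 'a, 'e \<times> 'f::real_normed_vector) vbundle \<Rightarrow> 'a set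
    \<Rightarrow> nat \<Rightarrow> nat \<Rightarrow> ('m, 'e, 'a, 'e \<times> 'f) cochain \<Rightarrow> ('m, 'e, 'a) weil" where
  "ev A k p q \<omega> = (\<lambda>j \<alpha>s x \<beta>s ws. if weil_args A p q j \<alpha>s x \<beta>s ws
     then if j \<le> q
       then bidual_elem A k x (\<lambda>\<zeta>.
         let \<mu> = (replicate j (tzero x) @ ws, x, \<zeta>)
         in \<omega> \<mu> (map (\<lambda>i. Z_lift A i (\<beta>s ! i) \<mu>) [0..<j] @ map (\<lambda>\<alpha>. T_lift A \<alpha> \<mu>) \<alpha>s))
       else zero A x
     else undefined)"

text \<open>Finite sums in a fibre, as products of the additive monoid of the fibre.\<close>

definition fibre_sum :: "('b, 'e, 't, 'd) vbundle \<Rightarrow> 'b \<Rightarrow> ('i \<Rightarrow> 't) \<Rightarrow> 'i set \<Rightarrow> 't" where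
  "fibre_sum V x f I = finprod \<lparr>carrier = fibre V x, monoid.mult = add V, one = zero V x\<rparr> f I"

text \<open>The value at \<open>x\<close> of the product of an \<open>m\<close>-form \<open>\<gamma>\<close> with values in symmetric multilinear maps and a list
  of one-forms \<open>\<theta>s\<close>, evaluated on the tangent vectors \<open>ws\<close>.\<close>

definition wedge_dot :: "('m, 'e, 'a, 'd) vbundle \<Rightarrow> 'm \<Rightarrow> nat \<Rightarrow> ('a list \<Rightarrow> ('m, 'e) tvec list \<Rightarrow> 'a)
    \<Rightarrow> (('m, 'e) tvec \<Rightarrow> 'a) list \<Rightarrow> ('m, 'e) tvec list \<Rightarrow> 'a" where
  "wedge_dot A x m \<gamma> \<theta>s ws = (let l = length \<theta>s in
     scl A (1 / fact m) (fibre_sum A x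
       (\<lambda>\<sigma>. scl A (of_int (sign \<sigma>))
          (\<gamma> (map (\<lambda>i. (\<theta>s ! i) (ws ! \<sigma> i)) [0..<l]) (map (\<lambda>i. ws ! \<sigma> i) [l..<l + m])))
       {\<sigma>. \<sigma> permutes {..<m + l}}))"

definition shuffle_perms :: "nat \<Rightarrow> nat \<Rightarrow> (nat \<Rightarrow> nat) set" where
  "shuffle_perms a b = {\<sigma>. \<sigma> permutes {..<a + b} \<and> strict_mono_on {..<a} \<sigma> \<and> strict_mono_on {a..<a + b} \<sigma>}"

text \<open>The summands with \<open>i > q\<close> vanish, since \<open>c i\<close> is a form of negative degree \<open>q - i\<close>.\<close>

definition hor_weil :: "('m, 'e::real_normed_vector, 'a, 'd::real_normed_vector) vbundle
    \<Rightarrow> (('m \<Rightarrow> 'a) \<Rightarrow> ('m, 'e) tvec \<Rightarrow> 'a) \<Rightarrow> ('a \<Rightarrow> 'a) \<Rightarrow> nat \<Rightarrow> nat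
    \<Rightarrow> ('m, 'e, 'a) weil \<Rightarrow> ('m, 'e, 'a) weil" where
  "hor_weil A C v p q c = (\<lambda>j \<alpha>s x \<beta>s ws. if weil_args A p q j \<alpha>s x \<beta>s ws
     then fibre_sum A x (\<lambda>i. if i \<le> q
         then scl A ((-1) ^ (i - j)) (fibre_sum A x
           (\<lambda>\<sigma>. scl A (of_int (sign \<sigma>))
              (wedge_dot A x (q - i)
                 (\<lambda>\<xi>s. c i (map (\<lambda>n. \<alpha>s ! \<sigma> n) [i - j..<p - j]) x
                          (map (\<lambda>\<beta>. add A \<beta> (scl A (-1) (v \<beta>))) \<beta>s @ \<xi>s))
                 (map (\<lambda>n. C (\<alpha>s ! \<sigma> n)) [0..<i - j]) ws))
           (shuffle_perms (i - j) (p - i)))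
         else zero A x) {j..p}
     else undefined)"

end

theory Submission
  imports Defs "HOL-Library.Function_Algebras"
begin

text \<open>
  Fix a point of the base and a bundle chart of \<open>A\<close> around its fibre. There the horizontal
  projection of the section lift of \<open>\<alpha>\<close> is that lift minus the sum, over the slots \<open>l\<close>, of the
  core sections \<open>Z_l (C \<alpha> w_l)\<close>, and the projection of \<open>Z_l \<beta>\<close> is \<open>Z_l (\<beta> - v \<beta>)\<close>, because
  the zero vectors over \<open>TM\<close> lie in \<open>E\<close>. Expanding the alternating form \<open>\<omega>\<close> over the subsets of
  rows in which the core part is chosen gives the sum over shuffles, and expanding the core parts over
  the slots gives the sum over permutations in the wedge product.

  That terms with two core sections in one slot vanish, and that a slot occupied by a core section may
  be emptied otherwise, follows from additivity in each slot: a smooth function of \<open>q + 1\<close> slots which is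
  homogeneous of degree \<open>q + 1\<close> and vanishes when one slot is zero is linear in each slot.
\<close>

subsection \<open>Finite-dimensional normed spaces\<close>

text \<open>Both sides take values in a fibre of the ideal, where \<open>ev\<close> is a definite
  description and sums are products in a monoid. Pairing with an arbitrary functional \<zeta> turns
  the claim into an identity of real numbers, and the expansion takes place there. That the
  described element exists is again slot-wise linearity, applied to the slot of the dual. Smoothness
  of a cochain is given on spaces of bounded sequences, in general infinite-dimensional, so the
  passage from homogeneity to linearity is done in arbitrary normed spaces. It differentiates twice
  in one slot: the result has degree \<open>q - 1\<close> and still vanishes whenever one of the
  other \<open>q\<close> slots is empty, which forces it to be zero. The factor
  \<open>1 / m!\<close> of the wedge product counts the permutations extending a given placement of
  the core parts in distinct slots. With more core parts than slots there is no placement, in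
  accordance with forms of negative degree being zero. The signs of the permutations come from
  skew-symmetry in the tangent slots, those of the shuffles from alternation in the rows.\<close>

lemma dist_span_bound:
  fixes b :: "'a::real_normed_vector"
  assumes cl: "closed S" and sub: "subspace S" and b: "b \<notin> S"
  shows "\<exists>\<delta>>0. \<forall>c. \<forall>y\<in>S. \<bar>c\<bar> * \<delta> \<le> norm (c *\<^sub>R b + y)"
proof -
  from cl b obtain \<delta> where "\<delta> > 0" "ball b \<delta> \<subseteq> - S"
    by (metis ComplI open_Compl open_contains_ball)
  then have \<delta>: "\<delta> > 0" "\<And>y. y \<in> S \<Longrightarrow> \<delta> \<le> dist b y" by (auto simp: subset_iff not_less)
  show ?thesis
  proof (intro exI[of _ \<delta>] conjI allI ballI)
    show "\<delta> > 0" by fact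
    fix c :: real and y assume y: "y \<in> S"
    show "\<bar>c\<bar> * \<delta> \<le> norm (c *\<^sub>R b + y)"
    proof (cases "c = 0")
      case False
      \<comment> \<open>For nonzero \<open>c\<close>, the vector \<open>c b + y\<close> is
        \<open>c\<close> times the difference of \<open>b\<close> and the element
        \<open>(-1 / c) y\<close> of the subspace, so the distance from \<open>b\<close> to the
        subspace gives the bound.\<close>
      have "(-1 / c) *\<^sub>R y \<in> S" using sub y by (rule subspace_scale)
      then have "\<delta> \<le> norm (b + (1 / c) *\<^sub>R y)" using \<delta>(2)[of "(-1 / c) *\<^sub>R y"] by (simp add: dist_norm)
      then have "\<bar>c\<bar> * \<delta> \<le> \<bar>c\<bar> * norm (b + (1 / c) *\<^sub>R y)" by (simp add: mult_left_mono)
      also have "\<dots> = norm (c *\<^sub>R (b + (1 / c) *\<^sub>R y))" by simp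
      also have "c *\<^sub>R (b + (1 / c) *\<^sub>R y) = c *\<^sub>R b + y" using False by (simp add: scaleR_add_right)
      finally show ?thesis .
    qed simp
  qed
qed

text \<open>Along a convergent sequence the coefficients of the new vector \<open>b\<close> are
  Cauchy by \<open>dist_span_bound\<close>, so the remainders converge as well, and their limit
  stays in the span that is closed by induction.\<close>

lemma closed_span_finite:
  fixes B :: "'a::real_normed_vector set"
  assumes "finite B"
  shows "closed (span B)"
  using assms
proof (induction B)
  case (insert b B)
  show ?case
  proof (cases "b \<in> span B")
    case True
    then show ?thesis using insert.IH by (simp add: span_redundant)
  next
    case False
    obtain \<delta> where \<delta>: "\<delta> > 0" "\<And>c y. y \<in> span B \<Longrightarrow> \<bar>c\<bar> * \<delta> \<le> norm (c *\<^sub>R b + y)"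
      using dist_span_bound[OF insert.IH subspace_span False] by blast
    show ?thesis
    proof (unfold closed_sequential_limits, intro allI impI, elim conjE)
      fix s l assume s: "\<forall>n. s n \<in> span (insert b B)" and l: "s \<longlonglongrightarrow> l"
      then have "\<forall>n. \<exists>c. s n - c *\<^sub>R b \<in> span B" by (simp add: span_insert)
      then obtain c where c: "\<And>n. s n - c n *\<^sub>R b \<in> span B" by metis
      have bd: "\<bar>c m - c n\<bar> * \<delta> \<le> norm (s m - s n)" for m n
      proof -
        have "(s m - c m *\<^sub>R b) - (s n - c n *\<^sub>R b) \<in> span B" by (intro span_diff c)
        moreover have "(c m - c n) *\<^sub>R b + ((s m - c m *\<^sub>R b) - (s n - c n *\<^sub>R b)) = s m - s n"
          by (simp add: scaleR_diff_left)
        ultimately show ?thesis using \<delta>(2) by metis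
      qed
      have "Cauchy c"
      proof (rule metric_CauchyI)
        fix e :: real assume "e > 0"
        then have "e * \<delta> > 0" using \<delta> by simp
        from metric_CauchyD[OF LIMSEQ_imp_Cauchy[OF l] this]
        obtain M where M: "\<And>m n. m \<ge> M \<Longrightarrow> n \<ge> M \<Longrightarrow> dist (s m) (s n) < e * \<delta>" by blast
        have "\<bar>c m - c n\<bar> * \<delta> < e * \<delta>" if "m \<ge> M" "n \<ge> M" for m n
          using bd[of m n] M[OF that] by (simp add: dist_norm)
        then have "dist (c m) (c n) < e" if "m \<ge> M" "n \<ge> M" for m n
          using that \<delta>(1) by (simp add: dist_real_def)
        then show "\<exists>M. \<forall>m\<ge>M. \<forall>n\<ge>M. dist (c m) (c n) < e" by blast
      qed
      then obtain c' where c': "c \<longlonglongrightarrow> c'" using Cauchy_convergent convergent_def by metis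
      have "(\<lambda>n. s n - c n *\<^sub>R b) \<longlonglongrightarrow> l - c' *\<^sub>R b" by (intro tendsto_intros l c')
      then have "l - c' *\<^sub>R b \<in> span B" using closed_sequentially[OF insert.IH c] by simp
      then show "l \<in> span (insert b B)" by (auto simp: span_insert)
    qed
  qed
qed simp

text \<open>Induction over the spanning set: \<open>dist_span_bound\<close> controls the coefficient
  of the new vector by the norm of the sum, and the remainder falls to the induction
  hypothesis.\<close>

lemma linear_bounded_on_span:
  fixes f :: "'a::real_normed_vector \<Rightarrow> real" and B :: "'a set"
  assumes "finite B" "linear f"
  shows "\<exists>K. \<forall>x\<in>span B. \<bar>f x\<bar> \<le> K * norm x"
  using assms(1)
proof (induction B)
  case empty
  then show ?case using linear_0[OF assms(2)] by auto
next
  case (insert b B)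
  show ?case
  proof (cases "b \<in> span B")
    case True
    then show ?thesis using insert.IH by (simp add: span_redundant)
  next
    case False
    obtain \<delta> where \<delta>: "\<delta> > 0" "\<And>c y. y \<in> span B \<Longrightarrow> \<bar>c\<bar> * \<delta> \<le> norm (c *\<^sub>R b + y)"
      using dist_span_bound[OF closed_span_finite[OF insert.hyps(1)] subspace_span False] by blast
    obtain K where K: "\<forall>x\<in>span B. \<bar>f x\<bar> \<le> K * norm x" using insert.IH by blast
    \<comment> \<open>The first part of the constant comes from the \<open>b\<close>-component,
      whose coefficient is at most \<open>norm x / \<delta>\<close>; the second from the remainder,
      of norm at most \<open>(1 + norm b / \<delta>) * norm x\<close>. The absolute value of
      \<open>K\<close> appears because the induction hypothesis says nothing about its sign.\<close>
    have "\<bar>f x\<bar> \<le> (\<bar>f b\<bar> / \<delta> + \<bar>K\<bar> * (1 + norm b / \<delta>)) * norm x" if "x \<in> span (insert b B)" for x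
    proof -
      from that obtain c where c: "x - c *\<^sub>R b \<in> span B" by (auto simp: span_insert)
      have 1: "\<bar>c\<bar> \<le> norm x / \<delta>" using \<delta>(2)[OF c, of c] \<delta>(1) by (simp add: field_simps)
      have "f x = c * f b + f (x - c *\<^sub>R b)"
        using assms(2) by (simp add: linear_diff linear_scale)
      then have "\<bar>f x\<bar> \<le> \<bar>c\<bar> * \<bar>f b\<bar> + \<bar>f (x - c *\<^sub>R b)\<bar>" by (metis abs_mult abs_triangle_ineq)
      also have "\<bar>f (x - c *\<^sub>R b)\<bar> \<le> K * norm (x - c *\<^sub>R b)" using K c by blast
      also have "\<dots> \<le> \<bar>K\<bar> * norm (x - c *\<^sub>R b)" by (simp add: mult_right_mono)
      also have "norm (x - c *\<^sub>R b) \<le> norm x + \<bar>c\<bar> * norm b" by (metis norm_scaleR norm_triangle_ineq4)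
      also have "\<bar>c\<bar> * \<bar>f b\<bar> + \<bar>K\<bar> * (norm x + \<bar>c\<bar> * norm b)
          \<le> (norm x / \<delta>) * \<bar>f b\<bar> + \<bar>K\<bar> * (norm x + (norm x / \<delta>) * norm b)"
        by (intro add_mono mult_mono 1 order_refl) (use \<delta>(1) in auto)
      also have "\<dots> = (\<bar>f b\<bar> / \<delta> + \<bar>K\<bar> * (1 + norm b / \<delta>)) * norm x"
        by (simp add: algebra_simps)
      finally show ?thesis by (simp add: mult_left_mono)
    qed
    then show ?thesis by blast
  qed
qed

text \<open>Allows an algebraic functional on the typical fibre to serve as the bounded functional
  \<open>L\<close> among the coordinates of a cochain.\<close>

lemma linear_imp_bounded_linear_finite_span:
  fixes f :: "'a::real_normed_vector \<Rightarrow> real" and B :: "'a set"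
  assumes "finite B" "span B = UNIV" "linear f"
  shows "bounded_linear f"
proof -
  obtain K where "\<forall>x\<in>span B. \<bar>f x\<bar> \<le> K * norm x" using linear_bounded_on_span[OF assms(1,3)] by blast
  then show ?thesis using assms
    by (intro bounded_linear_intro[of f K]) (auto simp: linear_add linear_scale mult.commute)
qed

subsection \<open>Smooth homogeneous functions\<close>

text \<open>The derivative of the composition in direction \<open>v\<close> is the derivative of
  \<open>f\<close> in direction \<open>l v\<close>, composed with the same affine map. Hence the
  induction is over all \<open>f\<close>. As the affine map never leaves \<open>S\<close>, the
  result is smooth on the whole space.\<close>

lemma Ck_on_compose_affine:
  fixes l :: "'a::real_normed_vector \<Rightarrow> 'b::real_normed_vector"
    and f :: "'b \<Rightarrow> 'c::real_normed_vector"
  assumes "Ck_on n S f" and l: "bounded_linear l" and S: "\<And>u. l u + p \<in> S"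
  shows "Ck_on n UNIV (\<lambda>u. f (l u + p))"
  using assms(1)
proof (induction n arbitrary: f)
  case 0
  then have "continuous_on S f" by simp
  moreover have "continuous_on UNIV (\<lambda>u. l u + p)"
    using l by (intro continuous_intros linear_continuous_on)
  ultimately have "continuous_on UNIV (\<lambda>u. f (l u + p))"
    by (rule continuous_on_compose2) (use S in auto)
  then show ?case by simp
next
  case (Suc n)
  have hd: "((\<lambda>u. f (l u + p)) has_derivative (\<lambda>v. frechet_derivative f (at (l u + p)) (l v))) (at u)" for u
  proof -
    have 1: "((\<lambda>u. l u + p) has_derivative l) (at u)"
      using bounded_linear.has_derivative[OF l has_derivative_ident] by (auto intro!: derivative_eq_intros)
    have "(f has_derivative frechet_derivative f (at (l u + p))) (at (l u + p))"
      using Suc.prems S frechet_derivative_works by fastforce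
    from has_derivative_compose[OF 1 this] show ?thesis by simp
  qed
  have "frechet_derivative (\<lambda>u. f (l u + p)) (at u) v = frechet_derivative f (at (l u + p)) (l v)" for u v
    using frechet_derivative_at[OF hd] by metis
  moreover have "Ck_on n UNIV (\<lambda>u. frechet_derivative f (at (l u + p)) (l v))" for v
    using Suc.IH[of "\<lambda>x. frechet_derivative f (at x) (l v)"] Suc.prems by simp
  moreover have "(\<lambda>u. f (l u + p)) differentiable at u" for u using hd[of u] unfolding differentiable_def by blast
  ultimately show ?case by simp
qed

lemma smooth_on_compose_affine:
  assumes "smooth_on S f" "bounded_linear l" "\<And>u. l u + p \<in> S"
  shows "smooth_on UNIV (\<lambda>u. f (l u + p))"
  using assms Ck_on_compose_affine unfolding smooth_on_def by blast

lemma smooth_on_has_derivative: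
  assumes "smooth_on UNIV h"
  shows "(h has_derivative frechet_derivative h (at x)) (at x)"
  using assms frechet_derivative_works unfolding smooth_on_def by (metis Ck_on.simps(2) UNIV_I)

lemma smooth_on_frechet_derivative:
  assumes "smooth_on UNIV h"
  shows "smooth_on UNIV (\<lambda>x. frechet_derivative h (at x) v)"
  using assms unfolding smooth_on_def by (metis Ck_on.simps(2))

lemma smooth_on_continuous:
  assumes "smooth_on UNIV h"
  shows "continuous_on UNIV h"
  using assms unfolding smooth_on_def by (metis Ck_on.simps(1))

lemma has_derivative_along_line:
  assumes "smooth_on UNIV h"
  shows "((\<lambda>t::real. h (y + t *\<^sub>R u)) has_derivative (\<lambda>s. s *\<^sub>R frechet_derivative h (at (y + t *\<^sub>R u)) u)) (at t)"
proof -
  have 1: "((\<lambda>t. y + t *\<^sub>R u) has_derivative (\<lambda>s. s *\<^sub>R u)) (at t)"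
    by (auto intro!: derivative_eq_intros)
  have "((\<lambda>t. h (y + t *\<^sub>R u)) has_derivative (\<lambda>s. frechet_derivative h (at (y + t *\<^sub>R u)) (s *\<^sub>R u))) (at t)"
    using has_derivative_compose[OF 1 smooth_on_has_derivative[OF assms]] .
  moreover have "linear (frechet_derivative h (at (y + t *\<^sub>R u)))"
    using smooth_on_has_derivative[OF assms] has_derivative_linear by blast
  ultimately show ?thesis by (simp add: linear_scale)
qed

lemma has_real_derivative_along_line:
  fixes h :: "'a::real_normed_vector \<Rightarrow> real"
  assumes "smooth_on UNIV h"
  shows "((\<lambda>t::real. h (y + t *\<^sub>R u)) has_field_derivative frechet_derivative h (at (y + t *\<^sub>R u)) u) (at t)"
  using has_derivative_along_line[OF assms] by (simp add: has_field_derivative_def mult_commute_abs)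

text \<open>Differentiating the homogeneity equation in \<open>x\<close> puts one factor
  \<open>r\<close> inside the derivative; cancelling it lowers the degree by one.\<close>

lemma homogeneous_frechet_derivative:
  fixes h :: "'a::real_normed_vector \<Rightarrow> real"
  assumes h: "smooth_on UNIV h" and hom: "\<And>r x. r > 0 \<Longrightarrow> h (r *\<^sub>R x) = r ^ Suc m * h x" and "r > 0"
  shows "frechet_derivative h (at (r *\<^sub>R x)) v = r ^ m * frechet_derivative h (at x) v"
proof -
  have 1: "((\<lambda>x. r *\<^sub>R x) has_derivative (\<lambda>x. r *\<^sub>R x)) (at x)" by (auto intro!: derivative_eq_intros)
  have "((\<lambda>x. h (r *\<^sub>R x)) has_derivative (\<lambda>v. frechet_derivative h (at (r *\<^sub>R x)) (r *\<^sub>R v))) (at x)"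
    using has_derivative_compose[OF 1 smooth_on_has_derivative[OF h]] .
  moreover have "((\<lambda>x. h (r *\<^sub>R x)) has_derivative (\<lambda>v. r ^ Suc m * frechet_derivative h (at x) v)) (at x)"
    unfolding hom[OF \<open>r > 0\<close>] by (intro has_derivative_mult_right smooth_on_has_derivative h)
  ultimately have "frechet_derivative h (at (r *\<^sub>R x)) (r *\<^sub>R v) = r ^ Suc m * frechet_derivative h (at x) v"
    using has_derivative_unique by (metis (no_types, lifting))
  moreover have "linear (frechet_derivative h (at (r *\<^sub>R x)))"
    using smooth_on_has_derivative[OF h] has_derivative_linear by blast
  ultimately show ?thesis using \<open>r > 0\<close> by (simp add: linear_scale)
qed

text \<open>The case of degree zero: \<open>h\<close> is constant on each open ray, and continuity
  at the origin determines the constant.\<close>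

lemma homogeneous_at_zero:
  fixes h :: "'a::real_normed_vector \<Rightarrow> real"
  assumes h: "smooth_on UNIV h" and hom: "\<And>r x. r > 0 \<Longrightarrow> h (r *\<^sub>R x) = h x"
  shows "h x = h 0"
proof -
  have "continuous_on UNIV (\<lambda>r::real. h (r *\<^sub>R x))"
    by (rule continuous_on_compose2[OF smooth_on_continuous[OF h]]) (auto intro!: continuous_intros)
  then have "isCont (\<lambda>r. h (r *\<^sub>R x)) 0" by (simp add: continuous_on_eq_continuous_at)
  then have 1: "((\<lambda>r. h (r *\<^sub>R x)) \<longlongrightarrow> h 0) (at_right 0)"
    unfolding isCont_def using filterlim_at_split by fastforce
  have "eventually (\<lambda>r. h (r *\<^sub>R x) = h x) (at_right 0)"
    using eventually_at_right_less[of "0::real"] by eventually_elim (rule hom)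
  then have 2: "((\<lambda>r. h (r *\<^sub>R x)) \<longlongrightarrow> h x) (at_right 0)" by (rule tendsto_eventually)
  show ?thesis using tendsto_unique[OF _ 2 1] by simp
qed

lemma zero_derivative_unit_interval:
  fixes g :: "real \<Rightarrow> real"
  assumes "\<And>t. (g has_field_derivative 0) (at t)"
  shows "g 1 = g 0"
  using DERIV_isconst_all assms by blast

text \<open>Differentiating in a direction of one of the slots \<open>W i\<close> lowers the degree by one and
  preserves the vanishing in all the other slots.\<close>

lemma homogeneous_vanishing:
  fixes h :: "'a::real_normed_vector \<Rightarrow> real"
  assumes "smooth_on UNIV h" and "\<And>r x. r > 0 \<Longrightarrow> h (r *\<^sub>R x) = r ^ m * h x"
    and "J \<subseteq> I" "finite J" "card J > m"
    and "\<And>i x. i \<in> J \<Longrightarrow> x \<in> span (\<Union>l\<in>I - {i}. W l) \<Longrightarrow> h x = 0"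
    and "x \<in> span (\<Union>l\<in>I. W l)"
  shows "h x = 0"
  using assms
proof (induction m arbitrary: h J x)
  case 0
  obtain i where "i \<in> J" using 0 by fastforce
  then have "h 0 = 0" by (rule 0(6)) (rule span_zero)
  then show ?case using homogeneous_at_zero[of h x] 0 by simp
next
  case (Suc m)
  let ?D = "\<lambda>v x. frechet_derivative h (at x) v"
  have lin: "linear (\<lambda>v. ?D v y)" for y
    using smooth_on_has_derivative[OF Suc.prems(1)] has_derivative_linear by blast
  have slot: "?D u y = 0" if y: "y \<in> span (\<Union>l\<in>I. W l)" and l: "l \<in> I" and u: "u \<in> W l" for l u y
  proof (rule Suc.IH[where J = "J - {l}" and h = "?D u"])
    show "smooth_on UNIV (?D u)" by (intro smooth_on_frechet_derivative Suc.prems)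
    show "?D u (r *\<^sub>R x) = r ^ m * ?D u x" if "r > 0" for r x
      using homogeneous_frechet_derivative[OF Suc.prems(1,2) that] .
    show "J - {l} \<subseteq> I" using Suc.prems by blast
    show "finite (J - {l})" using Suc.prems by blast
    \<comment> \<open>The degree drops by exactly one and the set of slots by at most one, so the
      strict inequality survives.\<close>
    show "m < card (J - {l})" using Suc.prems(5) card_Diff_singleton_if[of J l] by (auto split: if_splits)
    show "y \<in> span (\<Union>l\<in>I. W l)" by fact
    fix i z assume i: "i \<in> J - {l}" and z: "z \<in> span (\<Union>l\<in>I - {i}. W l)"
    \<comment> \<open>As \<open>u\<close> belongs to a slot other than \<open>i\<close>, the line
      through \<open>z\<close> in direction \<open>u\<close> stays among the sums omitting slot
      \<open>i\<close>, where \<open>h\<close> vanishes.\<close>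
    have "u \<in> span (\<Union>l\<in>I - {i}. W l)" using l u i by (intro span_base) auto
    then have "z + t *\<^sub>R u \<in> span (\<Union>l\<in>I - {i}. W l)" for t using z by (intro span_add span_scale)
    then have "h (z + t *\<^sub>R u) = 0" for t by (rule Suc.prems(6)[of i, rotated]) (use i in simp)
    then have "((\<lambda>t. 0::real) has_field_derivative ?D u z) (at 0)"
      using has_real_derivative_along_line[OF Suc.prems(1), of z u 0] by simp
    then show "?D u z = 0" by (rule DERIV_unique[OF _ DERIV_const])
  qed
  have all: "?D v y = 0" if y: "y \<in> span (\<Union>l\<in>I. W l)" and v: "v \<in> span (\<Union>l\<in>I. W l)" for v y
  proof -
    have "subspace {v. ?D v y = 0}" using lin by (simp add: subspace_def linear_0 linear_add linear_scale)
    moreover have "(\<Union>l\<in>I. W l) \<subseteq> {v. ?D v y = 0}" using slot[OF y] by blast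
    ultimately show ?thesis using v span_minimal[of "\<Union>l\<in>I. W l" "{v. ?D v y = 0}"] by blast
  qed
  \<comment> \<open>All derivatives along the slots being zero, \<open>h\<close> is constant on the
    segment from \<open>0\<close> to \<open>x\<close>.\<close>
  have "((\<lambda>t. h (0 + t *\<^sub>R x)) has_field_derivative 0) (at t)" for t
    using has_real_derivative_along_line[OF Suc.prems(1), of 0 x t] all[of "t *\<^sub>R x" x] Suc.prems(7)
    by (simp add: span_scale)
  from zero_derivative_unit_interval[OF this] have "h (0 + 1 *\<^sub>R x) = h (0 + 0 *\<^sub>R x)" .
  moreover obtain i where "i \<in> J" using Suc.prems by fastforce
  then have "h 0 = 0" by (rule Suc.prems(6)) (rule span_zero)
  ultimately show ?case by simp
qed

text \<open>The second derivative in the directions of one slot vanishes by the previous lemma.\<close>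

lemma homogeneous_slot_linear:
  fixes h :: "'a::real_normed_vector \<Rightarrow> real"
  assumes h: "smooth_on UNIV h" and hom: "\<And>r x. r > 0 \<Longrightarrow> h (r *\<^sub>R x) = r ^ card I * h x"
    and I: "finite I"
    and van: "\<And>i x. i \<in> I \<Longrightarrow> x \<in> span (\<Union>l\<in>I - {i}. W l) \<Longrightarrow> h x = 0"
    and i: "i \<in> I" and W: "subspace (W i)"
    and y: "y \<in> span (\<Union>l\<in>I - {i}. W l)" and u: "u \<in> W i" and u': "u' \<in> W i"
  shows "h (y + s *\<^sub>R u + t *\<^sub>R u') = s * h (y + u) + t * h (y + u')"
proof -
  let ?D = "\<lambda>v x. frechet_derivative h (at x) v"
  obtain n where n: "card I = Suc n" using i I by (metis card_Suc_Diff1)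
  have mono: "span (\<Union>l\<in>I - {j}. W l) \<subseteq> span (\<Union>l\<in>I. W l)" for j by (intro span_mono) auto
  have const: "?D u (z + w) = ?D u z" if u: "u \<in> W i" and w: "w \<in> W i" and z: "z \<in> span (\<Union>l\<in>I. W l)" for u w z
  proof -
    have sm: "smooth_on UNIV (?D u)" by (intro smooth_on_frechet_derivative h)
    have "frechet_derivative (?D u) (at x) w = 0" if x: "x \<in> span (\<Union>l\<in>I. W l)" for x
    \<comment> \<open>With a single slot, \<open>?D u\<close> has degree zero and is constant.
      Otherwise the second derivative has degree \<open>card I - 2\<close> and vanishes in each of
      the \<open>card I - 1\<close> slots other than \<open>i\<close>, just enough for
      \<open>homogeneous_vanishing\<close>.\<close>
    proof (cases n)
      case 0
      have "?D u x' = ?D u 0" for x'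
        using homogeneous_frechet_derivative[OF h hom[unfolded n], of _ _ u] 0 by (intro homogeneous_at_zero[OF sm]) auto
      then have "?D u = (\<lambda>_. ?D u 0)" by blast
      then show ?thesis by (metis frechet_derivative_const)
    next
      case (Suc m)
      show ?thesis
      proof (rule homogeneous_vanishing[where J = "I - {i}" and I = I and W = W and m = m and x = x
            and h = "\<lambda>x. frechet_derivative (?D u) (at x) w"])
        show "smooth_on UNIV (\<lambda>x. frechet_derivative (?D u) (at x) w)" by (intro smooth_on_frechet_derivative h)
        have "?D u (r *\<^sub>R x) = r ^ Suc m * ?D u x" if "r > 0" for r x
          using homogeneous_frechet_derivative[OF h hom[unfolded n] that] Suc by simp
        from homogeneous_frechet_derivative[OF sm this]
        show "frechet_derivative (?D u) (at (r *\<^sub>R x)) w = r ^ m * frechet_derivative (?D u) (at x) w" if "r > 0" for r x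
          using that by blast
        show "m < card (I - {i})" using n Suc I i by simp
        fix l z assume l: "l \<in> I - {i}" and z: "z \<in> span (\<Union>l'\<in>I - {l}. W l')"
        have uw: "u \<in> span (\<Union>l'\<in>I - {l}. W l')" "w \<in> span (\<Union>l'\<in>I - {l}. W l')"
          using u w l i by (auto intro!: span_base)
        have "?D u (z + t *\<^sub>R w) = 0" for t
        proof -
          have "h (z + t *\<^sub>R w + s *\<^sub>R u) = 0" for s
            by (rule van[of l]) (use l uw z in \<open>auto intro!: span_add span_scale\<close>)
          then have "((\<lambda>t. 0::real) has_field_derivative ?D u (z + t *\<^sub>R w)) (at 0)"
            using has_real_derivative_along_line[OF h, of "z + t *\<^sub>R w" u 0] by simp
          then show ?thesis by (rule DERIV_unique[OF _ DERIV_const])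
        qed
        then have "((\<lambda>t. 0::real) has_field_derivative frechet_derivative (?D u) (at z) w) (at 0)"
          using has_real_derivative_along_line[OF sm, of z w 0] by simp
        then show "frechet_derivative (?D u) (at z) w = 0" by (rule DERIV_unique[OF _ DERIV_const])
      qed (use I x in auto)
    qed
    note zero = this
    have wI: "w \<in> span (\<Union>l\<in>I. W l)" using w i by (intro span_base) auto
    have "((\<lambda>t. ?D u (z + t *\<^sub>R w)) has_field_derivative 0) (at t)" for t
      using has_real_derivative_along_line[OF sm, of z w t] zero[of "z + t *\<^sub>R w"] z wI
      by (simp add: span_add span_scale)
    from zero_derivative_unit_interval[OF this] have "?D u (z + 1 *\<^sub>R w) = ?D u (z + 0 *\<^sub>R w)" .
    then show ?thesis by simp
  qed
  \<comment> \<open>Since \<open>?D u\<close> does not change along slot \<open>i\<close>, the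
    Taylor expansion of first order in that slot is exact.\<close>
  have aff: "h (z + u) = h z + ?D u z" if u: "u \<in> W i" and z: "z \<in> span (\<Union>l\<in>I. W l)" for u z
  proof -
    have "((\<lambda>t. h (z + t *\<^sub>R u) - t * ?D u z) has_field_derivative 0) (at t)" for t
    proof -
      have "?D u (z + t *\<^sub>R u) = ?D u z" using const[OF u _ z] u W by (simp add: subspace_scale)
      then show ?thesis using has_real_derivative_along_line[OF h, of z u t]
        by (auto intro!: derivative_eq_intros)
    qed
    from zero_derivative_unit_interval[OF this]
    have "h (z + 1 *\<^sub>R u) - 1 * ?D u z = h (z + 0 *\<^sub>R u) - 0 * ?D u z" .
    then show ?thesis by simp
  qed
  have lin: "linear (\<lambda>v. ?D v y)"
    using smooth_on_has_derivative[OF h] has_derivative_linear by blast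
  have yI: "y \<in> span (\<Union>l\<in>I. W l)" using y mono by blast
  \<comment> \<open>The constant term \<open>h y\<close> is zero because \<open>y\<close> omits slot
    \<open>i\<close>, so that an affine dependence becomes a linear one.\<close>
  have hy: "h (y + v) = ?D v y" if "v \<in> W i" for v using aff[OF that yI] van[OF i y] by simp
  have "s *\<^sub>R u + t *\<^sub>R u' \<in> W i" using u u' W by (intro subspace_add subspace_scale)
  from hy[OF this] hy[OF u] hy[OF u'] show ?thesis
    using lin by (simp add: linear_add linear_scale add.assoc)
qed

subsection \<open>Tangent vectors in charts\<close>

definition chart_compat :: "('p, 'e::real_normed_vector) chart \<Rightarrow> ('p, 'e) chart \<Rightarrow> bool" where
  "chart_compat c d \<longleftrightarrow> inj_on (snd c) (fst c) \<and> open (snd c ` (fst c \<inter> fst d)) \<and>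
     (\<forall>y\<in>snd c ` (fst c \<inter> fst d). (snd d \<circ> chart_inv c) differentiable (at y))"

text \<open>Differentiability of the transition maps suffices for the calculus of tangent vectors; this
  spares the verification that the Whitney sum has a smooth atlas.\<close>

definition diff_atlas :: "('p, 'e::real_normed_vector) chart set \<Rightarrow> bool" where
  "diff_atlas At \<longleftrightarrow> (\<forall>c\<in>At. \<forall>d\<in>At. chart_compat c d)"

definition trans_deriv :: "('p, 'e::real_normed_vector) chart \<Rightarrow> ('p, 'e) chart \<Rightarrow> 'p \<Rightarrow> 'e \<Rightarrow> 'e" where
  "trans_deriv c d p = frechet_derivative (snd d \<circ> chart_inv c) (at (snd c p))"

text \<open>The tangent vector at \<open>p\<close> with coordinate vector \<open>u\<close> in the
  chart \<open>c\<close>. The value \<open>0\<close> elsewhere is the normalization required by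
  \<open>tangent\<close>.\<close>

definition tvec :: "('p, 'e::real_normed_vector) chart set \<Rightarrow> ('p, 'e) chart \<Rightarrow> 'p \<Rightarrow> 'e \<Rightarrow> ('p, 'e) tvec" where
  "tvec At c p u = (p, \<lambda>d. if d \<in> At \<and> p \<in> fst d then trans_deriv c d p u else 0)"

text \<open>Coordinate maps and their inverses have arbitrary values outside their domains. The
  eventuality clause keeps a neighbourhood of the point within both charts; without it such
  derivatives could not be composed.\<close>

definition has_mderiv :: "('p \<Rightarrow> 'q) \<Rightarrow> ('p, 'e::real_normed_vector) chart \<Rightarrow> ('q, 'd::real_normed_vector) chart
    \<Rightarrow> 'p \<Rightarrow> ('e \<Rightarrow> 'd) \<Rightarrow> bool" where
  "has_mderiv f c d p D \<longleftrightarrow> p \<in> fst c \<and>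
     eventually (\<lambda>y. y \<in> snd c ` fst c \<and> f (chart_inv c y) \<in> fst d) (nhds (snd c p)) \<and>
     ((snd d \<circ> f \<circ> chart_inv c) has_derivative D) (at (snd c p))"

lemma smooth_on_differentiable:
  assumes "smooth_on S f" "x \<in> S"
  shows "f differentiable at x"
  using assms unfolding smooth_on_def by (metis Ck_on.simps(2))

lemma compatible_imp_chart_compat:
  assumes "inj_on (snd c) (fst c)" "compatible c d"
  shows "chart_compat c d"
  using assms smooth_on_differentiable unfolding compatible_def chart_compat_def by blast

lemma smooth_atlas_imp_diff_atlas: "smooth_atlas At \<Longrightarrow> diff_atlas At"
  unfolding smooth_atlas_def diff_atlas_def using compatible_imp_chart_compat by blast

lemma chart_compat_inj: "chart_compat c d \<Longrightarrow> inj_on (snd c) (fst c)"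
  by (simp add: chart_compat_def)

lemma chart_compat_inv: "chart_compat c d \<Longrightarrow> p \<in> fst c \<Longrightarrow> chart_inv c (snd c p) = p"
  by (simp add: chart_compat_def)

lemma trans_deriv_has_derivative:
  assumes "chart_compat c d" "p \<in> fst c" "p \<in> fst d"
  shows "((snd d \<circ> chart_inv c) has_derivative trans_deriv c d p) (at (snd c p))"
  using assms frechet_derivative_works unfolding chart_compat_def trans_deriv_def by blast

lemma linear_trans_deriv:
  assumes "chart_compat c d" "p \<in> fst c" "p \<in> fst d"
  shows "linear (trans_deriv c d p)"
  using trans_deriv_has_derivative[OF assms] has_derivative_linear by blast

lemma eventually_chart_overlap:
  assumes "chart_compat c d" "p \<in> fst c" "p \<in> fst d"
  shows "eventually (\<lambda>y. y \<in> snd c ` (fst c \<inter> fst d)) (nhds (snd c p))"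
  using assms unfolding chart_compat_def by (intro eventually_nhds_in_open) auto

lemma has_derivative_cong_nhds:
  assumes f: "(f has_derivative D) (at x)" and eq: "eventually (\<lambda>y. f y = g y) (nhds x)"
  shows "(g has_derivative D) (at x)"
proof (rule has_derivative_transform_eventually[OF f])
  show "eventually (\<lambda>y. f y = g y) (at x)" using eq by (simp add: eventually_at_filter eventually_mono)
  show "f x = g x" using eq by (rule eventually_nhds_x_imp_x)
qed simp

text \<open>For the structure maps of a bundle, whose coordinate expressions \<open>g\<close> are
  known on an entire bundle chart.\<close>

lemma has_mderiv_explicit:
  assumes c: "chart_compat c c" and p: "p \<in> fst c" and g: "(g has_derivative D) (at (snd c p))"
    and f: "\<And>z. z \<in> fst c \<Longrightarrow> f z \<in> fst d \<and> snd d (f z) = g (snd c z)"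
  shows "has_mderiv f c d p D"
proof -
  have ev: "eventually (\<lambda>y. y \<in> snd c ` (fst c \<inter> fst c)) (nhds (snd c p))"
    using eventually_chart_overlap[OF c p p] .
  have *: "y \<in> snd c ` fst c \<and> f (chart_inv c y) \<in> fst d \<and> g y = (snd d \<circ> f \<circ> chart_inv c) y"
    if y: "y \<in> snd c ` (fst c \<inter> fst c)" for y
  proof -
    from y obtain z where z: "z \<in> fst c" "y = snd c z" by blast
    show ?thesis using f[OF z(1)] z chart_compat_inv[OF c z(1)] by simp
  qed
  have "eventually (\<lambda>y. g y = (snd d \<circ> f \<circ> chart_inv c) y) (nhds (snd c p))"
    using ev by eventually_elim (use * in blast)
  from has_derivative_cong_nhds[OF g this] show ?thesis
    using p eventually_mono[OF ev, of "\<lambda>y. y \<in> snd c ` fst c \<and> f (chart_inv c y) \<in> fst d"] *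
    unfolding has_mderiv_def by blast
qed

lemma has_mderiv_id:
  assumes "chart_compat c d" "p \<in> fst c" "p \<in> fst d"
  shows "has_mderiv (\<lambda>x. x) c d p (trans_deriv c d p)"
proof -
  have "eventually (\<lambda>y. y \<in> snd c ` fst c \<and> chart_inv c y \<in> fst d) (nhds (snd c p))"
    using eventually_chart_overlap[OF assms]
    by eventually_elim (use chart_compat_inv[OF assms(1)] in auto)
  then show ?thesis using trans_deriv_has_derivative[OF assms] assms
    by (simp add: has_mderiv_def o_def)
qed

lemma has_mderiv_continuous:
  assumes "has_mderiv f c d p D" "chart_compat c c'" "open S" "snd d (f p) \<in> S"
  shows "eventually (\<lambda>y. snd d (f (chart_inv c y)) \<in> S) (nhds (snd c p))"
proof -
  have p: "p \<in> fst c" and D: "((snd d \<circ> f \<circ> chart_inv c) has_derivative D) (at (snd c p))"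
    using assms(1) by (auto simp: has_mderiv_def)
  from has_derivative_continuous[OF D]
  have "isCont (snd d \<circ> f \<circ> chart_inv c) (snd c p)" .
  then have "((snd d \<circ> f \<circ> chart_inv c) \<longlongrightarrow> (snd d \<circ> f \<circ> chart_inv c) (snd c p)) (nhds (snd c p))"
    by (simp only: isCont_def tendsto_at_iff_tendsto_nhds)
  from topological_tendstoD[OF this assms(3)] show ?thesis
    using chart_compat_inv[OF assms(2) p] assms(4) by simp
qed

lemma has_mderiv_compose:
  assumes f: "has_mderiv f c d p D" and g: "has_mderiv g d e (f p) D'"
    and c: "chart_compat c c'" and d: "chart_compat d d'"
  shows "has_mderiv (\<lambda>x. g (f x)) c e p (\<lambda>u. D' (D u))"
proof -
  have p: "p \<in> fst c" and fp: "f p \<in> fst d" using f g by (auto simp: has_mderiv_def)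
  \<comment> \<open>The neighbourhood condition for \<open>g\<close> is an open condition in the
    chart \<open>d\<close>; continuity of \<open>f\<close> in coordinates pulls it back to
    \<open>c\<close>.\<close>
  obtain S where S: "open S" "snd d (f p) \<in> S" "\<And>z. z \<in> S \<Longrightarrow> g (chart_inv d z) \<in> fst e"
    using g unfolding has_mderiv_def eventually_nhds by blast
  have ev: "eventually (\<lambda>y. y \<in> snd c ` fst c \<and> f (chart_inv c y) \<in> fst d) (nhds (snd c p))"
    using f by (simp add: has_mderiv_def)
  have 1: "eventually (\<lambda>y. y \<in> snd c ` fst c \<and> g (f (chart_inv c y)) \<in> fst e) (nhds (snd c p))"
    using ev has_mderiv_continuous[OF f c S(1,2)]
    by eventually_elim (use S(3) chart_compat_inv[OF d] in fastforce)
  have f': "((snd d \<circ> f \<circ> chart_inv c) has_derivative D) (at (snd c p))"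
    using f by (simp add: has_mderiv_def)
  have g': "((snd e \<circ> g \<circ> chart_inv d) has_derivative D') (at (snd d (f p)))"
    using g by (simp add: has_mderiv_def)
  then have "((snd e \<circ> g \<circ> chart_inv d) has_derivative D') (at ((snd d \<circ> f \<circ> chart_inv c) (snd c p)))"
    using chart_compat_inv[OF c p] by simp
  from has_derivative_compose[OF f' this]
  have 2: "((\<lambda>y. (snd e \<circ> g \<circ> chart_inv d) ((snd d \<circ> f \<circ> chart_inv c) y)) has_derivative (\<lambda>u. D' (D u)))
      (at (snd c p))" .
  have eq: "eventually (\<lambda>y. (snd e \<circ> g \<circ> chart_inv d) ((snd d \<circ> f \<circ> chart_inv c) y)
      = (snd e \<circ> (\<lambda>x. g (f x)) \<circ> chart_inv c) y) (nhds (snd c p))"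
    using ev by eventually_elim (use chart_compat_inv[OF d] in simp)
  have "((snd e \<circ> (\<lambda>x. g (f x)) \<circ> chart_inv c) has_derivative (\<lambda>u. D' (D u))) (at (snd c p))"
    by (rule has_derivative_cong_nhds[OF 2 eq])
  with 1 p show ?thesis by (simp add: has_mderiv_def)
qed

lemma has_mderiv_unique:
  assumes "has_mderiv f c d p D" "has_mderiv f c d p D'"
  shows "D = D'"
  using assms has_derivative_unique unfolding has_mderiv_def by blast

lemma has_mderiv_linear: "has_mderiv f c d p D \<Longrightarrow> linear D"
  using has_derivative_linear unfolding has_mderiv_def by blast

lemma has_mderiv_cong:
  assumes "has_mderiv f c d p D" "\<And>x. x \<in> fst c \<Longrightarrow> f x = g x" "chart_compat c c'"
  shows "has_mderiv g c d p D"
proof -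
  have ev: "eventually (\<lambda>y. y \<in> snd c ` fst c \<and> f (chart_inv c y) \<in> fst d) (nhds (snd c p))"
    using assms by (simp add: has_mderiv_def)
  then have 1: "eventually (\<lambda>y. y \<in> snd c ` fst c \<and> g (chart_inv c y) \<in> fst d) (nhds (snd c p))"
    by eventually_elim (use assms(2) in \<open>auto simp: inv_into_into\<close>)
  have f': "((snd d \<circ> f \<circ> chart_inv c) has_derivative D) (at (snd c p))" and p: "p \<in> fst c"
    using assms by (auto simp: has_mderiv_def)
  have eq: "eventually (\<lambda>y. (snd d \<circ> f \<circ> chart_inv c) y = (snd d \<circ> g \<circ> chart_inv c) y) (nhds (snd c p))"
    using ev by eventually_elim (use assms(2) in \<open>auto simp: inv_into_into\<close>)
  have "((snd d \<circ> g \<circ> chart_inv c) has_derivative D) (at (snd c p))"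
    by (rule has_derivative_cong_nhds[OF f' eq])
  with 1 p show ?thesis by (simp add: has_mderiv_def)
qed

text \<open>Both sides are the derivative of the identity map, read in the charts \<open>c\<close>
  and \<open>e\<close>.\<close>

lemma trans_deriv_compose:
  assumes "chart_compat c d" "chart_compat d e" "chart_compat c e" "p \<in> fst c" "p \<in> fst d" "p \<in> fst e"
  shows "trans_deriv d e p (trans_deriv c d p u) = trans_deriv c e p u"
proof -
  have "has_mderiv (\<lambda>x. x) c e p (\<lambda>u. trans_deriv d e p (trans_deriv c d p u))"
    using has_mderiv_compose[OF has_mderiv_id[OF assms(1,4,5)] has_mderiv_id[OF assms(2,5,6)] assms(1,2)] .
  from has_mderiv_unique[OF this has_mderiv_id[OF assms(3,4,6)]] show ?thesis by metis
qed

lemma trans_deriv_self: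
  assumes "chart_compat c c" "p \<in> fst c"
  shows "trans_deriv c c p u = u"
proof -
  have "eventually (\<lambda>y. y = (snd c \<circ> chart_inv c) y) (nhds (snd c p))"
    using eventually_chart_overlap[OF assms assms(2)]
    by eventually_elim (use chart_compat_inv[OF assms(1)] in auto)
  then have "((snd c \<circ> chart_inv c) has_derivative (\<lambda>u. u)) (at (snd c p))"
    by (rule has_derivative_cong_nhds[OF has_derivative_ident])
  with trans_deriv_has_derivative[OF assms assms(2)] show ?thesis
    using has_derivative_unique by metis
qed

lemma trans_deriv_inverse:
  assumes "chart_compat c d" "chart_compat d c" "chart_compat c c" "p \<in> fst c" "p \<in> fst d"
  shows "trans_deriv d c p (trans_deriv c d p u) = u"
  using trans_deriv_compose[OF assms(1-4)] trans_deriv_self assms by metis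

lemma fst_tvec [simp]: "fst (tvec At c p u) = p"
  by (simp add: tvec_def)

lemma tvec_in_tangent:
  assumes "diff_atlas At" "c \<in> At" "p \<in> fst c"
  shows "tvec At c p u \<in> tangent At"
proof -
  have v: "snd (tvec At c p u) d = trans_deriv c d p u" if "d \<in> At" "p \<in> fst d" for d
    using that by (simp add: tvec_def)
  show ?thesis
    unfolding tangent_def mem_Collect_eq fst_tvec
  proof (intro conjI ballI allI impI)
    show "p \<in> points At" using assms by (auto simp: points_def)
    show "snd (tvec At c p u) d = 0" if "d \<notin> At \<or> p \<notin> fst d" for d
      using that by (auto simp: tvec_def)
    fix d e assume de: "d \<in> At" "e \<in> At" "p \<in> fst d" "p \<in> fst e"
    have "trans_deriv c e p u = frechet_derivative (snd e \<circ> chart_inv d) (at (snd d p)) (trans_deriv c d p u)"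
      using trans_deriv_compose[of c d e p u] assms de
      by (simp add: diff_atlas_def trans_deriv_def[of d e])
    then show "snd (tvec At c p u) e
        = frechet_derivative (snd e \<circ> chart_inv d) (at (snd d p)) (snd (tvec At c p u) d)"
      unfolding v[OF de(1,3)] v[OF de(2,4)] .
  qed
qed

lemma tvec_coord:
  assumes "diff_atlas At" "c \<in> At" "p \<in> fst c"
  shows "snd (tvec At c p u) c = u"
  using trans_deriv_self[of c p u] assms by (simp add: tvec_def diff_atlas_def)

lemma tvec_eq_iff:
  assumes "diff_atlas At" "c \<in> At" "p \<in> fst c" "q \<in> fst c"
  shows "tvec At c p u = tvec At c q u' \<longleftrightarrow> p = q \<and> u = u'"
  using tvec_coord assms fst_tvec by metis

lemma tangent_eq_tvec:
  assumes "X \<in> tangent At" "c \<in> At" "fst X \<in> fst c"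
  shows "X = tvec At c (fst X) (snd X c)"
proof -
  have "snd X d = snd (tvec At c (fst X) (snd X c)) d" for d
  proof (cases "d \<in> At \<and> fst X \<in> fst d")
    case True
    then have "snd X d = trans_deriv c d (fst X) (snd X c)"
      using assms unfolding tangent_def trans_deriv_def by blast
    with True show ?thesis by (simp add: tvec_def)
  next
    case False
    then have "snd X d = 0" using assms unfolding tangent_def by blast
    with False show ?thesis by (auto simp: tvec_def)
  qed
  then have "snd X = snd (tvec At c (fst X) (snd X c))" ..
  then show ?thesis by (metis fst_tvec prod.collapse)
qed

lemma tadd_tvec:
  assumes "diff_atlas At" "c \<in> At" "p \<in> fst c"
  shows "tadd (tvec At c p u) (tvec At c p u') = tvec At c p (u + u')"
proof -
  have "trans_deriv c d p (u + u') = trans_deriv c d p u + trans_deriv c d p u'" if "d \<in> At" "p \<in> fst d" for d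
    using linear_trans_deriv[of c d p] linear_add assms that by (auto simp: diff_atlas_def)
  then show ?thesis by (auto simp: tadd_def tvec_def)
qed

lemma tscale_tvec:
  assumes "diff_atlas At" "c \<in> At" "p \<in> fst c"
  shows "tscale r (tvec At c p u) = tvec At c p (r *\<^sub>R u)"
proof -
  have "trans_deriv c d p (r *\<^sub>R u) = r *\<^sub>R trans_deriv c d p u" if "d \<in> At" "p \<in> fst d" for d
    using linear_trans_deriv[of c d p] linear_scale assms that by (auto simp: diff_atlas_def)
  then show ?thesis by (auto simp: tscale_def tvec_def)
qed

lemma tzero_eq_tvec:
  assumes "diff_atlas At" "c \<in> At" "p \<in> fst c"
  shows "tzero p = tvec At c p 0"
proof -
  have "trans_deriv c d p 0 = 0" if "d \<in> At" "p \<in> fst d" for d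
    using linear_trans_deriv[of c d p] linear_0 assms that by (auto simp: diff_atlas_def)
  then show ?thesis by (auto simp: tzero_def tvec_def)
qed

lemma tsub_tvec:
  assumes "diff_atlas At" "c \<in> At" "p \<in> fst c"
  shows "tsub (tvec At c p u) (tvec At c p u') = tvec At c p (u - u')"
  by (simp add: tsub_def tscale_tvec[OF assms] tadd_tvec[OF assms])

lemma has_mderiv_change_charts:
  assumes f: "has_mderiv f c d p D" and c: "chart_compat c' c" "chart_compat c c'" "p \<in> fst c'"
    and d: "chart_compat d e" "chart_compat d d'" "f p \<in> fst d" "f p \<in> fst e"
  shows "has_mderiv f c' e p (\<lambda>u. trans_deriv d e (f p) (D (trans_deriv c' c p u)))"
proof -
  have p: "p \<in> fst c" using f by (simp add: has_mderiv_def)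
  have "has_mderiv f c e p (\<lambda>u. trans_deriv d e (f p) (D u))"
    using has_mderiv_compose[OF f has_mderiv_id[OF d(1,3,4)] c(2) d(2)] .
  from has_mderiv_compose[OF has_mderiv_id[OF c(1,3) p] this c(1) c(2)] show ?thesis .
qed

lemma differential_tvec:
  assumes A: "diff_atlas At" and B: "diff_atlas Bt" and c: "c \<in> At" and d: "d \<in> Bt" and fp: "f p \<in> fst d"
    and f: "has_mderiv f c d p D"
  shows "differential At Bt f (tvec At c p u) = tvec Bt d (f p) (D u)"
proof -
  have p: "p \<in> fst c" using f by (simp add: has_mderiv_def)
  \<comment> \<open>This is the chart picked by the choice operator in \<open>differential\<close>.
    The transition to it and back cancels, so the result can be expressed in the given chart
    \<open>c\<close>.\<close>
  define c' where "c' = (SOME c. c \<in> At \<and> p \<in> fst c)"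
  have c': "c' \<in> At" "p \<in> fst c'"
    using someI[of "\<lambda>c. c \<in> At \<and> p \<in> fst c" c] c p unfolding c'_def by auto
  have comp: "chart_compat c c'" "chart_compat c' c" "chart_compat c c" using A c c' by (auto simp: diff_atlas_def)
  have *: "frechet_derivative (snd e \<circ> f \<circ> chart_inv c') (at (snd c' p)) (trans_deriv c c' p u)
      = trans_deriv d e (f p) (D u)" if e: "e \<in> Bt" "f p \<in> fst e" for e
  proof -
    have "has_mderiv f c' e p (\<lambda>u. trans_deriv d e (f p) (D (trans_deriv c' c p u)))"
      using B d e by (intro has_mderiv_change_charts[OF f comp(2,1) c'(2) _ _ fp, of e d]) (auto simp: diff_atlas_def)
    then have "((snd e \<circ> f \<circ> chart_inv c') has_derivative (\<lambda>u. trans_deriv d e (f p) (D (trans_deriv c' c p u)))) (at (snd c' p))"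
      by (simp add: has_mderiv_def)
    from frechet_derivative_at[OF this] show ?thesis
      using trans_deriv_inverse[OF comp p c'(2)] by metis
  qed
  have "differential At Bt f (tvec At c p u) = (f p, \<lambda>e. if e \<in> Bt \<and> f p \<in> fst e
      then frechet_derivative (snd e \<circ> f \<circ> chart_inv c') (at (snd c' p)) (trans_deriv c c' p u) else 0)"
    unfolding differential_def Let_def fst_tvec c'_def[symmetric] using c' by (simp add: tvec_def cong: if_cong)
  also have "\<dots> = tvec Bt d (f p) (D u)"
    using * by (auto simp: tvec_def)
  finally show ?thesis .
qed

lemma fst_differential: "fst (differential At Bt f X) = f (fst X)"
  by (simp add: differential_def Let_def)

text \<open>Smoothness is witnessed in some pair of charts around the point; a change of charts
  moves the derivative to the prescribed pair.\<close>

lemma smooth_map_has_mderiv: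
  assumes sm: "smooth_map At Bt W f" and p: "p \<in> W" and A: "diff_atlas At" and B: "diff_atlas Bt"
    and c: "c \<in> At" "p \<in> fst c" and d: "d \<in> Bt" "f p \<in> fst d"
  shows "\<exists>D. has_mderiv f c d p D"
proof -
  obtain c0 d0 N where 0: "c0 \<in> At" "d0 \<in> Bt" "p \<in> fst c0" "open N" "snd c0 p \<in> N" "N \<subseteq> snd c0 ` (fst c0 \<inter> W)"
    "f ` chart_inv c0 ` N \<subseteq> fst d0" "smooth_on N (snd d0 \<circ> f \<circ> chart_inv c0)"
    using sm p unfolding smooth_map_def by blast
  have compat: "chart_compat c0 c0" "chart_compat c0 c" "chart_compat c c0" "chart_compat d0 d" "chart_compat d0 d0"
    using A B 0 c d by (auto simp: diff_atlas_def)
  have "(snd d0 \<circ> f \<circ> chart_inv c0) differentiable at (snd c0 p)"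
    using 0 smooth_on_differentiable by blast
  then obtain D where D: "((snd d0 \<circ> f \<circ> chart_inv c0) has_derivative D) (at (snd c0 p))"
    by (auto simp: differentiable_def)
  have "eventually (\<lambda>y. y \<in> N) (nhds (snd c0 p))" using 0 by (intro eventually_nhds_in_open)
  then have "eventually (\<lambda>y. y \<in> snd c0 ` fst c0 \<and> f (chart_inv c0 y) \<in> fst d0) (nhds (snd c0 p))"
    by eventually_elim (use 0 in auto)
  with D 0 have f: "has_mderiv f c0 d0 p D" by (simp add: has_mderiv_def)
  have "f p \<in> fst d0" using 0(5,7) chart_compat_inv[OF compat(1) 0(3)] by force
  from has_mderiv_change_charts[OF f compat(3,2) c(2) compat(4,5) this d(2)] show ?thesis by blast
qed

lemma velocity_tvec:
  assumes A: "diff_atlas At" and d: "d \<in> At" and ev: "eventually (\<lambda>t. \<gamma> t \<in> fst d) (nhds 0)"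
    and u: "((snd d \<circ> \<gamma>) has_vector_derivative u) (at 0)"
  shows "velocity At \<gamma> = tvec At d (\<gamma> 0) u"
proof -
  have g0: "\<gamma> 0 \<in> fst d" using eventually_nhds_x_imp_x[OF ev] .
  have "vector_derivative (snd e \<circ> \<gamma>) (at 0) = trans_deriv d e (\<gamma> 0) u" if e: "e \<in> At" "\<gamma> 0 \<in> fst e" for e
  proof -
    have de: "chart_compat d e" using A d e by (simp add: diff_atlas_def)
    have "((snd d \<circ> \<gamma>) has_derivative (\<lambda>t. t *\<^sub>R u)) (at 0)"
      using u by (simp add: has_vector_derivative_def)
    moreover have "((snd e \<circ> chart_inv d) has_derivative trans_deriv d e (\<gamma> 0)) (at ((snd d \<circ> \<gamma>) 0))"
      using trans_deriv_has_derivative[OF de g0 e(2)] by simp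
    ultimately have 1: "((\<lambda>t. (snd e \<circ> chart_inv d) ((snd d \<circ> \<gamma>) t)) has_derivative
        (\<lambda>t. trans_deriv d e (\<gamma> 0) (t *\<^sub>R u))) (at 0)"
      by (rule has_derivative_compose)
    have eq: "eventually (\<lambda>t. (snd e \<circ> chart_inv d) ((snd d \<circ> \<gamma>) t) = (snd e \<circ> \<gamma>) t) (nhds 0)"
      using ev by eventually_elim (use chart_compat_inv[OF de] in simp)
    have "((snd e \<circ> \<gamma>) has_derivative (\<lambda>t. trans_deriv d e (\<gamma> 0) (t *\<^sub>R u))) (at 0)"
      by (rule has_derivative_cong_nhds[OF 1 eq])
    then have "((snd e \<circ> \<gamma>) has_vector_derivative trans_deriv d e (\<gamma> 0) u) (at 0)"
      using linear_scale[OF linear_trans_deriv[OF de g0 e(2)]] by (simp add: has_vector_derivative_def)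
    then show ?thesis by (rule vector_derivative_at)
  qed
  then show ?thesis by (auto simp: velocity_def tvec_def)
qed

lemma points_tangent_atlas: "points (tangent_atlas At) = tangent At"
  by (auto simp: points_def tangent_atlas_def tangent_chart_def tangent_def)

text \<open>Identifies the inverses of tangent charts, in terms of which smoothness of cochains is
  stated, with \<open>tvec\<close>.\<close>

lemma tangent_chart_inv:
  assumes "diff_atlas At" "c \<in> At" "p \<in> fst c"
  shows "chart_inv (tangent_chart At c) (snd c p, u) = tvec At c p u"
proof -
  have inj: "inj_on (snd (tangent_chart At c)) (fst (tangent_chart At c))"
  proof (rule inj_onI)
    fix X Y assume X: "X \<in> fst (tangent_chart At c)" and Y: "Y \<in> fst (tangent_chart At c)"
      and eq: "snd (tangent_chart At c) X = snd (tangent_chart At c) Y"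
    have "inj_on (snd c) (fst c)" using assms by (auto simp: diff_atlas_def chart_compat_def)
    then have "fst X = fst Y" using X Y eq by (auto simp: tangent_chart_def dest: inj_onD)
    moreover have "snd X c = snd Y c" using eq by (simp add: tangent_chart_def)
    ultimately show "X = Y"
      using X Y tangent_eq_tvec[of X At c] tangent_eq_tvec[of Y At c] assms(2)
      by (simp add: tangent_chart_def)
  qed
  have "tvec At c p u \<in> fst (tangent_chart At c)"
    using assms tvec_in_tangent by (simp add: tangent_chart_def)
  from inv_into_f_f[OF inj this] show ?thesis
    using tvec_coord[OF assms] by (simp add: tangent_chart_def)
qed

subsection \<open>A vector bundle in a bundle chart\<close>

lemma vector_bundle_atlas:
  assumes "vector_bundle V"
  shows "diff_atlas (base V)" "diff_atlas (total V)"
  using assms by (simp_all add: vector_bundle_def manifold_def smooth_atlas_imp_diff_atlas)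

text \<open>A pair over one base point has a common base coordinate, recorded once. A transition map
  therefore consists of two copies of the transition map \<open>\<tau>\<close> of the total space,
  at \<open>(y, u)\<close> and at \<open>(y, v)\<close>. The result is used for
  \<open>TM_add\<close>, which passes through tangent vectors of the Whitney sum.\<close>

lemma whitney_diff_atlas:
  assumes V: "vector_bundle V"
  shows "diff_atlas (whitney_atlas V)"
  unfolding diff_atlas_def
proof (intro ballI)
  fix C C' assume "C \<in> whitney_atlas V" "C' \<in> whitney_atlas V"
  then obtain e e' where e: "e \<in> total V" and e': "e' \<in> total V"
    and C: "C = ({(a, b). a \<in> fst e \<and> b \<in> fst e \<and> proj V a = proj V b},
       \<lambda>(a, b). (fst (snd e a), snd (snd e a), snd (snd e b)))"
    and C': "C' = ({(a, b). a \<in> fst e' \<and> b \<in> fst e' \<and> proj V a = proj V b},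
       \<lambda>(a, b). (fst (snd e' a), snd (snd e' a), snd (snd e' b)))"
    unfolding whitney_atlas_def by blast
  have comp: "chart_compat e e'" using vector_bundle_atlas[OF V] e e' by (simp add: diff_atlas_def)
  have inj: "inj_on (snd e) (fst e)" using comp by (rule chart_compat_inj)
  obtain c where c: "smooth_chart (base V) c" "fst e = {a \<in> points (total V). proj V a \<in> fst c}"
    "\<forall>a\<in>fst e. fst (snd e a) = snd c (proj V a)"
    using bspec[OF V[unfolded vector_bundle_def, THEN conjunct2, THEN conjunct2, THEN conjunct2,
      THEN conjunct2, THEN conjunct2, THEN conjunct2] e] by blast
  have injc: "inj_on (snd c) (fst c)" using c(1) by (simp add: smooth_chart_def)
  have proj_eq: "proj V a = proj V b" if "a \<in> fst e" "b \<in> fst e" "fst (snd e a) = fst (snd e b)" for a b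
    using that c injc by (auto dest: inj_onD)
  define S where "S = snd e ` (fst e \<inter> fst e')"
  \<comment> \<open>The coordinate image of the chart overlap: a triple belongs to it exactly if
    both of its projections belong to the overlap \<open>S\<close> in the total space.\<close>
  let ?T = "{(y, a, b). (y, a) \<in> S \<and> (y, b) \<in> S}"
  have S: "open S" using comp by (simp add: chart_compat_def S_def)
  have injC: "inj_on (snd C) (fst C)"
  proof (rule inj_onI)
    fix z z' assume z: "z \<in> fst C" "z' \<in> fst C" and eq: "snd C z = snd C z'"
    obtain a b a' b' where [simp]: "z = (a, b)" "z' = (a', b')" by (metis surj_pair)
    have e: "a \<in> fst e" "b \<in> fst e" "a' \<in> fst e" "b' \<in> fst e" "proj V a = proj V b" "proj V a' = proj V b'"
      using z by (simp_all add: C)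
    then have "fst (snd e a) = fst (snd e b)" "fst (snd e a') = fst (snd e b')" using c(3) by simp_all
    then have "snd e a = snd e a'" "snd e b = snd e b'" using eq by (simp_all add: C prod_eq_iff)
    then show "z = z'" using e inj by (auto dest: inj_onD)
  qed
  have img: "snd C ` (fst C \<inter> fst C') = ?T"
  proof (intro Set.set_eqI iffI)
    fix z assume "z \<in> snd C ` (fst C \<inter> fst C')"
    then obtain a b where ab: "a \<in> fst e" "b \<in> fst e" "a \<in> fst e'" "b \<in> fst e'" "proj V a = proj V b"
      "z = (fst (snd e a), snd (snd e a), snd (snd e b))" by (auto simp: C C')
    moreover have "fst (snd e a) = fst (snd e b)" using ab c by simp
    ultimately show "z \<in> ?T"
      by (auto simp: S_def) (metis IntI image_eqI prod.collapse)
  next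
    fix z assume "z \<in> ?T"
    then obtain y u v a b where z: "z = (y, u, v)" "a \<in> fst e" "a \<in> fst e'" "snd e a = (y, u)"
       "b \<in> fst e" "b \<in> fst e'" "snd e b = (y, v)" by (auto simp: S_def image_iff)
    have "fst (snd e a) = fst (snd e b)" unfolding z(4,7) fst_conv ..
    then have "proj V a = proj V b" by (rule proj_eq[OF z(2,5)])
    then have "(a, b) \<in> fst C \<inter> fst C'" "z = snd C (a, b)" using z by (auto simp: C C')
    then show "z \<in> snd C ` (fst C \<inter> fst C')" by blast
  qed
  have "open ?T"
  proof -
    have "open ((\<lambda>z. (fst z, fst (snd z))) -` S \<inter> (\<lambda>z. (fst z, snd (snd z))) -` S)"
      by (intro open_Int open_vimage S continuous_intros)
    moreover have "(\<lambda>z. (fst z, fst (snd z))) -` S \<inter> (\<lambda>z. (fst z, snd (snd z))) -` S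
       = ?T" by auto
    ultimately show ?thesis by simp
  qed
  moreover have "(snd C' \<circ> chart_inv C) differentiable at z" if z: "(fst z, fst (snd z)) \<in> S" "(fst z, snd (snd z)) \<in> S" for z
  proof -
    define \<tau> where "\<tau> = snd e' \<circ> chart_inv e"
    have \<tau>: "\<tau> differentiable at s" if "s \<in> S" for s
      using comp that unfolding chart_compat_def S_def \<tau>_def by blast
    have d1: "(\<lambda>z. \<tau> (fst z, fst (snd z))) differentiable at z"
      by (rule differentiable_compose[of \<tau> "\<lambda>z. (fst z, fst (snd z))", OF \<tau>[OF z(1)]])
        (auto intro!: derivative_intros simp: differentiable_def intro: exI[of _ "\<lambda>z. (fst z, fst (snd z))"])
    have d2: "(\<lambda>z. \<tau> (fst z, snd (snd z))) differentiable at z"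
      by (rule differentiable_compose[of \<tau> "\<lambda>z. (fst z, snd (snd z))", OF \<tau>[OF z(2)]])
        (auto intro!: derivative_intros simp: differentiable_def intro: exI[of _ "\<lambda>z. (fst z, snd (snd z))"])
    obtain D1 D2 where D: "((\<lambda>z. \<tau> (fst z, fst (snd z))) has_derivative D1) (at z)"
       "((\<lambda>z. \<tau> (fst z, snd (snd z))) has_derivative D2) (at z)" using d1 d2 by (auto simp: differentiable_def)
    have "((\<lambda>z. (fst (\<tau> (fst z, fst (snd z))), snd (\<tau> (fst z, fst (snd z))), snd (\<tau> (fst z, snd (snd z)))))
      has_derivative (\<lambda>h. (fst (D1 h), snd (D1 h), snd (D2 h)))) (at z)"
      by (intro has_derivative_Pair has_derivative_fst has_derivative_snd D)
    moreover have "eventually (\<lambda>z. (fst (\<tau> (fst z, fst (snd z))), snd (\<tau> (fst z, fst (snd z))), snd (\<tau> (fst z, snd (snd z))))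
      = (snd C' \<circ> chart_inv C) z) (nhds z)"
    proof -
      have "eventually (\<lambda>z. z \<in> ?T) (nhds z)"
        using \<open>open ?T\<close> z by (intro eventually_nhds_in_open) (auto simp: split_beta)
      then show ?thesis
      proof eventually_elim
        case (elim z)
        then obtain a b where ab: "(a, b) \<in> fst C" "(a, b) \<in> fst C'" "z = snd C (a, b)" unfolding img[symmetric] by auto
        have "chart_inv C z = (a, b)" using ab injC by (simp add: inv_into_f_f)
        moreover have "(fst z, fst (snd z)) = snd e a" using ab by (simp add: C)
        moreover have "(fst z, snd (snd z)) = snd e b" using ab c by (auto simp: C prod_eq_iff)
        moreover have "chart_inv e (snd e a) = a" "chart_inv e (snd e b) = b" using ab inj by (auto simp: C)
        ultimately show ?case by (simp add: \<tau>_def C')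
      qed
    qed
    ultimately show ?thesis using has_derivative_cong_nhds unfolding differentiable_def by blast
  qed
  ultimately show "chart_compat C C'"
    using injC unfolding chart_compat_def img by auto
qed

text \<open>Both sides of the theorem are functions of a base point, so a single point
  \<open>x\<close> is fixed. Tangent vectors of the base have coordinates only in charts of its
  atlas; the chart \<open>c\<close> under the bundle chart \<open>d\<close> is merely compatible
  with that atlas, whence the second chart \<open>c'\<close>.\<close>

locale bundle_chart =
  fixes V :: "('m, 'e::real_normed_vector, 'a, 'e \<times> 'f::real_normed_vector) vbundle"
    and d :: "('a, 'e \<times> 'f) chart" and c c' :: "('m, 'e) chart" and x :: 'm
  assumes V: "vector_bundle V" and d: "d \<in> total V" and c: "smooth_chart (base V) c"
    and c': "c' \<in> base V" and x: "x \<in> fst c" and x': "x \<in> fst c'"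
    and fst_d: "fst d = {a \<in> points (total V). proj V a \<in> fst c}"
    and image_d: "snd d ` fst d = snd c ` fst c \<times> UNIV"
    and fst_snd_d: "\<And>a. a \<in> fst d \<Longrightarrow> fst (snd d a) = snd c (proj V a)"
    and d_scl: "\<And>a r. a \<in> fst d \<Longrightarrow> snd (snd d (scl V r a)) = r *\<^sub>R snd (snd d a)"
    and d_add: "\<And>a b. a \<in> fst d \<Longrightarrow> b \<in> fibre V (proj V a) \<Longrightarrow>
           snd (snd d (add V a b)) = snd (snd d a) + snd (snd d b)"
    and d_zero: "\<And>y. y \<in> fst c \<Longrightarrow> snd (snd d (zero V y)) = 0"

lemma bundle_chart_exists:
  assumes V: "vector_bundle V" and c': "c' \<in> base V" "x \<in> fst c'"
  shows "\<exists>d c. bundle_chart V d c c' x"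
proof -
  have x: "x \<in> points (base V)" using c' by (auto simp: points_def)
  then have z: "zero V x \<in> fibre V x" using V by (simp add: vector_bundle_def)
  then obtain d where d: "d \<in> total V" "zero V x \<in> fst d" by (auto simp: points_def)
  then obtain c where "smooth_chart (base V) c" and
        1: "fst d = {a \<in> points (total V). proj V a \<in> fst c}" and
        "snd d ` fst d = snd c ` fst c \<times> UNIV" and
        "(\<forall>a\<in>fst d. fst (snd d a) = snd c (proj V a))" and
        "(\<forall>a\<in>fst d. \<forall>r. snd (snd d (scl V r a)) = r *\<^sub>R snd (snd d a))" and
        "(\<forall>a\<in>fst d. \<forall>b\<in>fibre V (proj V a).
           snd (snd d (add V a b)) = snd (snd d a) + snd (snd d b))" and
        "(\<forall>x\<in>fst c. snd (snd d (zero V x)) = 0)"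
    using V unfolding vector_bundle_def by blast
  moreover have "x \<in> fst c" using 1 d(2) z by simp
  ultimately have "bundle_chart V d c c' x" using V d(1) c' by unfold_locales auto
  then show ?thesis by blast
qed

context bundle_chart
begin

text \<open>Coordinates over the point \<open>x\<close>: \<open>pt a\<close> is the point of the fibre with coordinate \<open>a\<close>,
  \<open>Tv a (w, b)\<close> the tangent vector at \<open>pt a\<close> with coordinates \<open>(w, b)\<close>, and \<open>bw w\<close> its projection.
  Since \<open>c\<close> need not belong to the atlas of the base, \<open>bw\<close> passes through the chart \<open>c'\<close>.\<close>

definition x0 :: 'e where "x0 = snd c x"
definition pt :: "'f \<Rightarrow> 'a" where "pt a = chart_inv d (x0, a)"
definition cf :: "'a \<Rightarrow> 'f" where "cf \<alpha> = snd (snd d \<alpha>)"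
definition Tv :: "'f \<Rightarrow> 'e \<times> 'f \<Rightarrow> ('a, 'e \<times> 'f) tvec" where "Tv a u = tvec (total V) d (pt a) u"
definition to_c' :: "'e \<Rightarrow> 'e" where "to_c' = trans_deriv c c' x"
definition of_c' :: "'e \<Rightarrow> 'e" where "of_c' = trans_deriv c' c x"
definition bw :: "'e \<Rightarrow> ('m, 'e) tvec" where "bw w = tvec (base V) c' x (to_c' w)"

lemma x_points: "x \<in> points (base V)"
  using c' x' by (auto simp: points_def)

lemma atlas_base: "diff_atlas (base V)" and atlas_total: "diff_atlas (total V)"
  using vector_bundle_atlas[OF V] .

lemma compat_c: "chart_compat c c'" "chart_compat c' c" "chart_compat c' c'"
proof -
  have "inj_on (snd c') (fst c')" using atlas_base c' by (auto simp: diff_atlas_def chart_compat_def)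
  then show "chart_compat c c'" "chart_compat c' c"
    using c c' unfolding smooth_chart_def by (auto intro: compatible_imp_chart_compat)
  show "chart_compat c' c'" using atlas_base c' by (auto simp: diff_atlas_def)
qed

lemma compat_d: "chart_compat d d"
  using atlas_total d by (simp add: diff_atlas_def)

text \<open>Compatibility is given only between \<open>c\<close> and members of the atlas, so it has
  to be derived here: the image of \<open>c\<close> is open as the union of the images of its
  overlaps with all atlas charts.\<close>

lemma compat_cc: "chart_compat c c"
proof -
  have inj: "inj_on (snd c) (fst c)" using compat_c chart_compat_inj by blast
  have "fst c = (\<Union>e\<in>base V. fst c \<inter> fst e)"
    using c by (auto simp: smooth_chart_def points_def)
  then have "snd c ` fst c = (\<Union>e\<in>base V. snd c ` (fst c \<inter> fst e))"
    using image_UN by metis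
  moreover have "open (\<Union>e\<in>base V. snd c ` (fst c \<inter> fst e))"
    using c by (auto simp: smooth_chart_def compatible_def)
  ultimately have o: "open (snd c ` fst c)" by simp
  have "(snd c \<circ> chart_inv c) differentiable at y" if y: "y \<in> snd c ` fst c" for y
  proof -
    have "eventually (\<lambda>y. y = (snd c \<circ> chart_inv c) y) (nhds y)"
      using eventually_nhds_in_open[OF o y] by eventually_elim (simp add: f_inv_into_f)
    from has_derivative_cong_nhds[OF has_derivative_ident this] show ?thesis unfolding differentiable_def by blast
  qed
  with o inj show ?thesis by (simp add: chart_compat_def)
qed

lemma to_of_c' [simp]: "to_c' (of_c' w) = w" "of_c' (to_c' w) = w"
  using trans_deriv_inverse[OF compat_c(2,1,3) x' x] trans_deriv_inverse[OF compat_c(1,2) compat_cc x x']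
  by (simp_all add: to_c'_def of_c'_def)

lemma linear_to_c': "linear to_c'" and linear_of_c': "linear of_c'"
  using linear_trans_deriv[OF compat_c(1) x x'] linear_trans_deriv[OF compat_c(2) x' x]
  by (simp_all add: to_c'_def of_c'_def)

lemma chart_inv_d:
  assumes "y \<in> snd c ` fst c"
  shows "chart_inv d (y, a) \<in> fst d" "snd d (chart_inv d (y, a)) = (y, a)" "proj V (chart_inv d (y, a)) = chart_inv c y"
proof -
  have *: "(y, a) \<in> snd d ` fst d" using assms image_d by auto
  then show 1: "chart_inv d (y, a) \<in> fst d" "snd d (chart_inv d (y, a)) = (y, a)"
    by (auto simp: inv_into_into f_inv_into_f)
  then have "snd c (proj V (chart_inv d (y, a))) = y" using fst_snd_d by fastforce
  then show "proj V (chart_inv d (y, a)) = chart_inv c y"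
    using 1 fst_d chart_compat_inv[OF compat_cc] by (metis (no_types, lifting) mem_Collect_eq)
qed

lemma x0_image: "x0 \<in> snd c ` fst c"
  using x by (simp add: x0_def)

lemma pt [simp]: "pt a \<in> fst d" "snd d (pt a) = (x0, a)" "proj V (pt a) = x" "cf (pt a) = a"
  using chart_inv_d[OF x0_image] chart_compat_inv[OF compat_cc x] by (auto simp: pt_def cf_def x0_def)

lemma pt_fibre [simp]: "pt a \<in> points (total V)"
  using pt(1) fst_d by blast

lemma fibre_pt:
  assumes "\<alpha> \<in> fibre V x"
  shows "\<alpha> \<in> fst d" "pt (cf \<alpha>) = \<alpha>"
proof -
  show 1: "\<alpha> \<in> fst d" using assms x fst_d by auto
  then have "snd d \<alpha> = (x0, cf \<alpha>)" using fst_snd_d assms by (simp add: cf_def x0_def prod_eq_iff)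
  then show "pt (cf \<alpha>) = \<alpha>" using chart_compat_inv[OF compat_d 1] by (simp add: pt_def)
qed

lemma fibre_cases:
  assumes "\<alpha> \<in> fibre V x"
  obtains a where "\<alpha> = pt a"
  using fibre_pt[OF assms] by metis

lemma pt_eq_iff [simp]: "pt a = pt b \<longleftrightarrow> a = b"
  using pt(4) by metis

lemma add_fibre: "a \<in> fibre V y \<Longrightarrow> b \<in> fibre V y \<Longrightarrow> add V a b \<in> fibre V y"
  using V unfolding vector_bundle_def by blast

lemma scl_fibre: "a \<in> fibre V y \<Longrightarrow> scl V r a \<in> fibre V y"
  using V unfolding vector_bundle_def by blast

lemma zero_fibre: "y \<in> points (base V) \<Longrightarrow> zero V y \<in> fibre V y"
  using V unfolding vector_bundle_def by blast

lemma add_pt: "add V (pt a) (pt b) = pt (a + b)"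
proof -
  have "add V (pt a) (pt b) \<in> fibre V x" using add_fibre[of "pt a" x "pt b"] by simp
  moreover have "cf (add V (pt a) (pt b)) = a + b" using d_add[of "pt a" "pt b"] pt(4) by (simp add: cf_def)
  ultimately show ?thesis using fibre_pt by metis
qed

lemma scl_pt: "scl V r (pt a) = pt (r *\<^sub>R a)"
proof -
  have "scl V r (pt a) \<in> fibre V x" using scl_fibre[of "pt a" x] by simp
  moreover have "cf (scl V r (pt a)) = r *\<^sub>R a" using d_scl[of "pt a" r] pt(4) by (simp add: cf_def)
  ultimately show ?thesis using fibre_pt by metis
qed

lemma zero_pt: "zero V x = pt 0"
  using zero_fibre[OF x_points] d_zero[OF x] fibre_pt by (metis cf_def)

lemma fst_Tv [simp]: "fst (Tv a u) = pt a"
  by (simp add: Tv_def)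

lemma Tv_tangent [simp]: "Tv a u \<in> tangent (total V)"
  by (simp add: Tv_def tvec_in_tangent atlas_total d)

lemma Tv_eq_iff [simp]: "Tv a u = Tv b u' \<longleftrightarrow> a = b \<and> u = u'"
  using tvec_eq_iff[OF atlas_total d] by (simp add: Tv_def)

lemma tadd_Tv: "tadd (Tv a u) (Tv a u') = Tv a (u + u')"
  by (simp add: Tv_def tadd_tvec atlas_total d)

lemma tscale_Tv: "tscale r (Tv a u) = Tv a (r *\<^sub>R u)"
  by (simp add: Tv_def tscale_tvec atlas_total d)

lemma tsub_Tv: "tsub (Tv a u) (Tv a u') = Tv a (u - u')"
  by (simp add: Tv_def tsub_tvec atlas_total d)

lemma tzero_pt: "tzero (pt a) = Tv a 0"
  by (simp add: Tv_def tzero_eq_tvec[OF atlas_total d])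

lemma tangent_chart_inv_Tv: "chart_inv (tangent_chart (total V) d) ((x0, a), u) = Tv a u"
  using tangent_chart_inv[OF atlas_total d, of "pt a" u] by (simp add: Tv_def)

lemma Tv_cases:
  assumes "X \<in> tangent (total V)" "proj V (fst X) = x"
  obtains a w b where "X = Tv a (w, b)"
proof -
  have "fst X \<in> fibre V x" using assms by (simp add: tangent_def)
  then obtain a where a: "fst X = pt a" by (rule fibre_cases)
  then have "X = tvec (total V) d (fst X) (snd X d)" using assms d by (intro tangent_eq_tvec) auto
  then show ?thesis using that a by (metis Tv_def prod.collapse)
qed

lemma fst_bw [simp]: "fst (bw w) = x"
  by (simp add: bw_def)

lemma bw_tangent [simp]: "bw w \<in> tangent (base V)"
  by (simp add: bw_def tvec_in_tangent atlas_base c' x')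

lemma bw_eq_iff [simp]: "bw w = bw w' \<longleftrightarrow> w = w'"
  using tvec_eq_iff[OF atlas_base c' x' x'] to_of_c'(2) by (auto simp: bw_def dest: arg_cong[of _ _ of_c'])

lemma bw_cases:
  assumes "X \<in> tangent (base V)" "fst X = x"
  obtains w where "X = bw w"
proof -
  have "X = tvec (base V) c' x (snd X c')" using tangent_eq_tvec[OF assms(1) c'] assms x' by simp
  then have "X = bw (of_c' (snd X c'))" by (simp add: bw_def)
  then show ?thesis using that by blast
qed

lemma tscale_bw: "tscale r (bw w) = bw (r *\<^sub>R w)"
  by (simp add: bw_def tscale_tvec atlas_base c' x' linear_scale[OF linear_to_c'])

lemma tzero_x: "tzero x = bw 0"
  by (simp add: bw_def tzero_eq_tvec[OF atlas_base c' x'] linear_0[OF linear_to_c'])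

lemma has_mderiv_proj_c: "has_mderiv (proj V) d c (pt a) fst"
  by (rule has_mderiv_explicit[OF compat_d pt(1) has_derivative_fst[OF has_derivative_ident]])
    (use fst_d fst_snd_d in auto)

lemma has_mderiv_proj: "has_mderiv (proj V) d c' (pt a) (\<lambda>u. to_c' (fst u))"
  unfolding to_c'_def
  using has_mderiv_compose[OF has_mderiv_proj_c _ compat_d compat_cc, of "\<lambda>x. x" c' a] has_mderiv_id[OF compat_c(1) x x']
  by simp

lemma differential_proj [simp]: "differential (total V) (base V) (proj V) (Tv a u) = bw (fst u)"
  unfolding Tv_def bw_def
  using differential_tvec[OF atlas_total atlas_base d c' _ has_mderiv_proj] x' by simp

lemma has_mderiv_zero: "has_mderiv (zero V) c' d x (\<lambda>w. (of_c' w, 0))"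
proof -
  have z: "zero V y \<in> fst d" "snd d (zero V y) = (snd c y, 0)" if "y \<in> fst c" for y
  proof -
    have "y \<in> points (base V)" using that c by (auto simp: smooth_chart_def)
    then have *: "zero V y \<in> fibre V y" by (rule zero_fibre)
    then show "zero V y \<in> fst d" using that fst_d by simp
    then show "snd d (zero V y) = (snd c y, 0)" using fst_snd_d d_zero that * by (simp add: prod_eq_iff)
  qed
  have "((\<lambda>w. (w, 0)) has_derivative (\<lambda>w. (w, 0))) (at (snd c x))"
    by (intro derivative_intros)
  then have "has_mderiv (zero V) c d x (\<lambda>w. (w, 0))"
    by (rule has_mderiv_explicit[OF compat_cc x]) (use z in auto)
  from has_mderiv_compose[OF has_mderiv_id[OF compat_c(2) x' x] this compat_c(2) compat_cc]
  show ?thesis by (simp add: of_c'_def)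
qed

lemma TM_zero: "zero (TA_over_TM V) (bw w) = Tv 0 (w, 0)"
  using differential_tvec[OF atlas_base atlas_total c' d _ has_mderiv_zero, of "to_c' w"]
  by (simp add: TA_over_TM_def bw_def Tv_def zero_pt)

lemma has_mderiv_scl: "has_mderiv (scl V r) d d (pt a) (\<lambda>u. (fst u, r *\<^sub>R snd u))"
proof -
  have s: "scl V r z \<in> fst d" "snd d (scl V r z) = (fst (snd d z), r *\<^sub>R snd (snd d z))" if "z \<in> fst d" for z
  proof -
    have *: "scl V r z \<in> fibre V (proj V z)" using that fst_d scl_fibre[of z "proj V z"] by simp
    then show "scl V r z \<in> fst d" using that fst_d by simp
    then show "snd d (scl V r z) = (fst (snd d z), r *\<^sub>R snd (snd d z))"
      using fst_snd_d d_scl that * by (simp add: prod_eq_iff)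
  qed
  have "((\<lambda>u. (fst u, r *\<^sub>R snd u)) has_derivative (\<lambda>u. (fst u, r *\<^sub>R snd u))) (at (snd d (pt a)))"
    by (intro derivative_intros)
  then show ?thesis by (rule has_mderiv_explicit[OF compat_d pt(1)]) (use s in auto)
qed

lemma TM_scl: "scl (TA_over_TM V) r (Tv a (w, b)) = Tv (r *\<^sub>R a) (w, r *\<^sub>R b)"
  using differential_tvec[OF atlas_total atlas_total d d _ has_mderiv_scl]
  by (simp add: TA_over_TM_def Tv_def scl_pt)

text \<open>In the Whitney chart the two projections and the fibrewise addition are linear, hence
  equal to their own derivatives. The two projections recover all three components of a tangent
  vector, so the description in \<open>TM_add\<close> has a unique solution.\<close>

lemma TM_add: "add (TA_over_TM V) (Tv a (w, b)) (Tv a' (w, b')) = Tv (a + a') (w, b + b')"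
proof -
  define W where "W = ({(a, b). a \<in> fst d \<and> b \<in> fst d \<and> proj V a = proj V b},
     \<lambda>(a, b). (fst (snd d a), snd (snd d a), snd (snd d b)))"
  have W: "W \<in> whitney_atlas V" using d by (auto simp: whitney_atlas_def W_def)
  have at: "diff_atlas (whitney_atlas V)" using whitney_diff_atlas[OF V] .
  then have cW: "chart_compat W W" using W by (simp add: diff_atlas_def)
  have pp: "(pt a, pt a') \<in> fst W" "snd W (pt a, pt a') = (x0, a, a')" by (simp_all add: W_def)
  have M: "has_mderiv f W d (pt a, pt a') D"
    if f: "\<And>z. z \<in> fst W \<Longrightarrow> f z \<in> fst d \<and> snd d (f z) = D (snd W z)" and D: "bounded_linear D" for f D
    using has_mderiv_explicit[OF cW pp(1) bounded_linear_imp_has_derivative[OF D] f] .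
  have m1: "has_mderiv fst W d (pt a, pt a') (\<lambda>u. (fst u, fst (snd u)))"
    by (rule M) (auto simp: W_def intro!: bounded_linear_intros)
  have m2: "has_mderiv snd W d (pt a, pt a') (\<lambda>u. (fst u, snd (snd u)))"
    by (rule M) (auto simp: W_def prod_eq_iff fst_snd_d intro!: bounded_linear_intros)
  have m3: "has_mderiv (\<lambda>(a, b). add V a b) W d (pt a, pt a') (\<lambda>u. (fst u, fst (snd u) + snd (snd u)))"
  proof (rule M)
    fix z assume "z \<in> fst W"
    then obtain e e' where z: "z = (e, e')" "e \<in> fst d" "e' \<in> fst d" "proj V e = proj V e'" by (auto simp: W_def)
    then have *: "add V e e' \<in> fibre V (proj V e)" using fst_d add_fibre[of e "proj V e" e'] by simp
    then have "add V e e' \<in> fst d" using z fst_d by simp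
    moreover have "snd d (add V e e') = (fst (snd d e), snd (snd d e) + snd (snd d e'))"
      using fst_snd_d[OF z(2)] fst_snd_d[OF \<open>add V e e' \<in> fst d\<close>] d_add[of e e'] z fst_d * by (simp add: prod_eq_iff)
    ultimately show "(case z of (a, b) \<Rightarrow> add V a b) \<in> fst d \<and>
        snd d (case z of (a, b) \<Rightarrow> add V a b) = (fst (snd W z), fst (snd (snd W z)) + snd (snd (snd W z)))"
      by (simp add: z W_def)
  qed (auto intro!: bounded_linear_intros)
  have d1: "differential (whitney_atlas V) (total V) fst (tvec (whitney_atlas V) W (pt a, pt a') u)
      = Tv a (fst u, fst (snd u))" for u
    using differential_tvec[OF at atlas_total W d _ m1] by (simp add: Tv_def)
  have d2: "differential (whitney_atlas V) (total V) snd (tvec (whitney_atlas V) W (pt a, pt a') u)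
      = Tv a' (fst u, snd (snd u))" for u
    using differential_tvec[OF at atlas_total W d _ m2] by (simp add: Tv_def)
  have the: "(THE Z. Z \<in> tangent (whitney_atlas V) \<and>
        differential (whitney_atlas V) (total V) fst Z = Tv a (w, b) \<and>
        differential (whitney_atlas V) (total V) snd Z = Tv a' (w, b'))
      = tvec (whitney_atlas V) W (pt a, pt a') (w, b, b')" (is "The ?P = ?Z")
  proof (rule the_equality)
    show "?P ?Z" using tvec_in_tangent[OF at W pp(1)] d1 d2 by simp
    fix Z assume Z: "?P Z"
    have "fst (fst Z) = pt a" "snd (fst Z) = pt a'"
      using Z fst_differential[of _ _ _ Z] by (metis fst_Tv)+
    then have fZ: "fst Z = (pt a, pt a')" by (simp add: prod_eq_iff)
    then have eq: "Z = tvec (whitney_atlas V) W (pt a, pt a') (snd Z W)"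
      using tangent_eq_tvec[of Z "whitney_atlas V" W] Z W pp(1) by simp
    have "Tv a (fst (snd Z W), fst (snd (snd Z W))) = Tv a (w, b)" using Z d1[of "snd Z W"] eq by metis
    moreover have "Tv a' (fst (snd Z W), snd (snd (snd Z W))) = Tv a' (w, b')" using Z d2[of "snd Z W"] eq by metis
    ultimately have "snd Z W = (w, b, b')" unfolding Tv_eq_iff by (simp add: prod_eq_iff)
    with eq show "Z = ?Z" by simp
  qed
  show ?thesis
    using differential_tvec[OF at atlas_total W d _ m3, of "(w, b, b')"] the
    by (simp add: TA_over_TM_def TM_add_def add_pt Tv_def)
qed

lemma velocity_pt: "velocity (total V) (\<lambda>t. pt (a + t *\<^sub>R b)) = Tv a (0, b)"
proof -
  have "((\<lambda>t. (x0, a + t *\<^sub>R b)) has_vector_derivative (0, b)) (at 0)"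
    by (auto intro!: derivative_eq_intros has_vector_derivative_Pair)
  then have "((snd d \<circ> (\<lambda>t. pt (a + t *\<^sub>R b))) has_vector_derivative (0, b)) (at 0)"
    by (simp add: o_def)
  from velocity_tvec[OF atlas_total d _ this] show ?thesis by (simp add: Tv_def)
qed

lemma core_vec_pt: "core_vec V (pt b) = Tv 0 (0, b)"
  using velocity_pt[of 0 b] by (simp add: core_vec_def scl_pt)

lemma vert_iso_pt: "vert_iso V (pt a, pt \<xi>) = Tv a (0, \<xi>)"
  using velocity_pt[of a \<xi>] by (simp add: vert_iso_def scl_pt add_pt)

text \<open>\<open>sections\<close> has no explicit clause placing the values in the total space;
  this is extracted from the chart condition in \<open>smooth_map\<close>.\<close>

lemma section_fibre:
  assumes "\<alpha> \<in> sections V" "y \<in> points (base V)"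
  shows "\<alpha> y \<in> fibre V y"
proof -
  have sm: "smooth_map (base V) (total V) (points (base V)) \<alpha>" and p: "proj V (\<alpha> y) = y"
    using assms by (auto simp: sections_def)
  obtain c0 d0 N where 0: "c0 \<in> base V" "d0 \<in> total V" "y \<in> fst c0" "snd c0 y \<in> N"
    "\<alpha> ` chart_inv c0 ` N \<subseteq> fst d0"
    using sm assms(2) unfolding smooth_map_def by blast
  have "chart_compat c0 c0" using atlas_base 0 by (simp add: diff_atlas_def)
  then have "chart_inv c0 (snd c0 y) = y" using 0(3) by (rule chart_compat_inv)
  then have "\<alpha> y \<in> \<alpha> ` chart_inv c0 ` N" using 0(4) by (metis image_eqI)
  then have "\<alpha> y \<in> fst d0" using 0(5) by blast
  then show ?thesis using p 0(2) by (auto simp: points_def)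
qed

text \<open>The section followed by the projection is the identity. This forces the base component
  of the derivative to be \<open>w\<close> itself, and only the vertical component \<open>D\<close>
  is left free.\<close>

lemma section_differential:
  assumes "\<alpha> \<in> sections V"
  obtains D where "linear D" "\<And>w. differential (base V) (total V) \<alpha> (bw w) = Tv (cf (\<alpha> x)) (w, D w)"
proof -
  have fib: "\<alpha> x \<in> fibre V x" using section_fibre[OF assms x_points] .
  have eq: "\<alpha> x = pt (cf (\<alpha> x))" "\<alpha> x \<in> fst d" using fibre_pt[OF fib] by simp_all
  have "smooth_map (base V) (total V) (points (base V)) \<alpha>" using assms by (auto simp: sections_def)
  from smooth_map_has_mderiv[OF this x_points atlas_base atlas_total c' x' d eq(2)]
  obtain D where D: "has_mderiv \<alpha> c' d x D" by blast
  have "has_mderiv (proj V) d c' (\<alpha> x) (\<lambda>u. to_c' (fst u))" using has_mderiv_proj eq(1) by metis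
  from has_mderiv_compose[OF D this compat_c(3) compat_d]
  have 1: "has_mderiv (\<lambda>y. proj V (\<alpha> y)) c' c' x (\<lambda>u. to_c' (fst (D u)))" .
  have "proj V (\<alpha> y) = y" if "y \<in> fst c'" for y
    using that assms c' by (auto simp: sections_def points_def)
  from has_mderiv_cong[OF 1 this compat_c(3)] have "has_mderiv (\<lambda>y. y) c' c' x (\<lambda>u. to_c' (fst (D u)))" by simp
  from has_mderiv_unique[OF this has_mderiv_id[OF compat_c(3) x' x']]
  have "to_c' (fst (D u)) = u" for u using trans_deriv_self[OF compat_c(3) x'] by metis
  then have 2: "fst (D u) = of_c' u" for u by (metis to_of_c'(2))
  have lin: "linear D" using D by (rule has_mderiv_linear)
  show ?thesis
  proof
    show "linear (\<lambda>w. snd (D (to_c' w)))"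
      using linear_compose[OF linear_compose[OF linear_to_c' lin] linear_snd] by (simp add: o_def)
    show "differential (base V) (total V) \<alpha> (bw w) = Tv (cf (\<alpha> x)) (w, snd (D (to_c' w)))" for w
    proof -
      have "differential (base V) (total V) \<alpha> (bw w) = tvec (total V) d (\<alpha> x) (D (to_c' w))"
        unfolding bw_def using differential_tvec[OF atlas_base atlas_total c' d eq(2) D] .
      also have "D (to_c' w) = (w, snd (D (to_c' w)))" by (simp add: prod_eq_iff 2)
      finally show ?thesis using eq(1) by (simp add: Tv_def)
    qed
  qed
qed

end

subsection \<open>The connection in a bundle chart\<close>

text \<open>The two bundles have their own bundle charts but share \<open>c'\<close> and
  \<open>x\<close>, so that base components of tangent vectors of \<open>A\<close> and of
  \<open>Q\<close> are compared in one chart.\<close>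

locale connection_chart = bundle_chart A d c c' x + Q: bundle_chart Q dQ cQ c' x
  for A :: "('m, 'e::real_normed_vector, 'a, 'e \<times> 'f::real_normed_vector) vbundle"
    and Q :: "('m, 'e, 'b, 'e \<times> 'g::real_normed_vector) vbundle"
    and d c c' x dQ cQ +
  fixes k :: "'a set" and \<phi> :: "'a \<Rightarrow> 'b" and E :: "('a, 'e \<times> 'f) tvec set"
  assumes quot: "quotient_bundle A k Q \<phi>"
    and E_A: "vector_subbundle (TA_over_A A) E"
    and E_TM: "vector_subbundle (TA_over_TM A) E"
    and decomp: "\<And>X. X \<in> tangent (total A) \<Longrightarrow> \<exists>!YZ. fst YZ \<in> E \<and> snd YZ \<in> ker_quot A Q \<phi> \<and>
        fst (fst YZ) = fst X \<and> fst (snd YZ) = fst X \<and> X = tadd (fst YZ) (snd YZ)"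
begin

definition kk :: "'f set" where "kk = {b. pt b \<in> k}"
definition \<phi>f :: "'f \<Rightarrow> 'g" where "\<phi>f b = Q.cf (\<phi> (pt b))"
definition E_at :: "'f \<Rightarrow> ('e \<times> 'f) set" where "E_at a = {u. Tv a u \<in> E}"

lemma \<phi>_smooth: "smooth_map (total A) (total Q) (points (total A)) \<phi>"
  and \<phi>_proj: "\<And>a. a \<in> points (total A) \<Longrightarrow> proj Q (\<phi> a) = proj A a"
  and \<phi>_points: "\<And>a. a \<in> points (total A) \<Longrightarrow> \<phi> a \<in> points (total Q)"
  and \<phi>_scl: "\<And>a r. a \<in> points (total A) \<Longrightarrow> \<phi> (scl A r a) = scl Q r (\<phi> a)"
  and \<phi>_add: "\<And>a b. a \<in> points (total A) \<Longrightarrow> b \<in> fibre A (proj A a) \<Longrightarrow> \<phi> (add A a b) = add Q (\<phi> a) (\<phi> b)"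
  and k_eq: "k = {a \<in> points (total A). \<phi> a = zero Q (proj A a)}"
  using quot unfolding quotient_bundle_def by auto

lemma \<phi>_pt: "\<phi> (pt b) = Q.pt (\<phi>f b)"
  using Q.fibre_pt(2)[of "\<phi> (pt b)"] \<phi>_proj[of "pt b"] \<phi>_points[of "pt b"] by (simp add: \<phi>f_def)

lemma linear_\<phi>f: "linear \<phi>f"
proof (rule linearI)
  show "\<phi>f (a + b) = \<phi>f a + \<phi>f b" for a b
    using \<phi>_add[of "pt a" "pt b"] by (simp add: add_pt \<phi>_pt Q.add_pt)
  show "\<phi>f (r *\<^sub>R a) = r *\<^sub>R \<phi>f a" for r a
    using \<phi>_scl[of "pt a" r] by (simp add: scl_pt \<phi>_pt Q.scl_pt)
qed

lemma kk_iff: "b \<in> kk \<longleftrightarrow> \<phi>f b = 0"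
proof -
  have "pt b \<in> k \<longleftrightarrow> \<phi> (pt b) = zero Q x" by (subst k_eq) simp
  then show ?thesis by (simp add: kk_def \<phi>_pt Q.zero_pt)
qed

lemma k_subset: "k \<subseteq> points (total A)"
  unfolding k_eq by blast

lemma subspace_kk: "subspace kk"
  using linear_\<phi>f by (auto simp: subspace_def kk_iff linear_0 linear_add linear_scale)

lemma k_cases:
  assumes "\<xi> \<in> k" "proj A \<xi> = x"
  obtains b where "b \<in> kk" "\<xi> = pt b"
proof -
  have "\<xi> \<in> fibre A x" using assms k_subset by blast
  then obtain b where "\<xi> = pt b" by (rule fibre_cases)
  with assms(1) show ?thesis by (intro that[of b]) (simp_all add: kk_def)
qed

lemma pt_in_k: "pt b \<in> k \<longleftrightarrow> b \<in> kk"
  by (simp add: kk_def)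

text \<open>Compatibility of \<open>\<phi>\<close> with the projections makes the base component of
  its derivative an isomorphic image of \<open>w\<close>. Along the fibre \<open>\<phi>\<close> is
  the linear map \<open>\<phi>f\<close>, which is then also its derivative on vertical vectors, and
  \<open>kk\<close> is the kernel of \<open>\<phi>f\<close>.\<close>

lemma differential_\<phi>_eq_tzero:
  "differential (total A) (total Q) \<phi> (Tv a (w, b)) = tzero (\<phi> (pt a)) \<longleftrightarrow> w = 0 \<and> b \<in> kk"
proof -
  have \<phi>a: "\<phi> (pt a) \<in> fst dQ" by (simp add: \<phi>_pt)
  from smooth_map_has_mderiv[OF \<phi>_smooth _ atlas_total Q.atlas_total d _ Q.d \<phi>a]
  obtain D where D: "has_mderiv \<phi> d dQ (pt a) D" by auto
  have "has_mderiv (proj Q) dQ c' (\<phi> (pt a)) (\<lambda>u. Q.to_c' (fst u))"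
    using Q.has_mderiv_proj by (simp add: \<phi>_pt)
  from has_mderiv_compose[OF D this compat_d Q.compat_d]
  have 1: "has_mderiv (\<lambda>z. proj Q (\<phi> z)) d c' (pt a) (\<lambda>u. Q.to_c' (fst (D u)))" .
  have "proj Q (\<phi> z) = proj A z" if "z \<in> fst d" for z using that fst_d \<phi>_proj by simp
  from has_mderiv_cong[OF 1 this compat_d]
  have "has_mderiv (proj A) d c' (pt a) (\<lambda>u. Q.to_c' (fst (D u)))" by simp
  from has_mderiv_unique[OF this has_mderiv_proj]
  have 2: "Q.to_c' (fst (D u)) = to_c' (fst u)" for u by metis
  have D': "((snd dQ \<circ> \<phi> \<circ> chart_inv d) has_derivative D) (at (x0, a + 0 *\<^sub>R b))"
    using D by (simp add: has_mderiv_def)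
  have "((\<lambda>t. (x0, a + t *\<^sub>R b)) has_derivative (\<lambda>t. (0, t *\<^sub>R b))) (at 0)"
    by (auto intro!: derivative_eq_intros has_derivative_Pair)
  from has_derivative_compose[OF this D']
  have "((\<lambda>t. (snd dQ \<circ> \<phi> \<circ> chart_inv d) (x0, a + t *\<^sub>R b)) has_derivative (\<lambda>t. D (0, t *\<^sub>R b))) (at 0)" .
  moreover have "(snd dQ \<circ> \<phi> \<circ> chart_inv d) (x0, a + t *\<^sub>R b) = (Q.x0, \<phi>f a + t *\<^sub>R \<phi>f b)" for t
    using linear_\<phi>f by (simp add: pt_def[symmetric] \<phi>_pt linear_add linear_scale)
  ultimately have "((\<lambda>t. (Q.x0, \<phi>f a + t *\<^sub>R \<phi>f b)) has_derivative (\<lambda>t. D (0, t *\<^sub>R b))) (at 0)"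
    by simp
  moreover have "((\<lambda>t. (Q.x0, \<phi>f a + t *\<^sub>R \<phi>f b)) has_derivative (\<lambda>t. (0, t *\<^sub>R \<phi>f b))) (at 0)"
    by (auto intro!: derivative_eq_intros has_derivative_Pair)
  ultimately have "(\<lambda>t. D (0, t *\<^sub>R b)) = (\<lambda>t. (0, t *\<^sub>R \<phi>f b))" by (rule has_derivative_unique)
  from fun_cong[OF this, of 1] have 3: "D (0, b) = (0, \<phi>f b)" by simp
  have "differential (total A) (total Q) \<phi> (Tv a (w, b)) = Q.Tv (\<phi>f a) (D (w, b))"
    using differential_tvec[OF atlas_total Q.atlas_total d Q.d \<phi>a D] by (simp add: Tv_def Q.Tv_def \<phi>_pt)
  moreover have "tzero (\<phi> (pt a)) = Q.Tv (\<phi>f a) 0" using Q.tzero_pt by (simp add: \<phi>_pt)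
  ultimately have "differential (total A) (total Q) \<phi> (Tv a (w, b)) = tzero (\<phi> (pt a)) \<longleftrightarrow> D (w, b) = 0" by simp
  also have "\<dots> \<longleftrightarrow> w = 0 \<and> b \<in> kk"
  proof
    assume "D (w, b) = 0"
    then have "to_c' w = 0" using 2[of "(w, b)"] linear_0[OF Q.linear_to_c'] by simp
    then have "w = 0" using to_of_c'(2)[of w] linear_0[OF linear_of_c'] by simp
    then show "w = 0 \<and> b \<in> kk" using \<open>D (w, b) = 0\<close> 3 by (simp add: kk_iff zero_prod_def)
  qed (auto simp: 3 kk_iff zero_prod_def)
  finally show ?thesis .
qed

lemma ker_quot_Tv: "Tv a (w, b) \<in> ker_quot A Q \<phi> \<longleftrightarrow> w = 0 \<and> b \<in> kk"
  using differential_\<phi>_eq_tzero by (simp add: ker_quot_def)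

lemma E_subset: "E \<subseteq> tangent (total A)"
  using E_A by (simp add: vector_subbundle_def TA_over_A_def points_tangent_atlas)

lemma lincomb_TA_over_A:
  assumes "\<And>i. i < n \<Longrightarrow> s i (pt a) = Tv a (u i)"
  shows "lincomb (TA_over_A A) s (pt a) r n = Tv a (\<Sum>i<n. r i *\<^sub>R u i)"
  using assms by (induction n) (simp_all add: TA_over_A_def tzero_pt tadd_Tv tscale_Tv)

text \<open>A local frame of \<open>E\<close> over \<open>A\<close> exhibits the fibre of
  \<open>E\<close> at \<open>pt a\<close> as the set of all linear combinations of finitely many
  vectors.\<close>

lemma subspace_E_at: "subspace (E_at a)"
proof -
  have "pt a \<in> points (base (TA_over_A A))" by (simp add: TA_over_A_def)
  then obtain W n s where W: "pt a \<in> W"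
      and s: "\<forall>i<n. smooth_map (base (TA_over_A A)) (total (TA_over_A A)) W (s i) \<and>
        (\<forall>y\<in>W. s i y \<in> E \<and> proj (TA_over_A A) (s i y) = y)"
      and bij: "\<forall>y\<in>W. bij_betw (\<lambda>c. lincomb (TA_over_A A) s y c n) ({..<n} \<rightarrow>\<^sub>E UNIV) {a \<in> E. proj (TA_over_A A) a = y}"
    using E_A unfolding vector_subbundle_def by blast
  have "\<exists>u. s i (pt a) = Tv a u" if "i < n" for i
  proof -
    have sE: "s i (pt a) \<in> E" "fst (s i (pt a)) = pt a" using s W that by (auto simp: TA_over_A_def)
    then show ?thesis using Tv_cases[of "s i (pt a)"] E_subset by (metis fst_Tv pt(3) pt_eq_iff subsetD)
  qed
  then obtain u where u: "\<And>i. i < n \<Longrightarrow> s i (pt a) = Tv a (u i)" by metis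
  have im: "(\<lambda>r. Tv a (\<Sum>i<n. r i *\<^sub>R u i)) ` ({..<n} \<rightarrow>\<^sub>E UNIV) = {X \<in> E. fst X = pt a}"
    using bspec[OF bij W] lincomb_TA_over_A[of n s a u, OF u] by (simp add: bij_betw_def TA_over_A_def)
  have E_at: "E_at a = range (\<lambda>r. \<Sum>i<n. r i *\<^sub>R u i)"
  proof (intro equalityI subsetI)
    fix v assume "v \<in> E_at a"
    then have "Tv a v \<in> {X \<in> E. fst X = pt a}" by (simp add: E_at_def)
    then show "v \<in> range (\<lambda>r. \<Sum>i<n. r i *\<^sub>R u i)" unfolding im[symmetric] by auto
  next
    fix v assume "v \<in> range (\<lambda>r. \<Sum>i<n. r i *\<^sub>R u i)"
    then obtain r where r: "v = (\<Sum>i<n. r i *\<^sub>R u i)" by blast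
    have "Tv a (\<Sum>i<n. restrict r {..<n} i *\<^sub>R u i) \<in> {X \<in> E. fst X = pt a}"
      unfolding im[symmetric] by (rule imageI) (auto split: if_splits)
    then show "v \<in> E_at a" by (simp add: E_at_def r)
  qed
  show ?thesis
  proof (rule subspaceI)
    show "0 \<in> E_at a" unfolding E_at by (auto intro!: image_eqI[of _ _ "\<lambda>_. 0"])
  next
    fix v v' assume "v \<in> E_at a" "v' \<in> E_at a"
    then obtain r r' where "v = (\<Sum>i<n. r i *\<^sub>R u i)" "v' = (\<Sum>i<n. r' i *\<^sub>R u i)" unfolding E_at by blast
    then show "v + v' \<in> E_at a"
      unfolding E_at by (intro image_eqI[of _ _ "\<lambda>i. r i + r' i"]) (simp_all add: scaleR_add_left sum.distrib)
  next
    fix t v assume "v \<in> E_at a"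
    then obtain r where "v = (\<Sum>i<n. r i *\<^sub>R u i)" unfolding E_at by blast
    then show "t *\<^sub>R v \<in> E_at a"
      unfolding E_at by (intro image_eqI[of _ _ "\<lambda>i. t * r i"]) (simp_all add: scaleR_sum_right)
  qed
qed

text \<open>Here the linearity of \<open>E\<close> over \<open>TM\<close> enters: the combination of
  a local frame over \<open>TM\<close> with all coefficients zero lies in \<open>E\<close>, and it
  is the zero vector over \<open>bw w\<close>.\<close>

lemma zero_in_E: "(w, 0) \<in> E_at 0"
proof -
  let ?V = "TA_over_TM A"
  have "bw w \<in> points (base ?V)" by (simp add: TA_over_TM_def points_tangent_atlas)
  then obtain W n s where W: "bw w \<in> W"
      and s: "\<forall>i<n. smooth_map (base ?V) (total ?V) W (s i) \<and>
        (\<forall>y\<in>W. s i y \<in> E \<and> proj ?V (s i y) = y)"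
      and bij: "\<forall>y\<in>W. bij_betw (\<lambda>c. lincomb ?V s y c n) ({..<n} \<rightarrow>\<^sub>E UNIV) {a \<in> E. proj ?V a = y}"
    using E_TM unfolding vector_subbundle_def by blast
  have s': "\<exists>a b. s i (bw w) = Tv a (w, b)" if "i < n" for i
  proof -
    have sE: "s i (bw w) \<in> E" "differential (total A) (base A) (proj A) (s i (bw w)) = bw w"
      using s W that by (auto simp: TA_over_TM_def)
    then have "proj A (fst (s i (bw w))) = x" using fst_differential by (metis fst_bw)
    then obtain a w' b where "s i (bw w) = Tv a (w', b)" using Tv_cases sE(1) E_subset by blast
    then show ?thesis using sE(2) by auto
  qed
  \<comment> \<open>The zero coefficients are restricted to \<open>{..<n}\<close> because the frame
    condition speaks of extensional functions.\<close>
  have "lincomb ?V s (bw w) (restrict (\<lambda>_. 0) {..<n}) m = Tv 0 (w, 0)" if "m \<le> n" for m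
    using that
  proof (induction m)
    case 0
    then show ?case by (simp add: TM_zero)
  next
    case (Suc m)
    obtain a b where "s m (bw w) = Tv a (w, b)" using s' Suc.prems by (meson Suc_le_lessD)
    with Suc show ?case by (simp add: TM_scl TM_add)
  qed
  moreover have "lincomb ?V s (bw w) (restrict (\<lambda>_. 0) {..<n}) n \<in> E"
    using bspec[OF bij W] by (auto simp: bij_betw_def)
  ultimately show ?thesis by (simp add: E_at_def)
qed

lemma ver_TA_unique:
  assumes "(w, b - \<xi>) \<in> E_at a" "\<xi> \<in> kk"
  shows "ver_TA A Q \<phi> E (Tv a (w, b)) = Tv a (0, \<xi>)"
  unfolding ver_TA_def
proof (rule the_equality)
  have sum: "Tv a (w, b) = tadd (Tv a (w, b - \<xi>)) (Tv a (0, \<xi>))" by (simp add: tadd_Tv)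
  have E: "Tv a (w, b - \<xi>) \<in> E" using assms by (simp add: E_at_def)
  have K: "Tv a (0, \<xi>) \<in> ker_quot A Q \<phi>" using assms by (simp add: ker_quot_Tv)
  show "Tv a (0, \<xi>) \<in> ker_quot A Q \<phi> \<and> fst (Tv a (0, \<xi>)) = fst (Tv a (w, b)) \<and>
      (\<exists>Y\<in>E. fst Y = fst (Tv a (w, b)) \<and> Tv a (w, b) = tadd Y (Tv a (0, \<xi>)))"
    by (intro conjI bexI[OF _ E] K sum) simp_all
  fix Z assume "Z \<in> ker_quot A Q \<phi> \<and> fst Z = fst (Tv a (w, b)) \<and>
      (\<exists>Y\<in>E. fst Y = fst (Tv a (w, b)) \<and> Tv a (w, b) = tadd Y Z)"
  then obtain Y where Y: "Z \<in> ker_quot A Q \<phi>" "fst Z = pt a" "Y \<in> E" "fst Y = pt a" "Tv a (w, b) = tadd Y Z"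
    unfolding fst_Tv by blast
  have "(Y, Z) = (Tv a (w, b - \<xi>), Tv a (0, \<xi>))"
    by (rule ex1E[OF decomp[OF Tv_tangent[of a "(w, b)"]]])
      (use Y sum E K in \<open>metis fst_Tv fst_conv snd_conv\<close>)
  then show "Z = Tv a (0, \<xi>)" by simp
qed

lemma ver_TA_exists: "\<exists>\<xi>\<in>kk. (w, b - \<xi>) \<in> E_at a"
proof -
  obtain Y Z where YZ: "Y \<in> E" "Z \<in> ker_quot A Q \<phi>" "fst Y = pt a" "fst Z = pt a" "Tv a (w, b) = tadd Y Z"
    using decomp[OF Tv_tangent[of a "(w, b)"]] by auto
  have "Z \<in> tangent (total A)" using YZ(2) by (simp add: ker_quot_def)
  then obtain w2 b2 where Z: "Z = Tv a (w2, b2)" using YZ(4) Tv_cases[of Z] by (metis fst_Tv pt(3) pt_eq_iff)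
  obtain w1 b1 where Y: "Y = Tv a (w1, b1)" using YZ(1,3) Tv_cases[of Y] E_subset by (metis fst_Tv pt(3) pt_eq_iff subsetD)
  have "w2 = 0" "b2 \<in> kk" using YZ(2) ker_quot_Tv by (simp_all add: Z)
  moreover have "w1 = w" "b1 = b - b2" using YZ(5) \<open>w2 = 0\<close> by (auto simp: Y Z tadd_Tv)
  ultimately show ?thesis using YZ(1) by (auto simp: Y E_at_def)
qed

lemma hor_TA_Tv:
  assumes "(w, b - \<xi>) \<in> E_at a" "\<xi> \<in> kk"
  shows "hor_TA A Q \<phi> E (Tv a (w, b)) = Tv a (w, b - \<xi>)"
  by (simp add: hor_TA_def ver_TA_unique[OF assms] tsub_Tv)

lemma nu_Tv:
  assumes "(w, b - \<xi>) \<in> E_at a" "\<xi> \<in> kk"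
  shows "nu A k Q \<phi> E (Tv a (w, b)) = (pt a, pt \<xi>)"
proof -
  let ?D = "{(a, \<xi>). a \<in> points (total A) \<and> \<xi> \<in> k \<and> proj A a = proj A \<xi>}"
  have mem: "(pt a, pt \<xi>) \<in> ?D" using assms(2) by (simp add: pt_in_k)
  have "vert_iso A (pt a, pt \<xi>) \<in> vert_iso A ` ?D" using mem by (rule imageI)
  then have inv: "inv_into ?D (vert_iso A) (vert_iso A (pt a, pt \<xi>)) \<in> ?D"
    "vert_iso A (inv_into ?D (vert_iso A) (vert_iso A (pt a, pt \<xi>))) = vert_iso A (pt a, pt \<xi>)"
    by (rule inv_into_into, rule f_inv_into_f)
  obtain \<alpha> \<eta> where \<alpha>\<eta>: "inv_into ?D (vert_iso A) (vert_iso A (pt a, pt \<xi>)) = (\<alpha>, \<eta>)" by fastforce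
  have D: "\<alpha> \<in> points (total A)" "\<eta> \<in> k" "proj A \<alpha> = proj A \<eta>" and
     eq: "vert_iso A (\<alpha>, \<eta>) = Tv a (0, \<xi>)" using inv[unfolded \<alpha>\<eta>] by (auto simp: vert_iso_pt)
  \<comment> \<open>\<open>nu\<close> inverts \<open>vert_iso\<close> on the whole bundle. Only when
    the foot point has shown that the chosen preimage lies over \<open>x\<close> can it be written
    in coordinates, where \<open>vert_iso\<close> is visibly injective.\<close>
  have "fst (vert_iso A (\<alpha>, \<eta>)) = add A \<alpha> (scl A 0 \<eta>)"
    by (simp add: vert_iso_def velocity_def)
  then have "add A \<alpha> (scl A 0 \<eta>) = pt a" using eq by simp
  moreover have "add A \<alpha> (scl A 0 \<eta>) \<in> fibre A (proj A \<alpha>)"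
    using D k_subset by (intro add_fibre scl_fibre) auto
  ultimately have "proj A \<alpha> = x" using pt(3) by (metis (mono_tags, lifting) mem_Collect_eq)
  then obtain a' b' where "\<alpha> = pt a'" "\<eta> = pt b'" using D k_subset fibre_cases
    by (metis (mono_tags, lifting) mem_Collect_eq subsetD)
  then have "(\<alpha>, \<eta>) = (pt a, pt \<xi>)" using eq by (simp add: vert_iso_pt)
  then show ?thesis
    unfolding nu_def ver_TA_unique[OF assms] vert_iso_pt[symmetric] \<alpha>\<eta> .
qed

definition vv :: "'f \<Rightarrow> 'f" where "vv b = cf (pair_v A k Q \<phi> E (pt b))"

lemma vv: "pair_v A k Q \<phi> E (pt b) = pt (vv b)" "vv b \<in> kk"
  and hor_core: "hor_TA A Q \<phi> E (Tv 0 (w, b)) = Tv 0 (w, b - vv b)"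
proof -
  obtain \<xi> where \<xi>: "\<xi> \<in> kk" "(0, b - \<xi>) \<in> E_at 0" using ver_TA_exists by blast
  then have *: "pair_v A k Q \<phi> E (pt b) = pt \<xi>" by (simp add: pair_v_def core_vec_pt nu_Tv)
  then show "pair_v A k Q \<phi> E (pt b) = pt (vv b)" "vv b \<in> kk" using \<xi> by (simp_all add: vv_def)
  \<comment> \<open>The zero vector over \<open>w\<close> is horizontal by \<open>zero_in_E\<close>,
    so the vertical part of a core vector does not depend on \<open>w\<close>; at
    \<open>w = 0\<close> it defines \<open>pair_v\<close>.\<close>
  have "(w, 0) + (0, b - \<xi>) \<in> E_at 0" by (intro subspace_add subspace_E_at zero_in_E \<xi>)
  then have "hor_TA A Q \<phi> E (Tv 0 (w, b)) = Tv 0 (w, b - \<xi>)" using \<xi> by (intro hor_TA_Tv) simp_all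
  then show "hor_TA A Q \<phi> E (Tv 0 (w, b)) = Tv 0 (w, b - vv b)" using * by (simp add: vv_def)
qed

lemma section_horizontal:
  assumes "\<alpha> \<in> sections A"
  obtains D C where "D 0 = 0" "C 0 = 0" "\<And>w. C w \<in> kk"
    "\<And>w. differential (base A) (total A) \<alpha> (bw w) = Tv (cf (\<alpha> x)) (w, D w)"
    "\<And>w. pair_C A k Q \<phi> E \<alpha> (bw w) = pt (C w)"
    "\<And>w. hor_TA A Q \<phi> E (Tv (cf (\<alpha> x)) (w, D w)) = Tv (cf (\<alpha> x)) (w, D w - C w)"
proof -
  obtain D where D: "linear D" "\<And>w. differential (base A) (total A) \<alpha> (bw w) = Tv (cf (\<alpha> x)) (w, D w)"
    using section_differential[OF assms] by blast
  have D0: "D 0 = 0" using D(1) by (rule linear_0)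
  \<comment> \<open>The last conjunct is built into the choice so that \<open>C 0 = 0\<close> holds
    at once; at \<open>w = 0\<close> the candidate \<open>0\<close> is admissible because
    \<open>D 0 = 0\<close>.\<close>
  have "\<forall>w. \<exists>\<xi>. \<xi> \<in> kk \<and> (w, D w - \<xi>) \<in> E_at (cf (\<alpha> x)) \<and> (w = 0 \<longrightarrow> \<xi> = 0)"
  proof
    fix w
    show "\<exists>\<xi>. \<xi> \<in> kk \<and> (w, D w - \<xi>) \<in> E_at (cf (\<alpha> x)) \<and> (w = 0 \<longrightarrow> \<xi> = 0)"
    proof (cases "w = 0")
      case True
      then have "(w, D w - 0) \<in> E_at (cf (\<alpha> x))" using D0 subspace_0[OF subspace_E_at] by (simp add: zero_prod_def)
      then show ?thesis using subspace_0[OF subspace_kk] by blast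
    qed (use ver_TA_exists in blast)
  qed
  then obtain C where C: "\<And>w. C w \<in> kk" "\<And>w. (w, D w - C w) \<in> E_at (cf (\<alpha> x))" "C 0 = 0" by metis
  show ?thesis
    by (rule that[of D C]) (simp_all add: C D D0 pair_C_def nu_Tv[OF C(2,1)] hor_TA_Tv[OF C(2,1)])
qed

end

subsection \<open>Alternating additive functions of lists\<close>

text \<open>Stated for entries in any abelian group: the expansions only take sums and differences
  of rows, and a row is a pair consisting of a vector and a function.\<close>

definition alt_additive :: "nat \<Rightarrow> ('r::ab_group_add list \<Rightarrow> real) \<Rightarrow> bool" where
  "alt_additive p f \<longleftrightarrow> (\<forall>xs. length xs = p \<longrightarrow>
     (\<forall>m<p. \<forall>r. f (xs[m := xs ! m + r]) = f xs + f (xs[m := r])) \<and>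
     (\<forall>m<p. \<forall>m'<p. m \<noteq> m' \<longrightarrow> xs ! m = xs ! m' \<longrightarrow> f xs = 0))"

lemma alt_additive_add:
  assumes "alt_additive p f" "length xs = p" "m < p"
  shows "f (xs[m := r + s]) = f (xs[m := r]) + f (xs[m := s])"
  using assms(1)[unfolded alt_additive_def, rule_format, THEN conjunct1, rule_format, of "xs[m := r]" m s] assms(2,3)
  by simp

lemma alt_additive_zero:
  assumes "alt_additive p f" "length xs = p" "m < p" "xs ! m = 0"
  shows "f xs = 0"
  using alt_additive_add[OF assms(1-3), of 0 0] assms(4) by (metis add_cancel_right_left list_update_id)

lemma alt_additive_diff:
  assumes "alt_additive p f" "length xs = p" "m < p"
  shows "f (xs[m := r - s]) = f (xs[m := r]) - f (xs[m := s])"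
  using alt_additive_add[OF assms, of "r - s" s] by simp

lemma alt_additive_sum:
  assumes "alt_additive p f" "length xs = p" "m < p" "finite K"
  shows "f (xs[m := (\<Sum>l\<in>K. z l)]) = (\<Sum>l\<in>K. f (xs[m := z l]))"
  using assms(4)
proof (induction K)
  case empty
  then show ?case using alt_additive_zero[OF assms(1), of "xs[m := 0]" m] assms(2,3) by simp
next
  case (insert l K)
  then show ?case using alt_additive_add[OF assms(1-3)] by simp
qed

lemma alt_additive_eq:
  assumes "alt_additive p f" "length xs = p" "m < p" "m' < p" "m \<noteq> m'" "xs ! m = xs ! m'"
  shows "f xs = 0"
  using assms unfolding alt_additive_def by blast

text \<open>Polarization: with the sum of the two entries in both places the value is zero, and so
  are the two pure terms, which leaves the sum of the mixed terms.\<close>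

lemma alt_additive_swap:
  assumes f: "alt_additive p f" and xs: "length xs = p" and m: "m < p" "m' < p" "m \<noteq> m'"
  shows "f (permute_list (Transposition.transpose m m') xs) = - f xs"
proof -
  let ?g = "\<lambda>r s. f (xs[m := r, m' := s])"
  have add1: "?g (r + r') s = ?g r s + ?g r' s" for r r' s
    using alt_additive_add[OF f, of "xs[m' := s]" m r r'] xs m by (simp add: list_update_swap)
  have add2: "?g r (s + s') = ?g r s + ?g r s'" for r s s'
    using alt_additive_add[OF f, of "xs[m := r]" m' s s'] xs m by simp
  have eq: "?g r r = 0" for r
    by (rule alt_additive_eq[OF f _ m]) (use xs m in simp_all)
  have "?g (xs ! m') (xs ! m) + ?g (xs ! m) (xs ! m') = 0"
    using eq[of "xs ! m + xs ! m'"] eq[of "xs ! m"] eq[of "xs ! m'"] by (simp add: add1 add2)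
  moreover have "xs[m := xs ! m, m' := xs ! m'] = xs" by simp
  moreover have "permute_list (Transposition.transpose m m') xs = xs[m := xs ! m', m' := xs ! m]"
    using xs m by (intro nth_equalityI) (auto simp: permute_list_def nth_list_update Transposition.transpose_def)
  ultimately show ?thesis by simp
qed

lemma permute_list_sign_induct:
  fixes f :: "'r list \<Rightarrow> real"
  assumes "\<sigma> permutes {..<p}" "length xs = p"
    and swap: "\<And>xs m m'. length xs = p \<Longrightarrow> m < p \<Longrightarrow> m' < p \<Longrightarrow> m \<noteq> m' \<Longrightarrow>
      f (permute_list (Transposition.transpose m m') xs) = - f xs"
  shows "f (permute_list \<sigma> xs) = of_int (sign \<sigma>) * f xs"
  using assms(1) finite_lessThan assms(2)
proof (induction arbitrary: xs rule: permutes_induct)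
  case id
  then show ?case by simp
next
  case (swap a b \<sigma>)
  \<comment> \<open>The transposition acts on the list before \<open>\<sigma>\<close> does, so the
    induction hypothesis is applied to the transposed list; hence \<open>xs\<close> is
    arbitrary.\<close>
  have "permute_list (Transposition.transpose a b \<circ> \<sigma>) xs
      = permute_list \<sigma> (permute_list (Transposition.transpose a b) xs)"
    using swap by (intro permute_list_compose) simp
  then have "f (permute_list (Transposition.transpose a b \<circ> \<sigma>) xs) = of_int (sign \<sigma>) * - f xs"
    using swap assms(3)[of xs a b] by simp
  moreover have "sign (Transposition.transpose a b \<circ> \<sigma>) = - sign \<sigma>"
    using swap permutation_permutes by (subst sign_compose) (auto simp: sign_swap_id permutation_swap_id)
  ultimately show ?case by (metis mult_minus_left mult_minus_right of_int_minus)
qed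

lemma alt_additive_permute:
  assumes "alt_additive p f" "\<sigma> permutes {..<p}" "length xs = p"
  shows "f (permute_list \<sigma> xs) = of_int (sign \<sigma>) * f xs"
  by (rule permute_list_sign_induct[OF assms(2,3)]) (rule alt_additive_swap[OF assms(1)])

lemma alt_additive_append:
  assumes f: "alt_additive (l + p) f" and pre: "length pre = l"
  shows "alt_additive p (\<lambda>xs. f (pre @ xs))"
  unfolding alt_additive_def
proof (intro allI impI conjI)
  fix xs :: "'a list" and m r assume xs: "length xs = p" and m: "m < p"
  have "pre @ xs[m := s] = (pre @ xs)[l + m := s]" for s using pre by (simp add: list_update_append)
  moreover have "pre @ xs = (pre @ xs)[l + m := xs ! m]" using pre xs m by (simp add: list_update_append)
  ultimately show "f (pre @ xs[m := xs ! m + r]) = f (pre @ xs) + f (pre @ xs[m := r])"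
    using alt_additive_add[OF f, of "pre @ xs" "l + m" "xs ! m" r] pre xs m by simp
next
  fix xs :: "'a list" and m m' assume "length xs = p" "m < p" "m' < p" "m \<noteq> m'" "xs ! m = xs ! m'"
  then show "f (pre @ xs) = 0"
    using pre by (intro alt_additive_eq[OF f, of _ "l + m" "l + m'"]) (simp_all add: nth_append)
qed

lemma alt_additive_append_right:
  assumes f: "alt_additive (p + l) f" and post: "length post = l"
  shows "alt_additive p (\<lambda>xs. f (xs @ post))"
  unfolding alt_additive_def
proof (intro allI impI conjI)
  fix xs :: "'a list" and m r assume xs: "length xs = p" and m: "m < p"
  have "xs[m := s] @ post = (xs @ post)[m := s]" for s using xs m by (simp add: list_update_append)
  then show "f (xs[m := xs ! m + r] @ post) = f (xs @ post) + f (xs[m := r] @ post)"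
    using alt_additive_add[OF f, of "xs @ post" m "xs ! m" r] post xs m
    by (metis length_append list_update_id trans_less_add1)
next
  fix xs :: "'a list" and m m' assume "length xs = p" "m < p" "m' < p" "m \<noteq> m'" "xs ! m = xs ! m'"
  then show "f (xs @ post) = 0"
    using post by (intro alt_additive_eq[OF f, of _ m m']) (simp_all add: nth_append)
qed

text \<open>The induction peels off the last difference and moves the chosen entry into
  \<open>post\<close>. Subsets of \<open>{..<Suc j}\<close> are split according to whether they
  contain \<open>j\<close>.\<close>

lemma alt_additive_expand_diff:
  assumes f: "alt_additive n f" and "length post = n - j" "j \<le> n"
  shows "f (map (\<lambda>m. t m - y m) [0..<j] @ post)
    = (\<Sum>S\<in>Pow {..<j}. (- 1) ^ card S * f (map (\<lambda>m. if m \<in> S then y m else t m) [0..<j] @ post))"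
  using assms(2,3)
proof (induction j arbitrary: post)
  case 0
  then show ?case by simp
next
  case (Suc j)
  let ?h = "\<lambda>S. map (\<lambda>m. if m \<in> S then y m else t m) [0..<j]"
  let ?l = "map (\<lambda>m. t m - y m) [0..<j]"
  have upd: "(?l @ 0 # post)[j := r] = ?l @ r # post" for r by (simp add: list_update_append)
  have "f (map (\<lambda>m. t m - y m) [0..<Suc j] @ post) = f (?l @ t j # post) - f (?l @ y j # post)"
    using alt_additive_diff[OF f, of "?l @ 0 # post" j "t j" "y j"] Suc.prems by (simp add: upd)
  also have "\<dots> = (\<Sum>S\<in>Pow {..<j}. (- 1) ^ card S * f (?h S @ t j # post))
       + (\<Sum>S\<in>Pow {..<j}. (- 1) ^ Suc (card S) * f (?h S @ y j # post))"
    using Suc.IH[of "t j # post"] Suc.IH[of "y j # post"] Suc.prems by (simp add: sum_negf)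
  also have "(\<Sum>S\<in>Pow {..<j}. (- 1) ^ card S * f (?h S @ t j # post))
      = (\<Sum>S\<in>Pow {..<j}. (- 1) ^ card S * f (map (\<lambda>m. if m \<in> S then y m else t m) [0..<Suc j] @ post))"
    by (intro sum.cong) auto
  also have "(\<Sum>S\<in>Pow {..<j}. (- 1) ^ Suc (card S) * f (?h S @ y j # post))
      = (\<Sum>S\<in>insert j ` Pow {..<j}. (- 1) ^ card S * f (map (\<lambda>m. if m \<in> S then y m else t m) [0..<Suc j] @ post))"
  proof (subst sum.reindex)
    show "inj_on (insert j) (Pow {..<j})" by (rule inj_onI) (auto dest: insert_ident[THEN iffD1, rotated 2])
    show "(\<Sum>S\<in>Pow {..<j}. (- 1) ^ Suc (card S) * f (?h S @ y j # post))
      = sum ((\<lambda>S. (- 1) ^ card S * f (map (\<lambda>m. if m \<in> S then y m else t m) [0..<Suc j] @ post)) \<circ> insert j) (Pow {..<j})"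
    proof (rule sum.cong)
      fix S assume S: "S \<in> Pow {..<j}"
      then have "finite S" "j \<notin> S" using finite_subset by auto
      moreover have "map (\<lambda>m. if m \<in> insert j S then y m else t m) [0..<Suc j] @ post = ?h S @ y j # post"
        by auto
      ultimately show "(- 1) ^ Suc (card S) * f (?h S @ y j # post)
        = ((\<lambda>S. (- 1) ^ card S * f (map (\<lambda>m. if m \<in> S then y m else t m) [0..<Suc j] @ post)) \<circ> insert j) S"
        by (simp only: comp_def card_insert_disjoint not_False_eq_True)
    qed simp
  qed
  finally show ?case
    by (subst (asm) sum.union_disjoint[symmetric]) (auto simp: lessThan_Suc Pow_insert)
qed

text \<open>The same induction as for differences; a function on \<open>{..<Suc j}\<close> is a
  function on \<open>{..<j}\<close> together with its value at \<open>j\<close>.\<close>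

lemma alt_additive_expand_sum:
  assumes f: "alt_additive n f" and "length post = n - j" "j \<le> n" and K: "finite K"
  shows "f (map (\<lambda>m. \<Sum>l\<in>K. z m l) [0..<j] @ post)
    = (\<Sum>g\<in>{..<j} \<rightarrow>\<^sub>E K. f (map (\<lambda>m. z m (g m)) [0..<j] @ post))"
  using assms(2,3)
proof (induction j arbitrary: post)
  case 0
  then show ?case by simp
next
  case (Suc j)
  let ?l = "map (\<lambda>m. \<Sum>l\<in>K. z m l) [0..<j]"
  have upd: "(?l @ 0 # post)[j := r] = ?l @ r # post" for r by (simp add: list_update_append)
  have eq: "map (\<lambda>m. z m ((g(j := l)) m)) [0..<j] = map (\<lambda>m. z m (g m)) [0..<j]" for g l
    by (rule map_cong) auto
  have "f (map (\<lambda>m. \<Sum>l\<in>K. z m l) [0..<Suc j] @ post) = (\<Sum>l\<in>K. f (?l @ z j l # post))"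
    using alt_additive_sum[OF f, of "?l @ 0 # post" j K "z j"] Suc.prems K by (simp add: upd)
  also have "\<dots> = (\<Sum>l\<in>K. \<Sum>g\<in>{..<j} \<rightarrow>\<^sub>E K. f (map (\<lambda>m. z m (g m)) [0..<j] @ z j l # post))"
    using Suc.IH Suc.prems by (intro sum.cong) simp_all
  also have "\<dots> = (\<Sum>(l, g)\<in>K \<times> ({..<j} \<rightarrow>\<^sub>E K). f (map (\<lambda>m. z m (g m)) [0..<j] @ z j l # post))"
    by (rule sum.cartesian_product)
  also have "\<dots> = (\<Sum>g\<in>(\<lambda>(l, g). g(j := l)) ` (K \<times> ({..<j} \<rightarrow>\<^sub>E K)). f (map (\<lambda>m. z m (g m)) [0..<Suc j] @ post))"
  proof (subst sum.reindex)
    show "inj_on (\<lambda>(l, g). g(j := l)) (K \<times> ({..<j} \<rightarrow>\<^sub>E K))" by (rule inj_combinator) simp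
    show "(\<Sum>(l, g)\<in>K \<times> ({..<j} \<rightarrow>\<^sub>E K). f (map (\<lambda>m. z m (g m)) [0..<j] @ z j l # post))
      = sum ((\<lambda>g. f (map (\<lambda>m. z m (g m)) [0..<Suc j] @ post)) \<circ> (\<lambda>(l, g). g(j := l))) (K \<times> ({..<j} \<rightarrow>\<^sub>E K))"
    proof (rule sum.cong)
      fix lg assume "lg \<in> K \<times> ({..<j} \<rightarrow>\<^sub>E K)"
      obtain l g where lg: "lg = (l, g)" by fastforce
      have "map (\<lambda>m. z m ((g(j := l)) m)) [0..<Suc j] @ post = map (\<lambda>m. z m (g m)) [0..<j] @ z j l # post"
        using eq[of g l] by simp
      then show "(case lg of (l, g) \<Rightarrow> f (map (\<lambda>m. z m (g m)) [0..<j] @ z j l # post))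
         = ((\<lambda>g. f (map (\<lambda>m. z m (g m)) [0..<Suc j] @ post)) \<circ> (\<lambda>(l, g). g(j := l))) lg"
        by (simp only: lg comp_def prod.case)
    qed simp
  qed
  also have "(\<lambda>(l, g). g(j := l)) ` (K \<times> ({..<j} \<rightarrow>\<^sub>E K)) = {..<Suc j} \<rightarrow>\<^sub>E K"
    by (simp add: lessThan_Suc PiE_insert_eq)
  finally show ?case .
qed

section \<open>Counting extensions of injections to permutations, and shuffles as subsets\<close>

lemma card_permutations_extending:
  assumes g: "inj_on g {..<s}" "g ` {..<s} \<subseteq> {..<N}" and s: "s \<le> N"
  shows "card {\<tau>. \<tau> permutes {..<N} \<and> (\<forall>m<s. \<tau> m = g m)} = fact (N - s)" (is "card ?P = _")
proof -
  have "card ({..<N} - g ` {..<s}) = card {s..<N}"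
    using g by (subst card_Diff_subset) (auto simp: card_image)
  then obtain h where h: "bij_betw h {s..<N} ({..<N} - g ` {..<s})"
    by (metis finite_Diff finite_atLeastLessThan finite_lessThan finite_same_card_bij)
  \<comment> \<open>One particular extension of \<open>g\<close>, by any bijection \<open>h\<close>
    between the complements. Every other extension is \<open>\<tau>0\<close> after a permutation of
    \<open>{s..<N}\<close>, which gives the factorial.\<close>
  define \<tau>0 where "\<tau>0 = (\<lambda>i. if i < s then g i else if i < N then h i else i)"
  have "bij_betw \<tau>0 ({..<s} \<union> {s..<N}) (g ` {..<s} \<union> ({..<N} - g ` {..<s}))"
  proof (rule bij_betw_combine)
    show "bij_betw \<tau>0 {..<s} (g ` {..<s})"
      using g(1) by (subst bij_betw_cong[of _ _ g]) (auto simp: \<tau>0_def bij_betw_def)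
    show "bij_betw \<tau>0 {s..<N} ({..<N} - g ` {..<s})"
      using h by (subst bij_betw_cong[of _ _ h]) (auto simp: \<tau>0_def)
  qed auto
  moreover have "{..<s} \<union> {s..<N} = {..<N}" "g ` {..<s} \<union> ({..<N} - g ` {..<s}) = {..<N}" using s g(2) by auto
  ultimately have \<tau>0: "\<tau>0 permutes {..<N}" by (intro bij_imp_permutes) (auto simp: \<tau>0_def)
  have \<tau>0g: "\<tau>0 m = g m" if "m < s" for m using that by (simp add: \<tau>0_def)
  have "bij_betw (\<lambda>\<rho>. \<tau>0 \<circ> \<rho>) {\<rho>. \<rho> permutes {s..<N}} ?P"
  proof (rule bij_betw_byWitness[where f' = "\<lambda>\<tau>. inv_into UNIV \<tau>0 \<circ> \<tau>"])
    show "\<forall>\<rho>\<in>{\<rho>. \<rho> permutes {s..<N}}. inv_into UNIV \<tau>0 \<circ> (\<tau>0 \<circ> \<rho>) = \<rho>"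
      using permutes_inv_o(2)[OF \<tau>0] by (simp add: o_assoc)
    show "\<forall>\<tau>\<in>?P. \<tau>0 \<circ> (inv_into UNIV \<tau>0 \<circ> \<tau>) = \<tau>"
      using permutes_inv_o(1)[OF \<tau>0] by (simp add: o_assoc)
    show "(\<lambda>\<rho>. \<tau>0 \<circ> \<rho>) ` {\<rho>. \<rho> permutes {s..<N}} \<subseteq> ?P"
    proof (intro image_subsetI CollectI conjI allI impI)
      fix \<rho> assume "\<rho> \<in> {\<rho>. \<rho> permutes {s..<N}}"
      then have \<rho>: "\<rho> permutes {s..<N}" by simp
      then have "\<rho> permutes {..<N}" by (rule permutes_subset) auto
      then show "\<tau>0 \<circ> \<rho> permutes {..<N}" using \<tau>0 by (rule permutes_compose)
      show "(\<tau>0 \<circ> \<rho>) m = g m" if "m < s" for m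
        using permutes_not_in[OF \<rho>, of m] that \<tau>0g by simp
    qed
    show "(\<lambda>\<tau>. inv_into UNIV \<tau>0 \<circ> \<tau>) ` ?P \<subseteq> {\<rho>. \<rho> permutes {s..<N}}"
    proof (intro image_subsetI CollectI)
      fix \<tau> assume "\<tau> \<in> ?P"
      then have \<tau>: "\<tau> permutes {..<N}" "\<And>m. m < s \<Longrightarrow> \<tau> m = \<tau>0 m" using \<tau>0g by auto
      have "inv_into UNIV \<tau>0 \<circ> \<tau> permutes {..<N}" using \<tau>(1) \<tau>0 by (intro permutes_compose permutes_inv)
      moreover have "(inv_into UNIV \<tau>0 \<circ> \<tau>) m = m" if "m \<in> {..<N} - {s..<N}" for m
        using that \<tau>(2)[of m] permutes_inverses(2)[OF \<tau>0] by auto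
      ultimately show "inv_into UNIV \<tau>0 \<circ> \<tau> permutes {s..<N}" by (rule permutes_superset)
    qed
  qed
  then have "card ?P = card {\<rho>. \<rho> permutes {s..<N}}"
    by (simp add: bij_betw_same_card)
  also have "\<dots> = fact (N - s)" by (intro card_permutations) auto
  finally show ?thesis .
qed

text \<open>Grouping permutations by their restriction to \<open>{..<s}\<close> meets every
  injection \<open>fact (N - s)\<close> times. This is the origin of the normalizing factor in
  \<open>wedge_dot\<close>, with \<open>N - s\<close> the degree of the form.\<close>

lemma sum_functions_eq_sum_permutations:
  fixes F :: "(nat \<Rightarrow> nat) \<Rightarrow> real"
  assumes F: "\<And>g. \<not> inj_on g {..<s} \<Longrightarrow> g \<in> {..<s} \<rightarrow>\<^sub>E {..<N} \<Longrightarrow> F g = 0" and s: "s \<le> N"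
  shows "(\<Sum>g\<in>{..<s} \<rightarrow>\<^sub>E {..<N}. F g)
    = 1 / fact (N - s) * (\<Sum>\<tau>\<in>{\<tau>. \<tau> permutes {..<N}}. F (restrict \<tau> {..<s}))"
    (is "_ = _ * sum _ ?P")
proof -
  let ?Z = "\<lambda>g. {\<tau> \<in> ?P. restrict \<tau> {..<s} = g}"
  let ?T = "{g \<in> {..<s} \<rightarrow>\<^sub>E {..<N}. inj_on g {..<s}}"
  have fin: "finite ({..<s} \<rightarrow>\<^sub>E {..<N})" by (intro finite_PiE) auto
  have sub: "(\<lambda>\<tau>. restrict \<tau> {..<s}) ` ?P \<subseteq> ?T"
  proof (intro image_subsetI CollectI conjI)
    fix \<tau> assume "\<tau> \<in> ?P"
    then have \<tau>: "\<tau> permutes {..<N}" by simp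
    show "restrict \<tau> {..<s} \<in> {..<s} \<rightarrow>\<^sub>E {..<N}" using permutes_in_image[OF \<tau>] s by auto
    show "inj_on (restrict \<tau> {..<s}) {..<s}" using permutes_inj_on[OF \<tau>] by (simp add: inj_on_restrict_eq)
  qed
  have "(\<Sum>\<tau>\<in>?P. F (restrict \<tau> {..<s}))
     = (\<Sum>g\<in>?T. \<Sum>\<tau>\<in>?Z g. F (restrict \<tau> {..<s}))"
    using fin sub by (intro sum.group[symmetric] finite_permutations) auto
  also have "\<dots> = (\<Sum>g\<in>?T. fact (N - s) * F g)"
  proof (rule sum.cong)
    fix g assume g: "g \<in> ?T"
    have "?Z g = {\<tau>. \<tau> permutes {..<N} \<and> (\<forall>m<s. \<tau> m = g m)}"
      using g by (auto simp: fun_eq_iff restrict_def PiE_def extensional_def)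
    moreover have "card {\<tau>. \<tau> permutes {..<N} \<and> (\<forall>m<s. \<tau> m = g m)} = fact (N - s)"
      using g s by (intro card_permutations_extending) auto
    moreover have "(\<Sum>\<tau>\<in>?Z g. F (restrict \<tau> {..<s}))
       = (\<Sum>\<tau>\<in>?Z g. F g)"
      by (intro sum.cong) auto
    ultimately show "(\<Sum>\<tau>\<in>?Z g. F (restrict \<tau> {..<s})) = fact (N - s) * F g"
      by simp
  qed simp
  also have "\<dots> = fact (N - s) * (\<Sum>g\<in>?T. F g)" by (simp add: sum_distrib_left)
  also have "(\<Sum>g\<in>?T. F g) = (\<Sum>g\<in>{..<s} \<rightarrow>\<^sub>E {..<N}. F g)"
    using F fin by (intro sum.mono_neutral_left) auto
  finally have eq: "(\<Sum>\<tau>\<in>?P. F (restrict \<tau> {..<s}))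
    = fact (N - s) * (\<Sum>g\<in>{..<s} \<rightarrow>\<^sub>E {..<N}. F g)" .
  show ?thesis unfolding eq by simp
qed

text \<open>Each block of a shuffle is increasing, hence the sorted list of its image. A shuffle is
  thus determined by the image of its first block.\<close>

lemma shuffle_perms_image:
  assumes "\<sigma> \<in> shuffle_perms a b"
  shows "\<sigma> ` {a..<a + b} = {..<a + b} - \<sigma> ` {..<a}" "\<sigma> ` {..<a} \<subseteq> {..<a + b}" "card (\<sigma> ` {..<a}) = a"
    "map \<sigma> [0..<a] = sorted_list_of_set (\<sigma> ` {..<a})"
    "map \<sigma> [a..<a + b] = sorted_list_of_set ({..<a + b} - \<sigma> ` {..<a})"
proof -
  have \<sigma>: "\<sigma> permutes {..<a + b}" "strict_mono_on {..<a} \<sigma>" "strict_mono_on {a..<a + b} \<sigma>"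
    using assms by (auto simp: shuffle_perms_def)
  have inj: "inj \<sigma>" using \<sigma>(1) by (rule permutes_inj)
  have "\<sigma> ` {a..<a + b} = \<sigma> ` ({..<a + b} - {..<a})" by (intro arg_cong[of _ _ "image \<sigma>"]) auto
  also have "\<dots> = {..<a + b} - \<sigma> ` {..<a}" using image_set_diff[OF inj] permutes_image[OF \<sigma>(1)] by metis
  finally show 1: "\<sigma> ` {a..<a + b} = {..<a + b} - \<sigma> ` {..<a}" .
  have "\<sigma> ` {..<a} \<subseteq> \<sigma> ` {..<a + b}" by (intro image_mono) auto
  then show "\<sigma> ` {..<a} \<subseteq> {..<a + b}" by (simp only: permutes_image[OF \<sigma>(1)])
  show "card (\<sigma> ` {..<a}) = a" using card_image[of \<sigma> "{..<a}"] inj by (simp add: inj_on_subset)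
  have srt: "map \<sigma> [i..<j] = sorted_list_of_set (\<sigma> ` {i..<j})" if "strict_mono_on {i..<j} \<sigma>" for i j
  proof (rule sorted_distinct_set_unique)
    show "sorted (map \<sigma> [i..<j])"
      by (auto simp: sorted_iff_nth_mono intro!: mono_onD[OF strict_mono_on_imp_mono_on[OF that]])
    show "distinct (map \<sigma> [i..<j])" by (auto simp: distinct_map intro: inj_on_subset[OF inj])
  qed auto
  show "map \<sigma> [0..<a] = sorted_list_of_set (\<sigma> ` {..<a})"
    using srt[of 0 a] \<sigma>(2) by (simp add: lessThan_atLeast0)
  show "map \<sigma> [a..<a + b] = sorted_list_of_set ({..<a + b} - \<sigma> ` {..<a})"
    using srt[OF \<sigma>(3)] 1 by simp
qed

lemma bij_betw_shuffle_perms: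
  "bij_betw (\<lambda>\<sigma>. \<sigma> ` {..<a}) (shuffle_perms a b) {S \<in> Pow {..<a + b}. card S = a}"
  unfolding bij_betw_def
proof (intro conjI inj_onI subset_antisym image_subsetI subsetI)
  fix \<sigma> \<sigma>' assume s: "\<sigma> \<in> shuffle_perms a b" "\<sigma>' \<in> shuffle_perms a b" and eq: "\<sigma> ` {..<a} = \<sigma>' ` {..<a}"
  have 1: "map \<sigma> [0..<a] = map \<sigma>' [0..<a]" using shuffle_perms_image(4)[OF s(1)] shuffle_perms_image(4)[OF s(2)] eq by simp
  have 2: "map \<sigma> [a..<a + b] = map \<sigma>' [a..<a + b]" using shuffle_perms_image(5)[OF s(1)] shuffle_perms_image(5)[OF s(2)] eq by simp
  show "\<sigma> = \<sigma>'"
  proof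
    fix i
    consider "i < a" | "a \<le> i" "i < a + b" | "a + b \<le> i" by linarith
    then show "\<sigma> i = \<sigma>' i"
    proof cases
      case 3
      have "\<sigma> permutes {..<a + b}" "\<sigma>' permutes {..<a + b}" using s by (simp_all add: shuffle_perms_def)
      then show ?thesis using 3 permutes_not_in[of _ "{..<a + b}" i] by (metis lessThan_iff not_less)
    qed (use 1 2 in auto)
  qed
next
  fix \<sigma> assume "\<sigma> \<in> shuffle_perms a b"
  then show "\<sigma> ` {..<a} \<in> {S \<in> Pow {..<a + b}. card S = a}" using shuffle_perms_image by blast
next
  fix S assume S: "S \<in> {S \<in> Pow {..<a + b}. card S = a}"
  then have fS: "finite S" and cS: "card S = a" and sS: "S \<subseteq> {..<a + b}" using finite_subset[of S "{..<a + b}"] by auto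
  let ?u = "sorted_list_of_set S" and ?v = "sorted_list_of_set ({..<a + b} - S)"
  have lu: "length ?u = a" using cS by simp
  have lv: "length ?v = b" using cS fS sS by (simp add: card_Diff_subset)
  \<comment> \<open>The shuffle that enumerates \<open>S\<close> increasingly, followed by its
    complement, and fixes everything beyond.\<close>
  define \<sigma> where "\<sigma> = (\<lambda>i. if i < a then ?u ! i else if i < a + b then ?v ! (i - a) else i)"
  have b1: "bij_betw \<sigma> {..<a} S"
  proof -
    have "bij_betw (\<lambda>i. ?u ! i) {..<a} S" using bij_betw_nth[of ?u "{..<a}" S] lu fS by simp
    then show ?thesis by (subst bij_betw_cong[of _ _ "\<lambda>i. ?u ! i"]) (auto simp: \<sigma>_def)
  qed
  have b2: "bij_betw \<sigma> {a..<a + b} ({..<a + b} - S)"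
  proof -
    have 1: "bij_betw (\<lambda>i. i - a) {a..<a + b} {..<b}"
      by (rule bij_betw_byWitness[where f' = "\<lambda>i. i + a"]) auto
    have 2: "bij_betw (\<lambda>i. ?v ! i) {..<b} ({..<a + b} - S)" using bij_betw_nth[of ?v "{..<b}" "{..<a + b} - S"] lv by simp
    have "bij_betw (\<lambda>i. ?v ! (i - a)) {a..<a + b} ({..<a + b} - S)" using bij_betw_trans[OF 1 2] by (simp add: o_def)
    then show ?thesis by (subst bij_betw_cong[of _ _ "\<lambda>i. ?v ! (i - a)"]) (auto simp: \<sigma>_def)
  qed
  have "bij_betw \<sigma> ({..<a} \<union> {a..<a + b}) (S \<union> ({..<a + b} - S))" using b1 b2 by (rule bij_betw_combine) auto
  moreover have "{..<a} \<union> {a..<a + b} = {..<a + b}" "S \<union> ({..<a + b} - S) = {..<a + b}" using sS by auto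
  ultimately have "\<sigma> permutes {..<a + b}" by (intro bij_imp_permutes) (auto simp: \<sigma>_def)
  moreover have "strict_mono_on {..<a} \<sigma>"
    using strict_sorted_list_of_set[of S] lu by (auto simp: strict_mono_on_def \<sigma>_def sorted_wrt_iff_nth_less)
  moreover have "strict_mono_on {a..<a + b} \<sigma>"
    using strict_sorted_list_of_set[of "{..<a + b} - S"] lv by (auto simp: strict_mono_on_def \<sigma>_def sorted_wrt_iff_nth_less)
  ultimately have "\<sigma> \<in> shuffle_perms a b" by (simp add: shuffle_perms_def)
  moreover have "\<sigma> ` {..<a} = S" using b1 by (simp add: bij_betw_def)
  ultimately show "S \<in> (\<lambda>\<sigma>. \<sigma> ` {..<a}) ` shuffle_perms a b" by blast
qed

text \<open>The subsets of rows taken from \<open>y\<close> are grouped by cardinality and replaced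
  by shuffles. Reordering the rows so that those from \<open>y\<close> come in front produces the
  sign of the shuffle.\<close>

lemma alt_additive_expand_shuffles:
  assumes f: "alt_additive n f"
  shows "f (map (\<lambda>m. t m - y m) [0..<n]) = (\<Sum>a\<le>n. (- 1) ^ a * (\<Sum>\<sigma>\<in>shuffle_perms a (n - a).
    of_int (sign \<sigma>) * f (map (\<lambda>m. y (\<sigma> m)) [0..<a] @ map (\<lambda>m. t (\<sigma> m)) [a..<n])))"
    (is "_ = (\<Sum>a\<le>n. _ * (\<Sum>\<sigma>\<in>_. _ * f (?T a \<sigma>)))")
proof -
  let ?R = "\<lambda>S. map (\<lambda>m. if m \<in> S then y m else t m) [0..<n]"
  have "f (map (\<lambda>m. t m - y m) [0..<n]) = (\<Sum>S\<in>Pow {..<n}. (- 1) ^ card S * f (?R S))"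
    using alt_additive_expand_diff[OF f, of "[]" n] by simp
  also have "\<dots> = (\<Sum>a\<le>n. \<Sum>S\<in>{S \<in> Pow {..<n}. card S = a}. (- 1) ^ card S * f (?R S))"
  proof (rule sum.group[symmetric])
    show "card ` Pow {..<n} \<subseteq> {..n}" using card_mono[of "{..<n}"] by auto
  qed auto
  also have "\<dots> = (\<Sum>a\<le>n. (- 1) ^ a * (\<Sum>\<sigma>\<in>shuffle_perms a (n - a). of_int (sign \<sigma>) * f (?T a \<sigma>)))"
  proof (rule sum.cong)
    fix a assume "a \<in> {..n}"
    then have n: "a + (n - a) = n" by simp
    have "(\<Sum>S\<in>{S \<in> Pow {..<n}. card S = a}. (- 1) ^ card S * f (?R S))
        = (- 1) ^ a * (\<Sum>S\<in>{S \<in> Pow {..<n}. card S = a}. f (?R S))"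
      by (simp add: sum_distrib_left)
    also have "(\<Sum>S\<in>{S \<in> Pow {..<n}. card S = a}. f (?R S)) = (\<Sum>\<sigma>\<in>shuffle_perms a (n - a). f (?R (\<sigma> ` {..<a})))"
      using sum.reindex_bij_betw[OF bij_betw_shuffle_perms[of a "n - a"], of "\<lambda>S. f (?R S)"] unfolding n by simp
    also have "\<dots> = (\<Sum>\<sigma>\<in>shuffle_perms a (n - a). of_int (sign \<sigma>) * f (?T a \<sigma>))"
    proof (rule sum.cong)
      fix \<sigma> assume s: "\<sigma> \<in> shuffle_perms a (n - a)"
      then have \<sigma>: "\<sigma> permutes {..<n}" unfolding shuffle_perms_def n by blast
      have "\<sigma> m \<in> \<sigma> ` {..<a} \<longleftrightarrow> m < a" for m using permutes_inj[OF \<sigma>] by (auto simp: inj_image_mem_iff)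
      moreover have "\<sigma> m < n" if "m < n" for m using permutes_in_image[OF \<sigma>] that by auto
      ultimately have "permute_list \<sigma> (?R (\<sigma> ` {..<a})) = map (\<lambda>m. if m < a then y (\<sigma> m) else t (\<sigma> m)) [0..<n]"
        by (auto simp: permute_list_def)
      also have "\<dots> = ?T a \<sigma>"
        using upt_add_eq_append[of 0 a "n - a"] n by simp
      finally have "f (?T a \<sigma>) = of_int (sign \<sigma>) * f (?R (\<sigma> ` {..<a}))"
        using alt_additive_permute[OF f \<sigma>, of "?R (\<sigma> ` {..<a})"] by simp
      then have "of_int (sign \<sigma>) * f (?T a \<sigma>)
          = of_int (sign \<sigma> * sign \<sigma>) * f (?R (\<sigma> ` {..<a}))"
        by (simp only: of_int_mult mult.assoc)
      then show "f (?R (\<sigma> ` {..<a})) = of_int (sign \<sigma>) * f (?T a \<sigma>)"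
        by simp
    qed simp
    finally show "(\<Sum>S\<in>{S \<in> Pow {..<n}. card S = a}. (- 1) ^ card S * f (?R S)) = (- 1) ^ a * (\<Sum>\<sigma>\<in>shuffle_perms a (n - a). of_int (sign \<sigma>) * f (?T a \<sigma>))" .
  qed simp
  finally show ?thesis .
qed

subsection \<open>Exterior cochains in a bundle chart\<close>

text \<open>Cutting off after \<open>n\<close> entries leaves a finite range, so that the sequence
  is bounded and \<open>Bcontfun\<close> yields it as intended.\<close>

definition bseq :: "nat \<Rightarrow> (nat \<Rightarrow> 'z::real_normed_vector) \<Rightarrow> nat \<Rightarrow>\<^sub>C 'z" where
  "bseq n g = Bcontfun (\<lambda>i. if i < n then g i else 0)"

lemma apply_bseq [simp]: "apply_bcontfun (bseq n g) i = (if i < n then g i else 0)"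
proof -
  have "range (\<lambda>i. if i < n then g i else 0) \<subseteq> insert 0 (g ` {..<n})" by auto
  then have "finite (range (\<lambda>i. if i < n then g i else 0))" by (rule finite_subset) simp
  then have "(\<lambda>i. if i < n then g i else 0) \<in> bcontfun"
    by (simp add: bcontfun_def finite_imp_bounded)
  then show ?thesis by (simp add: bseq_def Bcontfun_inverse)
qed

definition single :: "nat \<Rightarrow> 'z::zero \<Rightarrow> nat \<Rightarrow> 'z" where
  "single i v = (\<lambda>l. if l = i then v else 0)"

locale cochain_chart = connection_chart A Q d c c' x dQ cQ k \<phi> E
  for A :: "('m, 'e::real_normed_vector, 'a, 'e \<times> 'f::real_normed_vector) vbundle"
    and Q :: "('m, 'e, 'b, 'e \<times> 'g::real_normed_vector) vbundle"
    and d c c' x dQ cQ k \<phi> E +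
  fixes p q :: nat and \<omega> :: "('m, 'e, 'a, 'e \<times> 'f) cochain"
  assumes \<omega>: "\<omega> \<in> ext_cochains A k p q"
begin

text \<open>The functional on the fibre of \<open>k\<close> that is written with a functional
  \<open>L\<close> on the whole typical fibre in the definition of smooth cochains.\<close>

definition zeta :: "('f \<Rightarrow>\<^sub>L real) \<Rightarrow> 'a \<Rightarrow> real" where
  "zeta L = (\<lambda>\<xi>. if \<xi> \<in> k \<and> proj A \<xi> = x then blinfun_apply L (cf \<xi>) else 0)"

text \<open>A row \<open>(a, b)\<close> encodes the element of \<open>Aq\<close> over \<open>Mpt w \<zeta>\<close> at \<open>pt a\<close> with vertical
  coordinates \<open>b\<close>; only \<open>w i\<close> and \<open>b i\<close> with \<open>i < q\<close> matter.\<close>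

definition Mpt :: "(nat \<Rightarrow> 'e) \<Rightarrow> ('a \<Rightarrow> real) \<Rightarrow> ('m, 'e, 'a) Mq_point" where
  "Mpt w \<zeta> = (map (\<lambda>i. bw (w i)) [0..<q], x, \<zeta>)"

definition Rpt :: "(nat \<Rightarrow> 'e) \<Rightarrow> ('a \<Rightarrow> real) \<Rightarrow> 'f \<times> (nat \<Rightarrow> 'f) \<Rightarrow> ('a, 'e \<times> 'f) Aq_point" where
  "Rpt w \<zeta> r = (map (\<lambda>i. Tv (fst r) (w i, snd r i)) [0..<q], pt (fst r), \<zeta>)"

definition Om :: "(nat \<Rightarrow> 'e) \<Rightarrow> ('a \<Rightarrow> real) \<Rightarrow> ('f \<times> (nat \<Rightarrow> 'f)) list \<Rightarrow> real" where
  "Om w \<zeta> rs = \<omega> (Mpt w \<zeta>) (map (Rpt w \<zeta>) rs)"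

definition Om_mat :: "(nat \<Rightarrow> 'e) \<Rightarrow> ('a \<Rightarrow> real) \<Rightarrow> (nat \<Rightarrow> 'f) \<Rightarrow> (nat \<Rightarrow> nat \<Rightarrow> 'f) \<Rightarrow> real" where
  "Om_mat w \<zeta> a b = Om w \<zeta> (map (\<lambda>m. (a m, b m)) [0..<p])"

lemma finite_span_fibre: "\<exists>B::'f set. finite B \<and> span B = UNIV"
proof -
  have "smooth_atlas (total A)" using V by (simp add: vector_bundle_def)
  then obtain B :: "('e \<times> 'f) set" where "finite B" "span B = UNIV" by (auto simp: smooth_atlas_def)
  then have "finite (snd ` B)" "span (snd ` B) = snd ` (UNIV :: ('e \<times> 'f) set)"
    using linear_span_image[OF linear_snd] by (simp, metis)
  then show ?thesis by (metis range_snd)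
qed

lemma k_dualD:
  assumes "\<zeta> \<in> k_dual A k x"
  shows "a \<in> kk \<Longrightarrow> b \<in> kk \<Longrightarrow> \<zeta> (pt (a + b)) = \<zeta> (pt a) + \<zeta> (pt b)"
    and "a \<in> kk \<Longrightarrow> \<zeta> (pt (r *\<^sub>R a)) = r * \<zeta> (pt a)"
    and "\<xi> \<notin> k \<or> proj A \<xi> \<noteq> x \<Longrightarrow> \<zeta> \<xi> = 0"
  using assms by (simp_all add: k_dual_def pt_in_k add_pt[symmetric] scl_pt[symmetric])

lemma k_dualI:
  assumes "\<And>a b. a \<in> kk \<Longrightarrow> b \<in> kk \<Longrightarrow> \<zeta> (pt (a + b)) = \<zeta> (pt a) + \<zeta> (pt b)"
    and "\<And>r a. a \<in> kk \<Longrightarrow> \<zeta> (pt (r *\<^sub>R a)) = r * \<zeta> (pt a)"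
    and "\<And>\<xi>. \<xi> \<notin> k \<or> proj A \<xi> \<noteq> x \<Longrightarrow> \<zeta> \<xi> = 0"
  shows "\<zeta> \<in> k_dual A k x"
  unfolding k_dual_def
proof (intro CollectI conjI allI ballI impI)
  fix \<xi> r assume "\<xi> \<in> k" "proj A \<xi> = x"
  then obtain a where "a \<in> kk" "\<xi> = pt a" by (rule k_cases)
  then show "\<zeta> (scl A r \<xi>) = r * \<zeta> \<xi>" using assms(2) by (simp add: scl_pt)
next
  fix \<xi> \<eta> assume 1: "\<xi> \<in> k" "proj A \<xi> = x" and 2: "\<eta> \<in> k" "proj A \<eta> = x"
  obtain a where "a \<in> kk" "\<xi> = pt a" using 1 by (rule k_cases)
  moreover obtain b where "b \<in> kk" "\<eta> = pt b" using 2 by (rule k_cases)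
  ultimately show "\<zeta> (add A \<xi> \<eta>) = \<zeta> \<xi> + \<zeta> \<eta>" using assms(1) by (simp add: add_pt)
qed (use assms(3) in blast)

lemma k_dual_eqI:
  assumes "\<zeta> \<in> k_dual A k x" "\<zeta>' \<in> k_dual A k x" "\<And>b. b \<in> kk \<Longrightarrow> \<zeta> (pt b) = \<zeta>' (pt b)"
  shows "\<zeta> = \<zeta>'"
proof
  fix \<xi> show "\<zeta> \<xi> = \<zeta>' \<xi>"
  proof (cases "\<xi> \<in> k \<and> proj A \<xi> = x")
    case True
    then obtain b where "b \<in> kk" "\<xi> = pt b" using k_cases by blast
    then show ?thesis using assms(3) by simp
  next
    case False
    then show ?thesis using k_dualD(3)[OF assms(1), of \<xi>] k_dualD(3)[OF assms(2), of \<xi>] by auto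
  qed
qed

lemma zeta_pt: "b \<in> kk \<Longrightarrow> zeta L (pt b) = blinfun_apply L b"
  by (simp add: zeta_def pt_in_k)

lemma zeta_dual: "zeta L \<in> k_dual A k x"
  by (rule k_dualI)
    (auto simp: zeta_pt subspace_add[OF subspace_kk] subspace_scale[OF subspace_kk] blinfun.add_right blinfun.scaleR_right,
     auto simp: zeta_def)

text \<open>A functional on \<open>kk\<close>, prescribed on a basis of \<open>kk\<close>, extends
  linearly to the typical fibre; the extension is bounded because that fibre is
  finite-dimensional.\<close>

lemma dual_zeta:
  assumes "\<zeta> \<in> k_dual A k x"
  obtains L where "\<zeta> = zeta L"
proof -
  obtain B where B: "B \<subseteq> kk" "independent B" "kk \<subseteq> span B" using basis_exists by metis
  obtain g where g: "linear g" "\<And>b. b \<in> B \<Longrightarrow> g b = \<zeta> (pt b)"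
    using linear_independent_extend[OF B(2), of "\<lambda>b. \<zeta> (pt b)"] by auto
  have eq: "b \<in> kk \<and> g b = \<zeta> (pt b)" if "b \<in> span B" for b
    using that
  proof (induction rule: span_induct_alt)
    case base
    have "0 \<in> kk" using subspace_kk by (rule subspace_0)
    then show ?case using k_dualD(2)[OF assms, of 0 0] linear_0[OF g(1)] by simp
  next
    case (step r b y)
    have b: "b \<in> kk" using B step by blast
    then have rb: "r *\<^sub>R b \<in> kk" using subspace_kk subspace_scale by blast
    then have "r *\<^sub>R b + y \<in> kk" using step subspace_kk subspace_add by blast
    then show ?case
      using k_dualD(1)[OF assms rb, of y] k_dualD(2)[OF assms b] step g by (simp add: linear_add linear_scale)
  qed
  obtain F :: "'f set" where "finite F" "span F = UNIV" using finite_span_fibre by blast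
  then have "bounded_linear g" using g(1) by (rule linear_imp_bounded_linear_finite_span)
  then have "\<zeta> = zeta (Blinfun g)"
    using eq B(3) by (intro k_dual_eqI[OF assms zeta_dual]) (auto simp: zeta_pt bounded_linear_Blinfun_apply)
  then show ?thesis using that by blast
qed

lemma Mpt_Mq: "\<zeta> \<in> k_dual A k x \<Longrightarrow> Mpt w \<zeta> \<in> Mq A k q"
  by (auto simp: Mpt_def Mq_def x_points)

lemma Rpt_Aq: "\<zeta> \<in> k_dual A k x \<Longrightarrow> Rpt w \<zeta> r \<in> Aq A k q"
  by (auto simp: Rpt_def Aq_def)

lemma Aq_proj_Rpt: "Aq_proj A (Rpt w \<zeta> r) = Mpt w \<zeta>"
  by (simp add: Aq_proj_def Rpt_def Mpt_def)

lemma map_Rpt_tuples: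
  assumes "\<zeta> \<in> k_dual A k x" "length rs = p"
  shows "map (Rpt w \<zeta>) rs \<in> Aq_tuples A k p q (Mpt w \<zeta>)"
  using assms Rpt_Aq Aq_proj_Rpt by (auto simp: Aq_tuples_def)

lemma Aq_add_Rpt: "Aq_add A (Rpt w \<zeta> r) (Rpt w \<zeta> r') = Rpt w \<zeta> (r + r')"
  by (auto simp: Aq_add_def Rpt_def add_pt TM_add intro!: nth_equalityI)

lemma Om_alt_additive:
  assumes \<zeta>: "\<zeta> \<in> k_dual A k x"
  shows "alt_additive p (Om w \<zeta>)"
proof -
  have ma: "multilinear_alternating A k p q \<omega>" using \<omega> by (simp add: ext_cochains_def)
  note ma' = ma[unfolded multilinear_alternating_def, rule_format, OF Mpt_Mq[OF \<zeta>] map_Rpt_tuples[OF \<zeta>]]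
  show ?thesis
    unfolding alt_additive_def
  proof (intro allI impI conjI)
    fix rs :: "('f \<times> (nat \<Rightarrow> 'f)) list" and m r
    assume l: "length rs = p" and m: "m < p"
    show "Om w \<zeta> (rs[m := rs ! m + r]) = Om w \<zeta> rs + Om w \<zeta> (rs[m := r])"
      using ma'[OF l, THEN conjunct1, rule_format, OF m Rpt_Aq[OF \<zeta>] Aq_proj_Rpt] l m
      by (simp add: Om_def map_update Aq_add_Rpt)
  next
    fix rs :: "('f \<times> (nat \<Rightarrow> 'f)) list" and m m'
    assume "length rs = p" "m < p" "m' < p" "m \<noteq> m'" "rs ! m = rs ! m'"
    then show "Om w \<zeta> rs = 0"
      using ma'[of rs w] by (simp add: Om_def)
  qed
qed

lemma Om_cong:
  assumes "\<And>i. i < q \<Longrightarrow> w i = w' i" "length rs = length rs'"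
    and "\<And>m. m < length rs \<Longrightarrow> fst (rs ! m) = fst (rs' ! m)"
    and "\<And>m i. m < length rs \<Longrightarrow> i < q \<Longrightarrow> snd (rs ! m) i = snd (rs' ! m) i"
  shows "Om w \<zeta> rs = Om w' \<zeta> rs'"
proof -
  have "map (Rpt w \<zeta>) rs = map (Rpt w' \<zeta>) rs'"
    using assms by (intro nth_equalityI) (auto simp: Rpt_def)
  moreover have "Mpt w \<zeta> = Mpt w' \<zeta>" using assms(1) by (auto simp: Mpt_def)
  ultimately show ?thesis by (simp add: Om_def)
qed

lemma permute_list_map_upt:
  assumes "\<tau> permutes {..<q}"
  shows "permute_list \<tau> (map f [0..<q]) = map (\<lambda>i. f (\<tau> i)) [0..<q]"
  using permutes_in_image[OF assms] by (auto simp: permute_list_def)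

lemma Om_skew:
  assumes \<zeta>: "\<zeta> \<in> k_dual A k x" and \<tau>: "\<tau> permutes {..<q}" and l: "length rs = p"
  shows "Om (\<lambda>i. w (\<tau> i)) \<zeta> (map (\<lambda>r. (fst r, \<lambda>i. snd r (\<tau> i))) rs) = of_int (sign \<tau>) * Om w \<zeta> rs"
proof -
  have "skew_cochain A k p q \<omega>" using \<omega> by (simp add: ext_cochains_def)
  from this[unfolded skew_cochain_def, rule_format, OF \<tau> Mpt_Mq[OF \<zeta>] map_Rpt_tuples[OF \<zeta> l], of w]
  have "\<omega> (apfst (permute_list \<tau>) (Mpt w \<zeta>)) (map (apfst (permute_list \<tau>)) (map (Rpt w \<zeta>) rs))
    = of_int (sign \<tau>) * Om w \<zeta> rs" by (simp add: Om_def)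
  moreover have "apfst (permute_list \<tau>) (Mpt w \<zeta>) = Mpt (\<lambda>i. w (\<tau> i)) \<zeta>"
    by (simp add: Mpt_def permute_list_map_upt[OF \<tau>])
  moreover have "map (apfst (permute_list \<tau>)) (map (Rpt w \<zeta>) rs)
      = map (Rpt (\<lambda>i. w (\<tau> i)) \<zeta>) (map (\<lambda>r. (fst r, \<lambda>i. snd r (\<tau> i))) rs)"
    by (simp add: Rpt_def permute_list_map_upt[OF \<tau>])
  ultimately show ?thesis by (simp only: Om_def)
qed

text \<open>For fixed base points \<open>a\<close> of the rows, \<open>Om_mat\<close> is a smooth function of the remaining data
  \<open>(w, L, b)\<close>, which consists of \<open>q + 1\<close> slots: \<open>L\<close> is the last one.\<close>

definition chart_fun :: "(nat \<Rightarrow> 'f) \<Rightarrow> (nat \<Rightarrow>\<^sub>C 'e) \<times> ('f \<Rightarrow>\<^sub>L real) \<times> (nat \<Rightarrow>\<^sub>C nat \<Rightarrow>\<^sub>C 'f) \<Rightarrow> real" where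
  "chart_fun a u = Om_mat (apply_bcontfun (fst u)) (zeta (fst (snd u))) a
     (\<lambda>m. apply_bcontfun (apply_bcontfun (snd (snd u)) m))"

text \<open>For \<open>i < q\<close> the slot contains the tangent component \<open>w i\<close>
  together with the entries \<open>b m i\<close> of all rows \<open>m\<close>, that is, a whole
  column. Slot \<open>q\<close> contains only \<open>L\<close>.\<close>

definition slot :: "nat \<Rightarrow> ((nat \<Rightarrow>\<^sub>C 'e) \<times> ('f \<Rightarrow>\<^sub>L real) \<times> (nat \<Rightarrow>\<^sub>C nat \<Rightarrow>\<^sub>C 'f)) set" where
  "slot i = {u. (\<forall>l. l \<noteq> i \<or> i = q \<longrightarrow> apply_bcontfun (fst u) l = 0 \<and> (\<forall>m. apply_bcontfun (apply_bcontfun (snd (snd u)) m) l = 0))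
     \<and> (i \<noteq> q \<longrightarrow> fst (snd u) = 0)}"

abbreviation "other_slots i \<equiv> span (\<Union>l\<in>{..q} - {i}. slot l)"

definition coords :: "(nat \<Rightarrow> 'e) \<Rightarrow> ('f \<Rightarrow>\<^sub>L real) \<Rightarrow> (nat \<Rightarrow> nat \<Rightarrow> 'f)
    \<Rightarrow> (nat \<Rightarrow>\<^sub>C 'e) \<times> ('f \<Rightarrow>\<^sub>L real) \<times> (nat \<Rightarrow>\<^sub>C nat \<Rightarrow>\<^sub>C 'f)" where
  "coords w L b = (bseq q w, L, bseq p (\<lambda>m. bseq q (b m)))"

text \<open>The coordinates \<open>(w, L, b)\<close> are inserted by an affine map whose constant
  part freezes the base point at \<open>x0\<close> and the fibre points at \<open>a\<close>. The
  domain of smoothness restricts only the base point, so the image stays inside it.\<close>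

lemma smooth_chart_fun: "smooth_on UNIV (chart_fun a)"
proof -
  define S where "S = {(y, w :: nat \<Rightarrow>\<^sub>C 'e, L :: 'f \<Rightarrow>\<^sub>L real, a :: nat \<Rightarrow>\<^sub>C 'f, b :: nat \<Rightarrow>\<^sub>C nat \<Rightarrow>\<^sub>C 'f).
         (y, 0) \<in> snd d ` fst d}"
  define F where "F = (\<lambda>(y, w :: nat \<Rightarrow>\<^sub>C 'e, L :: 'f \<Rightarrow>\<^sub>L real, a :: nat \<Rightarrow>\<^sub>C 'f, b :: nat \<Rightarrow>\<^sub>C nat \<Rightarrow>\<^sub>C 'f).
          let pt = (\<lambda>z. chart_inv d (y, z));
              tv = (\<lambda>z u. chart_inv (tangent_chart (total A) d) ((y, z), u));
              \<zeta> = (\<lambda>\<xi>. if \<xi> \<in> k \<and> proj A \<xi> = proj A (pt 0)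
                        then blinfun_apply L (snd (snd d \<xi>)) else 0)
          in \<omega> (map (\<lambda>i. differential (total A) (base A) (proj A) (tv 0 (apply_bcontfun w i, 0))) [0..<q],
                 proj A (pt 0), \<zeta>)
               (map (\<lambda>j. (map (\<lambda>i. tv (apply_bcontfun a j)
                                   (apply_bcontfun w i, apply_bcontfun (apply_bcontfun b j) i)) [0..<q],
                          pt (apply_bcontfun a j), \<zeta>)) [0..<p]))"
  define l where "l = (\<lambda>u :: (nat \<Rightarrow>\<^sub>C 'e) \<times> ('f \<Rightarrow>\<^sub>L real) \<times> (nat \<Rightarrow>\<^sub>C nat \<Rightarrow>\<^sub>C 'f).
    (0::'e, fst u, fst (snd u), 0 :: nat \<Rightarrow>\<^sub>C 'f, snd (snd u)))"
  define p0 where "p0 = (x0, 0 :: nat \<Rightarrow>\<^sub>C 'e, 0 :: 'f \<Rightarrow>\<^sub>L real, bseq p a, 0 :: nat \<Rightarrow>\<^sub>C nat \<Rightarrow>\<^sub>C 'f)"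
  have "smooth_cochain A k p q \<omega>" using \<omega> by (simp add: ext_cochains_def)
  then have "smooth_on S F" using d unfolding smooth_cochain_def S_def F_def by blast
  moreover have "bounded_linear l"
    unfolding l_def by (intro bounded_linear_Pair bounded_linear_zero bounded_linear_fst
      bounded_linear_compose[OF bounded_linear_fst bounded_linear_snd] bounded_linear_compose[OF bounded_linear_snd bounded_linear_snd])
  moreover have "l u + p0 \<in> S" for u
  proof -
    have "(x0, 0) \<in> snd d ` fst d" using pt(1,2)[of 0] by (metis image_eqI)
    then show ?thesis by (simp add: S_def l_def p0_def)
  qed
  ultimately have "smooth_on UNIV (\<lambda>u. F (l u + p0))" by (rule smooth_on_compose_affine)
  moreover have "F (l u + p0) = chart_fun a u" for u
  proof -
    obtain w L b where u: "u = (w, L, b)" by (metis surj_pair)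
    have z: "(\<lambda>\<xi>. if \<xi> \<in> k \<and> proj A \<xi> = x then blinfun_apply L (snd (snd d \<xi>)) else 0) = zeta L"
      unfolding zeta_def cf_def ..
    show ?thesis
      by (auto simp: u F_def l_def p0_def Let_def pt_def[symmetric] tangent_chart_inv_Tv z chart_fun_def Om_mat_def Om_def
        Mpt_def Rpt_def intro!: arg_cong2[where f = \<omega>])
  qed
  ultimately show ?thesis by simp
qed

lemma subspace_slot: "subspace (slot i)"
  by (auto simp: subspace_def slot_def plus_bcontfun.rep_eq scaleR_bcontfun.rep_eq zero_bcontfun.rep_eq)

lemma span_other_slots:
  assumes "u \<in> other_slots i" "i \<le> q"
  shows "i < q \<Longrightarrow> apply_bcontfun (fst u) i = 0 \<and> (\<forall>m. apply_bcontfun (apply_bcontfun (snd (snd u)) m) i = 0)"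
      (is "_ \<Longrightarrow> ?P u")
    and "i = q \<Longrightarrow> fst (snd u) = 0"
proof -
  have "u \<in> {u. (i < q \<longrightarrow> ?P u) \<and> (i = q \<longrightarrow> fst (snd u) = 0)}" (is "u \<in> ?U")
  proof (rule subsetD[OF span_minimal assms(1)])
    show "(\<Union>l\<in>{..q} - {i}. slot l) \<subseteq> ?U" by (auto simp: slot_def)
    show "subspace ?U"
      by (auto simp: subspace_def plus_bcontfun.rep_eq scaleR_bcontfun.rep_eq zero_bcontfun.rep_eq)
  qed
  then show "i < q \<Longrightarrow> ?P u" and "i = q \<Longrightarrow> fst (snd u) = 0" by auto
qed

text \<open>An empty column is the insertion of a zero in a tangent slot, since \<open>bw 0\<close>
  and \<open>Tv a 0\<close> are the zero vectors over \<open>M\<close> and over \<open>A\<close>; an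
  empty slot \<open>q\<close> is the zero functional. Both cases are covered by simplicity of
  \<open>\<omega>\<close>.\<close>

lemma chart_fun_vanishing:
  assumes "i \<in> {..q}" "u \<in> other_slots i"
  shows "chart_fun a u = 0"
proof -
  obtain w L b where u: "u = (w, L, b)" by (metis surj_pair)
  have sim: "simple_cochain A k p q \<omega>" using \<omega> by (simp add: ext_cochains_def)
  let ?rs = "map (\<lambda>m. (a m, apply_bcontfun (apply_bcontfun b m))) [0..<p]"
  have Mq: "(map (\<lambda>i. bw (apply_bcontfun w i)) [0..<q], x, zeta L) \<in> Mq A k q"
    using Mpt_Mq[OF zeta_dual] by (simp add: Mpt_def)
  have tup: "map (Rpt (apply_bcontfun w) (zeta L)) ?rs
     \<in> Aq_tuples A k p q (map (\<lambda>i. bw (apply_bcontfun w i)) [0..<q], x, zeta L)"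
    using map_Rpt_tuples[OF zeta_dual, of ?rs "apply_bcontfun w" L] by (simp add: Mpt_def)
  note s = sim[unfolded simple_cochain_def, rule_format, OF Mq tup]
  have "\<omega> (Mpt (apply_bcontfun w) (zeta L)) (map (Rpt (apply_bcontfun w) (zeta L)) ?rs) = 0"
  proof (cases "i < q")
    case True
    then have "apply_bcontfun w i = 0" "\<And>m. apply_bcontfun (apply_bcontfun b m) i = 0"
      using span_other_slots(1)[OF assms(2)] by (simp_all add: u)
    then show ?thesis using s[THEN conjunct1, rule_format, OF True] True
      by (simp add: Mpt_def Rpt_def tzero_x tzero_pt zero_prod_def)
  next
    case False
    then have "L = 0" using span_other_slots(2)[OF assms(2)] assms(1) by (simp add: u)
    then have "zeta L = (\<lambda>\<xi>. 0)" by (auto simp: zeta_def)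
    then show ?thesis using s[THEN conjunct2, rule_format] by (simp add: Mpt_def)
  qed
  then show ?thesis by (simp add: u chart_fun_def Om_mat_def Om_def)
qed

text \<open>Scalar multiplication over \<open>A\<close> keeps the points \<open>pt a\<close> and
  scales the tangent vectors and the functional. With \<open>a\<close> frozen this is scalar
  multiplication of \<open>(w, L, b)\<close>, and the degree \<open>q + 1\<close> is the number of
  slots.\<close>

lemma chart_fun_homogeneous: "chart_fun a (r *\<^sub>R u) = r ^ card {..q} * chart_fun a u"
proof -
  obtain w L b where u: "u = (w, L, b)" by (metis surj_pair)
  have hom: "homogeneous_cochain A k p q \<omega>" using \<omega> by (simp add: ext_cochains_def)
  let ?rs = "map (\<lambda>m. (a m, apply_bcontfun (apply_bcontfun b m))) [0..<p]"
  have "\<omega> (Mq_hscl r (Mpt (apply_bcontfun w) (zeta L))) (map (Aq_hscl r) (map (Rpt (apply_bcontfun w) (zeta L)) ?rs))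
     = r ^ (q + 1) * \<omega> (Mpt (apply_bcontfun w) (zeta L)) (map (Rpt (apply_bcontfun w) (zeta L)) ?rs)"
    by (rule hom[unfolded homogeneous_cochain_def, rule_format, OF Mpt_Mq[OF zeta_dual] map_Rpt_tuples[OF zeta_dual]]) simp
  moreover have "(\<lambda>\<xi>. r * zeta L \<xi>) = zeta (r *\<^sub>R L)" by (auto simp: zeta_def blinfun.scaleR_left)
  ultimately show ?thesis
    by (simp add: u chart_fun_def Om_mat_def Om_def Mpt_def Rpt_def Mq_hscl_def Aq_hscl_def o_def tscale_bw tscale_Tv
      scaleR_bcontfun.rep_eq)
qed

lemma chart_fun_slot_linear:
  assumes "i \<le> q" "y \<in> other_slots i" "u \<in> slot i" "u' \<in> slot i"
  shows "chart_fun a (y + s *\<^sub>R u + t *\<^sub>R u') = s * chart_fun a (y + u) + t * chart_fun a (y + u')"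
  by (rule homogeneous_slot_linear[where I = "{..q}" and W = slot and i = i])
    (use assms smooth_chart_fun chart_fun_homogeneous chart_fun_vanishing subspace_slot in auto)

lemma chart_fun_coords: "chart_fun a (coords w L b) = Om_mat w (zeta L) a b"
  unfolding chart_fun_def Om_mat_def coords_def fst_conv snd_conv by (rule Om_cong) auto

lemma coords_add: "coords w L b + coords w' L' b' = coords (\<lambda>i. w i + w' i) (L + L') (\<lambda>m i. b m i + b' m i)"
  by (auto simp: coords_def plus_bcontfun.rep_eq intro!: bcontfun_eqI)

text \<open>A finite family of columns is the sum of its single columns, each of which lies in its
  own slot.\<close>

lemma coords_in_span:
  assumes "finite J" "J \<subseteq> {..<q}" "i \<notin> J" "i \<le> q"
  shows "coords (\<lambda>j. if j \<in> J then w j else 0) 0 (\<lambda>m j. if j \<in> J then b m j else 0) \<in> other_slots i"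
    (is "?c J \<in> _")
  using assms
proof (induction J)
  case empty
  have "coords (\<lambda>j. 0) 0 (\<lambda>m j. 0) = 0"
    by (auto simp: coords_def zero_prod_def zero_bcontfun.rep_eq intro!: bcontfun_eqI)
  then show ?case by (simp add: span_zero)
next
  case (insert l J)
  have "?c {l} \<in> slot l"
    using insert.prems by (auto simp: slot_def coords_def)
  then have "?c {l} \<in> other_slots i"
    using insert.prems by (intro span_base) auto
  moreover have "?c J \<in> other_slots i"
    using insert by auto
  ultimately have "?c {l}
     + ?c J \<in> other_slots i"
    by (rule span_add)
  also have "?c {l}
     + ?c J
     = ?c (insert l J)"
    using insert.hyps unfolding coords_add by (intro arg_cong3[where f = coords] ext) auto
  finally show ?case .
qed

lemma Om_mat_slot_add:
  assumes \<zeta>: "\<zeta> \<in> k_dual A k x" and i: "i < q"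
  shows "Om_mat (w(i := w1 + w2)) \<zeta> a (\<lambda>m. (b m)(i := c1 m + c2 m))
    = Om_mat (w(i := w1)) \<zeta> a (\<lambda>m. (b m)(i := c1 m)) + Om_mat (w(i := w2)) \<zeta> a (\<lambda>m. (b m)(i := c2 m))"
proof -
  obtain L where L: "\<zeta> = zeta L" using dual_zeta[OF \<zeta>] .
  let ?J = "{..<q} - {i}"
  let ?s = "\<lambda>w c. coords (single i w) 0 (\<lambda>m. single i (c m))"
  have "coords (\<lambda>_. 0) L (\<lambda>_ _. 0) \<in> slot q"
    by (auto simp: slot_def coords_def)
  then have "coords (\<lambda>_. 0) L (\<lambda>_ _. 0) \<in> other_slots i"
    using i by (intro span_base) auto
  from span_add[OF coords_in_span[of ?J i w b] this]
  \<comment> \<open>\<open>?y\<close> carries everything except column \<open>i\<close>: the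
    remaining columns, and \<open>L\<close> in slot \<open>q\<close>, which differs from slot
    \<open>i\<close> because \<open>i < q\<close>.\<close>
  have y: "coords (\<lambda>j. if j \<in> ?J then w j else 0) L (\<lambda>m j. if j \<in> ?J then b m j else 0) \<in> other_slots i"
    (is "?y \<in> _") using i by (simp add: coords_add)
  have s: "?s w c \<in> slot i" for w c using i by (auto simp: slot_def coords_def single_def)
  have eq: "?y + ?s w' c = coords (w(i := w')) L (\<lambda>m. (b m)(i := c m))" for w' c
    unfolding coords_add coords_def using i by (auto simp: single_def intro!: bcontfun_eqI)
  have "?y + 1 *\<^sub>R ?s w1 c1 + 1 *\<^sub>R ?s w2 c2 = ?y + ?s (w1 + w2) (\<lambda>m. c1 m + c2 m)"
    by (simp add: add.assoc coords_add single_def if_distrib[of "\<lambda>t. t + _"] cong: if_cong)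
  moreover have "chart_fun a (?y + 1 *\<^sub>R ?s w1 c1 + 1 *\<^sub>R ?s w2 c2)
      = 1 * chart_fun a (?y + ?s w1 c1) + 1 * chart_fun a (?y + ?s w2 c2)"
    using i by (intro chart_fun_slot_linear[OF _ y s s]) simp
  ultimately have "chart_fun a (?y + ?s (w1 + w2) (\<lambda>m. c1 m + c2 m)) = chart_fun a (?y + ?s w1 c1) + chart_fun a (?y + ?s w2 c2)"
    by (simp only: mult_1)
  then show ?thesis unfolding eq chart_fun_coords L .
qed

text \<open>Slot-wise linearity in slot \<open>q\<close>. It makes the functional occurring in
  \<open>ev\<close> linear, so that an element of \<open>k\<close> can represent it.\<close>

lemma Om_mat_dual_linear:
  assumes \<zeta>: "\<zeta> \<in> k_dual A k x" "\<zeta>' \<in> k_dual A k x"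
  shows "Om_mat w (\<lambda>\<xi>. s * \<zeta> \<xi> + t * \<zeta>' \<xi>) a b = s * Om_mat w \<zeta> a b + t * Om_mat w \<zeta>' a b"
proof -
  obtain L where L: "\<zeta> = zeta L" using dual_zeta[OF \<zeta>(1)] .
  obtain L' where L': "\<zeta>' = zeta L'" using dual_zeta[OF \<zeta>(2)] .
  have z: "(\<lambda>\<xi>. s * zeta L \<xi> + t * zeta L' \<xi>) = zeta (s *\<^sub>R L + t *\<^sub>R L')"
    by (auto simp: zeta_def blinfun.add_left blinfun.scaleR_left)
  let ?y = "coords (\<lambda>j. if j \<in> {..<q} then w j else 0) 0 (\<lambda>m j. if j \<in> {..<q} then b m j else 0)"
  let ?s = "\<lambda>L. coords (\<lambda>_. 0) L (\<lambda>_ _. 0)"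
  have y: "?y \<in> other_slots q" by (rule coords_in_span) auto
  have s: "?s L \<in> slot q" for L by (auto simp: slot_def coords_def)
  have eq: "?y + ?s L = coords w L b" for L
    unfolding coords_add coords_def by (auto intro!: bcontfun_eqI)
  have "?y + s *\<^sub>R ?s L + t *\<^sub>R ?s L' = ?y + ?s (s *\<^sub>R L + t *\<^sub>R L')"
    by (auto simp: coords_def plus_bcontfun.rep_eq scaleR_bcontfun.rep_eq intro!: bcontfun_eqI)
  moreover have "chart_fun a (?y + s *\<^sub>R ?s L + t *\<^sub>R ?s L') = s * chart_fun a (?y + ?s L) + t * chart_fun a (?y + ?s L')"
    by (rule chart_fun_slot_linear[OF _ y s s]) simp
  ultimately have "chart_fun a (?y + ?s (s *\<^sub>R L + t *\<^sub>R L')) = s * chart_fun a (?y + ?s L) + t * chart_fun a (?y + ?s L')"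
    by (simp only:)
  then show ?thesis unfolding eq chart_fun_coords L L' z .
qed

lemma Om_eq_Om_mat:
  assumes "length rs = p"
  shows "Om w \<zeta> rs = Om_mat w \<zeta> (\<lambda>m. fst (rs ! m)) (\<lambda>m. snd (rs ! m))"
proof -
  have "map (\<lambda>m. (fst (rs ! m), snd (rs ! m))) [0..<p] = rs" using assms by (intro nth_equalityI) auto
  then show ?thesis by (simp add: Om_mat_def)
qed

lemma Om_dual_linear:
  assumes "\<zeta> \<in> k_dual A k x" "\<zeta>' \<in> k_dual A k x" "length rs = p"
  shows "Om w (\<lambda>\<xi>. s * \<zeta> \<xi> + t * \<zeta>' \<xi>) rs = s * Om w \<zeta> rs + t * Om w \<zeta>' rs"
  using Om_mat_dual_linear[OF assms(1,2)] assms(3) by (simp add: Om_eq_Om_mat)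

text \<open>A core row occupies its slot exclusively: by additivity in the slot, all other entries of the
  slot may be replaced by zero.\<close>

lemma Om_core_row:
  assumes \<zeta>: "\<zeta> \<in> k_dual A k x" and l: "length rs = p" and m0: "m0 < p" and i: "i < q"
    and row: "rs ! m0 = (0, single i v)"
  shows "Om w \<zeta> rs = Om (w(i := 0)) \<zeta>
     (map (\<lambda>m. if m = m0 then rs ! m else (fst (rs ! m), (snd (rs ! m))(i := 0))) [0..<p])"
proof -
  let ?a = "\<lambda>m. fst (rs ! m)" and ?b = "\<lambda>m. snd (rs ! m)"
  \<comment> \<open>Column \<open>i\<close> is split into the entry of the core row and all the
    rest, the base component \<open>w i\<close> included. In the second summand the core row has
    lost its only entry and is the zero row.\<close>
  let ?c1 = "\<lambda>m. if m = m0 then ?b m i else 0" and ?c2 = "\<lambda>m. if m = m0 then 0 else ?b m i"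
  have "Om w \<zeta> rs = Om_mat (w(i := 0 + w i)) \<zeta> ?a (\<lambda>m. (?b m)(i := ?c1 m + ?c2 m))"
    unfolding Om_eq_Om_mat[OF l] by (intro arg_cong3[where f = "\<lambda>w. Om_mat w \<zeta>"] ext) auto
  also have "\<dots> = Om_mat (w(i := 0)) \<zeta> ?a (\<lambda>m. (?b m)(i := ?c1 m)) + Om_mat (w(i := w i)) \<zeta> ?a (\<lambda>m. (?b m)(i := ?c2 m))"
    using \<zeta> i by (rule Om_mat_slot_add)
  also have "Om_mat (w(i := w i)) \<zeta> ?a (\<lambda>m. (?b m)(i := ?c2 m)) = 0"
    unfolding Om_mat_def
  proof (rule alt_additive_zero[OF Om_alt_additive[OF \<zeta>] _ m0])
    show "map (\<lambda>m. (?a m, (?b m)(i := ?c2 m))) [0..<p] ! m0 = 0"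
      using m0 by (auto simp: row single_def zero_prod_def)
  qed simp
  also have "Om_mat (w(i := 0)) \<zeta> ?a (\<lambda>m. (?b m)(i := ?c1 m))
    = Om (w(i := 0)) \<zeta> (map (\<lambda>m. if m = m0 then rs ! m else (fst (rs ! m), (snd (rs ! m))(i := 0))) [0..<p])"
    unfolding Om_mat_def by (intro arg_cong[where f = "Om (w(i := 0)) \<zeta>"] map_cong) auto
  finally show ?thesis by simp
qed

text \<open>When one core row clears the slot, the other one becomes a zero row.\<close>

lemma Om_two_core_rows:
  assumes \<zeta>: "\<zeta> \<in> k_dual A k x" and l: "length rs = p" and m: "m < p" "m' < p" "m \<noteq> m'" and i: "i < q"
    and rs: "rs ! m = (0, single i v)" "rs ! m' = (0, single i v')"
  shows "Om w \<zeta> rs = 0"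
  unfolding Om_core_row[OF \<zeta> l m(1) i rs(1)]
  by (rule alt_additive_zero[OF Om_alt_additive[OF \<zeta>] _ m(2)])
    (use m rs(2) in \<open>auto simp: single_def zero_prod_def\<close>)

end

section \<open>Expansion of horizontal rows into core rows and lifted rows\<close>

lemma sum_fun_apply: "(\<Sum>i\<in>I. f i) l = (\<Sum>i\<in>I. f i l)" for f :: "'i \<Rightarrow> 'l \<Rightarrow> 'z::comm_monoid_add"
  by (induction I rule: infinite_finite_induct) auto

text \<open>Skew-symmetry of \<open>\<omega>\<close> concerns all \<open>q\<close> slots, the wedge
  product only the last \<open>q - j\<close> of them. Fixing \<open>j\<close> slots in front turns
  transpositions into transpositions, so the sign persists by induction.\<close>

lemma permutes_shift:
  fixes \<tau> :: "nat \<Rightarrow> nat"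
  assumes "\<tau> permutes {..<N}"
  shows "(\<lambda>i. if i < j then i else j + \<tau> (i - j)) permutes {..<j + N}"
    and "sign (\<lambda>i. if i < j then i else j + \<tau> (i - j)) = sign \<tau>"
proof -
  let ?s = "\<lambda>\<tau> i. if i < j then i else j + \<tau> (i - j)"
  have "?s \<tau> permutes {..<j + N} \<and> sign (?s \<tau>) = sign \<tau>"
    using assms finite_lessThan[of N]
  proof (induction rule: permutes_induct)
    case id
    have "?s id = id" by auto
    then show ?case by (simp add: permutes_id)
  next
    case (swap a b \<tau>)
    have eq: "?s (Transposition.transpose a b \<circ> \<tau>) = Transposition.transpose (j + a) (j + b) \<circ> ?s \<tau>"
      by (auto simp: Transposition.transpose_def fun_eq_iff)
    have "Transposition.transpose (j + a) (j + b) permutes {..<j + N}"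
      using swap by (intro permutes_swap_id) auto
    then have "?s (Transposition.transpose a b \<circ> \<tau>) permutes {..<j + N}"
      unfolding eq using swap by (intro permutes_compose) auto
    moreover have "permutation (?s \<tau>)" "permutation \<tau>"
      using swap by (auto simp: permutation_permutes intro: exI[of _ "{..<j + N}"] exI[of _ "{..<N}"])
    then have "sign (?s (Transposition.transpose a b \<circ> \<tau>)) = sign (Transposition.transpose a b \<circ> \<tau>)"
      unfolding eq using swap by (simp add: sign_compose permutation_swap_id sign_swap_id)
    ultimately show ?case by blast
  qed
  then show "?s \<tau> permutes {..<j + N}" "sign (?s \<tau>) = sign \<tau>" by auto
qed

text \<open>The tangent components after the slots beyond \<open>j\<close> have been permuted by
  \<open>\<tau>\<close> and the \<open>j + s\<close> slots occupied by core rows have been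
  emptied.\<close>

definition shifted :: "(nat \<Rightarrow> 'z::zero) \<Rightarrow> nat \<Rightarrow> nat \<Rightarrow> (nat \<Rightarrow> nat) \<Rightarrow> nat \<Rightarrow> 'z" where
  "shifted w j s \<tau> = (\<lambda>l. if l < j + s then 0 else w (j + \<tau> (l - j)))"

context cochain_chart
begin

definition core_rows :: "(nat \<Rightarrow> 'f) \<Rightarrow> nat \<Rightarrow> ('f \<times> (nat \<Rightarrow> 'f)) list" where
  "core_rows b j = map (\<lambda>i. (0, single i (b i))) [0..<j]"

definition lift_rows :: "('i \<Rightarrow> 'f) \<Rightarrow> ('i \<Rightarrow> 'e \<Rightarrow> 'f) \<Rightarrow> (nat \<Rightarrow> 'e) \<Rightarrow> 'i list \<Rightarrow> ('f \<times> (nat \<Rightarrow> 'f)) list" where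
  "lift_rows a D w \<alpha>s = map (\<lambda>i. (a i, \<lambda>l. D i (w l))) \<alpha>s"

lemma length_core_rows [simp]: "length (core_rows b j) = j"
  by (simp add: core_rows_def)

lemma length_lift_rows [simp]: "length (lift_rows a D w \<alpha>s) = length \<alpha>s"
  by (simp add: lift_rows_def)

text \<open>Core row \<open>t\<close> clears slot \<open>t\<close>. Because
  \<open>D i 0 = 0\<close>, a lifted row with that entry cleared is again the lifted row of the
  cleared \<open>w\<close>, and the induction over \<open>t\<close> can continue.\<close>

lemma Om_zero_core_slots:
  assumes \<zeta>: "\<zeta> \<in> k_dual A k x" and p: "p = j + length \<alpha>s" and j: "j \<le> q" and t: "t \<le> j"
    and D: "\<And>i. i \<in> set \<alpha>s \<Longrightarrow> D i 0 = 0"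
  shows "Om w \<zeta> (core_rows b j @ lift_rows a D w \<alpha>s)
    = Om (\<lambda>l. if l < t then 0 else w l) \<zeta> (core_rows b j @ lift_rows a D (\<lambda>l. if l < t then 0 else w l) \<alpha>s)"
  using t
proof (induction t)
  case 0
  then show ?case by simp
next
  case (Suc t)
  let ?w = "\<lambda>t l. if l < t then 0 else w l"
  let ?rs = "\<lambda>t. core_rows b j @ lift_rows a D (?w t) \<alpha>s"
  have t: "t < p" "t < q" "t < j" using Suc.prems p j by auto
  have row: "?rs t ! t = (0, single t (b t))" using t(3) by (simp add: nth_append core_rows_def)
  have "Om w \<zeta> (core_rows b j @ lift_rows a D w \<alpha>s) = Om (?w t) \<zeta> (?rs t)" using Suc by simp
  also have "\<dots> = Om ((?w t)(t := 0)) \<zeta>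
     (map (\<lambda>m. if m = t then ?rs t ! m else (fst (?rs t ! m), (snd (?rs t ! m))(t := 0))) [0..<p])"
    by (rule Om_core_row[OF \<zeta> _ t(1,2) row]) (simp add: p)
  also have "(?w t)(t := 0) = ?w (Suc t)" by auto
  also have "map (\<lambda>m. if m = t then ?rs t ! m else (fst (?rs t ! m), (snd (?rs t ! m))(t := 0))) [0..<p] = ?rs (Suc t)"
  proof (rule nth_equalityI)
    fix m assume "m < length (map (\<lambda>m. if m = t then ?rs t ! m else (fst (?rs t ! m), (snd (?rs t ! m))(t := 0))) [0..<p])"
    then have m: "m < p" by simp
    show "map (\<lambda>m. if m = t then ?rs t ! m else (fst (?rs t ! m), (snd (?rs t ! m))(t := 0))) [0..<p] ! m = ?rs (Suc t) ! m"
    proof (cases "m < j")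
      case True
      then show ?thesis using m by (auto simp: nth_append core_rows_def single_def)
    next
      case False
      then have "\<alpha>s ! (m - j) \<in> set \<alpha>s" "m - j < length \<alpha>s" using m p by auto
      then show ?thesis using m False t D by (auto simp: nth_append lift_rows_def fun_eq_iff)
    qed
  qed (simp add: p)
  finally show ?case .
qed

text \<open>Skew-symmetry under the shifted \<open>\<tau>\<close> brings the core row in slot
  \<open>j + \<tau> m\<close> to slot \<open>j + m\<close>, so that the core rows occupy the leading
  slots in order, as in \<open>ev\<close>; those slots are then cleared.\<close>

lemma Om_core_permute:
  assumes \<zeta>: "\<zeta> \<in> k_dual A k x" and \<tau>: "\<tau> permutes {..<q - j}" and j: "j \<le> q" and s: "s \<le> q - j"
    and p: "p = j + s + length \<alpha>s" and D: "\<And>i. i \<in> set \<alpha>s \<Longrightarrow> D i 0 = 0"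
  shows "Om w \<zeta> (core_rows b j @ map (\<lambda>m. (0, single (j + \<tau> m) (v m))) [0..<s] @ lift_rows a D w \<alpha>s)
    = of_int (sign \<tau>) * Om (shifted w j s \<tau>) \<zeta>
       (core_rows (\<lambda>i. if i < j then b i else v (i - j)) (j + s) @ lift_rows a D (shifted w j s \<tau>) \<alpha>s)"
proof -
  let ?rs = "core_rows b j @ map (\<lambda>m. (0, single (j + \<tau> m) (v m))) [0..<s] @ lift_rows a D w \<alpha>s"
  let ?\<tau> = "\<lambda>i. if i < j then i else j + \<tau> (i - j)"
  let ?b = "\<lambda>i. if i < j then b i else v (i - j)"
  have \<tau>': "?\<tau> permutes {..<q}" using permutes_shift(1)[OF \<tau>, of j] j by simp
  have inj: "?\<tau> i = ?\<tau> l \<longleftrightarrow> i = l" for i l by (rule inj_eq[OF permutes_inj[OF \<tau>']])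
  have c1: "single i u (?\<tau> l) = single i u l" if "i < j" for i u l using inj[of l i] that by (auto simp: single_def)
  have c2: "single (j + \<tau> m) u (?\<tau> l) = single (j + m) u l" for m u l using inj[of l "j + m"] by (auto simp: single_def)
  have rs: "map (\<lambda>r. (fst r, \<lambda>l. snd r (?\<tau> l))) ?rs = core_rows ?b (j + s) @ lift_rows a D (\<lambda>l. w (?\<tau> l)) \<alpha>s"
  proof -
    have "map (\<lambda>r. (fst r, \<lambda>l. snd r (?\<tau> l))) (core_rows b j) = map (\<lambda>i. (0, single i (?b i))) [0..<j]"
      unfolding core_rows_def by (auto simp: c1)
    moreover have "map (\<lambda>r. (fst r, \<lambda>l. snd r (?\<tau> l))) (map (\<lambda>m. (0::'f, single (j + \<tau> m) (v m))) [0..<s])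
       = map (\<lambda>i. (0, single i (?b i))) [j..<j + s]"
      by (rule nth_equalityI) (auto simp: c2)
    moreover have "map (\<lambda>r. (fst r, \<lambda>l. snd r (?\<tau> l))) (lift_rows a D w \<alpha>s) = lift_rows a D (\<lambda>l. w (?\<tau> l)) \<alpha>s"
      by (simp add: lift_rows_def)
    moreover have "core_rows ?b (j + s) = map (\<lambda>i. (0, single i (?b i))) [0..<j] @ map (\<lambda>i. (0, single i (?b i))) [j..<j + s]"
      using upt_add_eq_append[of 0 j s] by (simp only: core_rows_def map_append zero_le)
    ultimately show ?thesis by (simp only: map_append append_assoc)
  qed
  have "Om (\<lambda>l. w (?\<tau> l)) \<zeta> (core_rows ?b (j + s) @ lift_rows a D (\<lambda>l. w (?\<tau> l)) \<alpha>s) = of_int (sign \<tau>) * Om w \<zeta> ?rs"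
    using Om_skew[OF \<zeta> \<tau>', of ?rs w] permutes_shift(2)[OF \<tau>, of j] unfolding rs by (simp add: p)
  moreover have "Om (\<lambda>l. w (?\<tau> l)) \<zeta> (core_rows ?b (j + s) @ lift_rows a D (\<lambda>l. w (?\<tau> l)) \<alpha>s)
     = Om (\<lambda>l. if l < j + s then 0 else w (?\<tau> l)) \<zeta>
        (core_rows ?b (j + s) @ lift_rows a D (\<lambda>l. if l < j + s then 0 else w (?\<tau> l)) \<alpha>s)"
    by (rule Om_zero_core_slots[OF \<zeta> p]) (use j s D in auto)
  moreover have "(\<lambda>l. if l < j + s then 0 else w (?\<tau> l)) = shifted w j s \<tau>" by (auto simp: shifted_def)
  ultimately have "of_int (sign \<tau>) * Om w \<zeta> ?rs
     = Om (shifted w j s \<tau>) \<zeta> (core_rows ?b (j + s) @ lift_rows a D (shifted w j s \<tau>) \<alpha>s)" by simp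
  then have "of_int (sign \<tau> * sign \<tau>) * Om w \<zeta> ?rs
     = of_int (sign \<tau>) * Om (shifted w j s \<tau>) \<zeta> (core_rows ?b (j + s) @ lift_rows a D (shifted w j s \<tau>) \<alpha>s)"
    by (simp only: of_int_mult mult.assoc)
  then show ?thesis by simp
qed

text \<open>Each horizontal row is the difference of a lifted row and a sum of core rows, one for each of
  the remaining slots. Expanding, the terms with two core rows in the same slot vanish.\<close>

lemma Om_horizontal_rows:
  assumes \<zeta>: "\<zeta> \<in> k_dual A k x" and p: "p = j + length \<alpha>s" and j: "j \<le> q"
    and w: "\<And>l. l < j \<Longrightarrow> w l = 0"
    and D: "\<And>i. i \<in> set \<alpha>s \<Longrightarrow> D i 0 = 0" and C: "\<And>i. i \<in> set \<alpha>s \<Longrightarrow> C i 0 = 0"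
  shows "Om w \<zeta> (core_rows b j @ lift_rows a (\<lambda>i u. D i u - C i u) w \<alpha>s)
    = (\<Sum>s\<le>length \<alpha>s. (- 1) ^ s * (\<Sum>\<sigma>\<in>shuffle_perms s (length \<alpha>s - s). of_int (sign \<sigma>) *
        (if s \<le> q - j then 1 / fact (q - j - s) * (\<Sum>\<tau>\<in>{\<tau>. \<tau> permutes {..<q - j}}. of_int (sign \<tau>) *
          Om (shifted w j s \<tau>) \<zeta>
           (core_rows (\<lambda>i. if i < j then b i else C (\<alpha>s ! \<sigma> (i - j)) (w (j + \<tau> (i - j)))) (j + s)
            @ lift_rows a D (shifted w j s \<tau>) (map (\<lambda>m. \<alpha>s ! \<sigma> m) [s..<length \<alpha>s])))
         else 0)))"
    (is "_ = (\<Sum>s\<le>_. _ * (\<Sum>\<sigma>\<in>_. _ * ?R s \<sigma>))"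
      is "_ = (\<Sum>s\<le>_. _ * (\<Sum>\<sigma>\<in>_. _ * (if _ then _ * (\<Sum>\<tau>\<in>_. _ * ?O s \<sigma> \<tau>) else _)))")
proof -
  let ?n = "length \<alpha>s" and ?N = "q - j"
  let ?f = "\<lambda>xs. Om w \<zeta> (core_rows b j @ xs)"
  have f: "alt_additive ?n ?f"
    using Om_alt_additive[OF \<zeta>] by (intro alt_additive_append[of j]) (simp_all add: p)
  define t where "t m = (a (\<alpha>s ! m), \<lambda>l. D (\<alpha>s ! m) (w l))" for m
  define z where "z m l = (0 :: 'f, single (j + l) (C (\<alpha>s ! m) (w (j + l))))" for m l
  \<comment> \<open>The core part of row \<open>m\<close> has no contribution in the leading
    \<open>j\<close> slots, since \<open>w\<close> is zero there and \<open>C i 0 = 0\<close>; the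
    sum starts at slot \<open>j\<close>.\<close>
  define y where "y m = (\<Sum>l<?N. z m l)" for m
  have y: "fst (y m) = 0" "l < q \<Longrightarrow> snd (y m) l = (if j \<le> l then C (\<alpha>s ! m) (w l) else 0)" for m l
  proof -
    show "fst (y m) = 0" by (simp add: y_def z_def fst_sum)
    assume l: "l < q"
    have "snd (y m) l = (\<Sum>i<?N. single (j + i) (C (\<alpha>s ! m) (w (j + i))) l)"
      by (simp add: y_def z_def snd_sum sum_fun_apply)
    also have "\<dots> = (\<Sum>i<?N. if i = l - j \<and> j \<le> l then C (\<alpha>s ! m) (w l) else 0)"
      by (intro sum.cong) (auto simp: single_def)
    also have "\<dots> = (if j \<le> l then C (\<alpha>s ! m) (w l) else 0)"
      using l by (cases "j \<le> l") (auto simp: diff_less_mono)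
    finally show "snd (y m) l = (if j \<le> l then C (\<alpha>s ! m) (w l) else 0)" .
  qed
  have "Om w \<zeta> (core_rows b j @ lift_rows a (\<lambda>i u. D i u - C i u) w \<alpha>s) = ?f (map (\<lambda>m. t m - y m) [0..<?n])"
  proof (rule Om_cong)
    fix m l assume m: "m < length (core_rows b j @ lift_rows a (\<lambda>i u. D i u - C i u) w \<alpha>s)" and l: "l < q"
    show "snd ((core_rows b j @ lift_rows a (\<lambda>i u. D i u - C i u) w \<alpha>s) ! m) l
        = snd ((core_rows b j @ map (\<lambda>m. t m - y m) [0..<?n]) ! m) l"
    proof (cases "m < j")
      case False
      then have "\<alpha>s ! (m - j) \<in> set \<alpha>s" "m - j < ?n" using m by auto
      then show ?thesis using False y(2)[OF l] w C by (auto simp: nth_append lift_rows_def t_def)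
    qed (simp add: nth_append)
  qed (auto simp: nth_append lift_rows_def t_def y(1))
  also have "\<dots> = (\<Sum>s\<le>?n. (- 1) ^ s * (\<Sum>\<sigma>\<in>shuffle_perms s (?n - s).
      of_int (sign \<sigma>) * ?f (map (\<lambda>m. y (\<sigma> m)) [0..<s] @ map (\<lambda>m. t (\<sigma> m)) [s..<?n])))"
    by (rule alt_additive_expand_shuffles[OF f])
  also have "\<dots> = (\<Sum>s\<le>?n. (- 1) ^ s * (\<Sum>\<sigma>\<in>shuffle_perms s (?n - s). of_int (sign \<sigma>) *
        ?R s \<sigma>))"
  proof (intro sum.cong refl arg_cong2[where f = "(*)"])
    fix s \<sigma> assume s: "s \<in> {..?n}" and \<sigma>: "\<sigma> \<in> shuffle_perms s (?n - s)"
    then have n: "s + (?n - s) = ?n" by simp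
    have \<sigma>p: "\<sigma> permutes {..<?n}" using \<sigma> unfolding shuffle_perms_def n by blast
    let ?T = "map (\<lambda>m. t (\<sigma> m)) [s..<?n]"
    let ?F = "\<lambda>h. ?f (map (\<lambda>m. z (\<sigma> m) (h m)) [0..<s] @ ?T)"
    have g: "alt_additive s (\<lambda>xs. ?f (xs @ ?T))"
      using f by (intro alt_additive_append_right[of s "?n - s"]) (use s in simp_all)
    have "?f (map (\<lambda>m. y (\<sigma> m)) [0..<s] @ ?T) = (\<Sum>h\<in>{..<s} \<rightarrow>\<^sub>E {..<?N}. ?F h)"
      using alt_additive_expand_sum[OF g, of "[]" s "{..<?N}" "\<lambda>m. z (\<sigma> m)"] by (simp add: y_def)
    also have "\<dots> = ?R s \<sigma>"
    proof -
      have noninj: "?F h = 0" if h: "\<not> inj_on h {..<s}" "h \<in> {..<s} \<rightarrow>\<^sub>E {..<?N}" for h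
      proof -
        obtain m m' where m: "m < s" "m' < s" "m \<noteq> m'" "h m = h m'" using h(1) by (auto simp: inj_on_def)
        have nth: "(core_rows b j @ map (\<lambda>m. z (\<sigma> m) (h m)) [0..<s] @ ?T) ! (j + m) = z (\<sigma> m) (h m)" if "m < s" for m
          using that by (simp add: nth_append)
        have hm: "h m < ?N" using h(2) m(1) by auto
        show ?thesis
        proof (rule Om_two_core_rows[OF \<zeta>])
          show "length (core_rows b j @ map (\<lambda>m. z (\<sigma> m) (h m)) [0..<s] @ ?T) = p" using s p by simp
          show "j + m < p" "j + m' < p" "j + m \<noteq> j + m'" "j + h m < q" using m hm s p by auto
          show "(core_rows b j @ map (\<lambda>m. z (\<sigma> m) (h m)) [0..<s] @ ?T) ! (j + m)
              = (0, single (j + h m) (C (\<alpha>s ! \<sigma> m) (w (j + h m))))"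
            by (rule trans[OF nth[OF m(1)]]) (simp only: z_def)
          show "(core_rows b j @ map (\<lambda>m. z (\<sigma> m) (h m)) [0..<s] @ ?T) ! (j + m')
              = (0, single (j + h m) (C (\<alpha>s ! \<sigma> m') (w (j + h m))))"
            by (rule trans[OF nth[OF m(2)]]) (simp only: z_def m(4))
        qed
      qed
      show ?thesis
      proof (cases "s \<le> ?N")
        case True
        have "(\<Sum>h\<in>{..<s} \<rightarrow>\<^sub>E {..<?N}. ?F h)
          = 1 / fact (?N - s) * (\<Sum>\<tau>\<in>{\<tau>. \<tau> permutes {..<?N}}. ?F (restrict \<tau> {..<s}))"
          using noninj True by (rule sum_functions_eq_sum_permutations)
        also have "(\<Sum>\<tau>\<in>{\<tau>. \<tau> permutes {..<?N}}. ?F (restrict \<tau> {..<s}))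
          = (\<Sum>\<tau>\<in>{\<tau>. \<tau> permutes {..<?N}}. of_int (sign \<tau>) * ?O s \<sigma> \<tau>)"
        proof (rule sum.cong)
          fix \<tau> assume "\<tau> \<in> {\<tau>. \<tau> permutes {..<?N}}"
          then have \<tau>: "\<tau> permutes {..<?N}" by simp
          have T: "?T = lift_rows a D w (map (\<lambda>m. \<alpha>s ! \<sigma> m) [s..<?n])" by (simp add: t_def lift_rows_def)
          have Z: "map (\<lambda>m. z (\<sigma> m) (restrict \<tau> {..<s} m)) [0..<s]
             = map (\<lambda>m. (0, single (j + \<tau> m) (C (\<alpha>s ! \<sigma> m) (w (j + \<tau> m))))) [0..<s]"
            by (auto simp: z_def)
          have D': "D i 0 = 0" if i: "i \<in> set (map (\<lambda>m. \<alpha>s ! \<sigma> m) [s..<?n])" for i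
          proof -
            obtain m where m: "i = \<alpha>s ! \<sigma> m" "m < ?n" using i by auto
            then have "\<sigma> m < ?n" using permutes_in_image[OF \<sigma>p, of m] by simp
            then show ?thesis unfolding m(1) by (intro D nth_mem)
          qed
          have p': "p = j + s + length (map (\<lambda>m. \<alpha>s ! \<sigma> m) [s..<?n])" using s p by simp
          show "?F (restrict \<tau> {..<s}) = of_int (sign \<tau>) * ?O s \<sigma> \<tau>"
            unfolding T Z by (rule Om_core_permute[OF \<zeta> \<tau> j True p']) (rule D')
        qed simp
        finally show ?thesis using True by simp
      next
        case False
        \<comment> \<open>With more core rows than available slots no placement is injective, so
          every term vanishes; this agrees with the case of negative form degree.\<close>
        have "?F h = 0" if h: "h \<in> {..<s} \<rightarrow>\<^sub>E {..<?N}" for h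
        proof (rule noninj[OF _ h])
          show "\<not> inj_on h {..<s}"
            using card_inj_on_le[of h "{..<s}" "{..<?N}"] h False by auto
        qed
        then show ?thesis using False by simp
      qed
    qed
    finally show "?f (map (\<lambda>m. y (\<sigma> m)) [0..<s] @ ?T) = ?R s \<sigma>" .
  qed
  finally show ?thesis .
qed

end

context cochain_chart
begin

subsection \<open>Elements of the fibre of the ideal as functionals\<close>

text \<open>The identification of the fibre of \<open>k\<close> with its bidual, in relational form:
  it is compatible with sums and multiples, and reduces equations in the fibre to equations of real
  numbers.\<close>

definition represents :: "'a \<Rightarrow> (('a \<Rightarrow> real) \<Rightarrow> real) \<Rightarrow> bool" where
  "represents \<xi> F \<longleftrightarrow> \<xi> \<in> k \<and> proj A \<xi> = x \<and> (\<forall>\<zeta>\<in>k_dual A k x. \<zeta> \<xi> = F \<zeta>)"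

lemma represents_pt: "represents (pt b) F \<longleftrightarrow> b \<in> kk \<and> (\<forall>\<zeta>\<in>k_dual A k x. \<zeta> (pt b) = F \<zeta>)"
  by (simp add: represents_def pt_in_k)

lemma representsE:
  assumes "represents \<xi> F"
  obtains b where "\<xi> = pt b" "b \<in> kk" "\<forall>\<zeta>\<in>k_dual A k x. \<zeta> (pt b) = F \<zeta>"
  using assms k_cases[of \<xi>] unfolding represents_def by metis

text \<open>The functionals are the coordinate functions of a basis of \<open>kk\<close>, extended
  by zero; the basis is finite because the typical fibre has a finite spanning set.\<close>

lemma dual_basis:
  obtains B \<theta> where "finite B" "B \<subseteq> kk" "\<forall>b\<in>B. \<theta> b \<in> k_dual A k x"
    "\<forall>v\<in>kk. (\<Sum>b\<in>B. \<theta> b (pt v) *\<^sub>R b) = v"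
proof -
  obtain B where B: "B \<subseteq> kk" "independent B" "kk \<subseteq> span B" using basis_exists by metis
  obtain F :: "'f set" where F: "finite F" "span F = UNIV" using finite_span_fibre by blast
  have fin: "finite B" using independent_span_bound[OF F(1) B(2)] F(2) by simp
  define \<theta> where "\<theta> b \<xi> = (if \<xi> \<in> k \<and> proj A \<xi> = x then representation B (cf \<xi>) b else 0)" for b \<xi>
  have \<theta>: "\<theta> b (pt v) = representation B v b" if "v \<in> kk" for b v using that by (simp add: \<theta>_def pt_in_k)
  have sp: "v \<in> span B" if "v \<in> kk" for v using that B(3) by blast
  have dual: "\<theta> b \<in> k_dual A k x" for b
  proof (rule k_dualI)
    fix u v assume "u \<in> kk" "v \<in> kk"
    then show "\<theta> b (pt (u + v)) = \<theta> b (pt u) + \<theta> b (pt v)"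
      using representation_add[OF B(2) sp sp] by (simp add: \<theta> subspace_add[OF subspace_kk])
  next
    fix r u assume "u \<in> kk"
    then show "\<theta> b (pt (r *\<^sub>R u)) = r * \<theta> b (pt u)"
      using representation_scale[OF B(2) sp] by (simp add: \<theta> subspace_scale[OF subspace_kk])
  qed (auto simp: \<theta>_def)
  have "(\<Sum>b\<in>B. \<theta> b (pt v) *\<^sub>R b) = v" if "v \<in> kk" for v
    using sum_representation_eq[OF B(2) sp[OF that] fin order_refl] that by (simp add: \<theta>)
  with fin B(1) dual show ?thesis by (intro that[of B \<theta>]) auto
qed

text \<open>Evaluating on the functionals of a dual basis recovers all coordinates of an
  element.\<close>

lemma represents_unique:
  assumes "represents \<xi> F" "represents \<xi>' F'" "\<And>\<zeta>. \<zeta> \<in> k_dual A k x \<Longrightarrow> F \<zeta> = F' \<zeta>"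
  shows "\<xi> = \<xi>'"
proof -
  obtain b where b: "\<xi> = pt b" "b \<in> kk" "\<forall>\<zeta>\<in>k_dual A k x. \<zeta> (pt b) = F \<zeta>"
    using assms(1) by (rule representsE)
  obtain b' where b': "\<xi>' = pt b'" "b' \<in> kk" "\<forall>\<zeta>\<in>k_dual A k x. \<zeta> (pt b') = F' \<zeta>"
    using assms(2) by (rule representsE)
  obtain B \<theta> where \<theta>: "finite B" "B \<subseteq> kk" "\<forall>b\<in>B. \<theta> b \<in> k_dual A k x"
    "\<forall>v\<in>kk. (\<Sum>b\<in>B. \<theta> b (pt v) *\<^sub>R b) = v" by (rule dual_basis)
  have "b = (\<Sum>e\<in>B. \<theta> e (pt b) *\<^sub>R e)" using bspec[OF \<theta>(4) b(2)] by simp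
  also have "\<dots> = (\<Sum>e\<in>B. \<theta> e (pt b') *\<^sub>R e)"
    using b(3) b'(3) \<theta>(3) assms(3) by (intro sum.cong) auto
  also have "\<dots> = b'" using bspec[OF \<theta>(4) b'(2)] .
  finally show ?thesis by (simp add: b b')
qed

lemma k_dual_sum:
  assumes "\<And>i. i \<in> I \<Longrightarrow> f i \<in> k_dual A k x"
  shows "(\<lambda>\<xi>. \<Sum>i\<in>I. r i * f i \<xi>) \<in> k_dual A k x"
  using assms
proof (intro k_dualI)
  fix a b assume "a \<in> kk" "b \<in> kk"
  then show "(\<Sum>i\<in>I. r i * f i (pt (a + b))) = (\<Sum>i\<in>I. r i * f i (pt a)) + (\<Sum>i\<in>I. r i * f i (pt b))"
    using assms by (simp add: k_dualD sum.distrib[symmetric] distrib_left)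
next
  fix t a assume "a \<in> kk"
  then show "(\<Sum>i\<in>I. r i * f i (pt (t *\<^sub>R a))) = t * (\<Sum>i\<in>I. r i * f i (pt a))"
    using assms by (simp add: k_dualD sum_distrib_left mult.left_commute)
next
  fix \<xi> assume "\<xi> \<notin> k \<or> proj A \<xi> \<noteq> x"
  then show "(\<Sum>i\<in>I. r i * f i \<xi>) = 0" using k_dualD(3)[OF assms] by simp
qed

lemma linear_functional_sum:
  assumes F: "\<And>s t \<zeta> \<zeta>'. \<zeta> \<in> k_dual A k x \<Longrightarrow> \<zeta>' \<in> k_dual A k x \<Longrightarrow>
      F (\<lambda>\<xi>. s * \<zeta> \<xi> + t * \<zeta>' \<xi>) = s * F \<zeta> + t * (F \<zeta>' :: real)"
    and "finite I" "\<And>i. i \<in> I \<Longrightarrow> f i \<in> k_dual A k x"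
  shows "F (\<lambda>\<xi>. \<Sum>i\<in>I. r i * f i \<xi>) = (\<Sum>i\<in>I. r i * F (f i))"
  using assms(2,3)
proof (induction I)
  case empty
  have "(\<lambda>\<xi>. 0) \<in> k_dual A k x" using k_dual_sum[of "{}"] by simp
  from F[OF this this, of 0 0] show ?case by simp
next
  case (insert i I)
  have "F (\<lambda>\<xi>. r i * f i \<xi> + 1 * (\<Sum>i\<in>I. r i * f i \<xi>)) = r i * F (f i) + 1 * F (\<lambda>\<xi>. \<Sum>i\<in>I. r i * f i \<xi>)"
    using insert.prems by (intro F k_dual_sum) auto
  then show ?case using insert by simp
qed

text \<open>Supplies a unique solution to the definite description: the element with coordinates
  \<open>F (\<theta> b)\<close> works because each functional is a combination of the
  \<open>\<theta> b\<close> with coefficients \<open>\<zeta> (pt b)\<close>.\<close>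

lemma bidual_elem_represents:
  assumes F: "\<And>s t \<zeta> \<zeta>'. \<zeta> \<in> k_dual A k x \<Longrightarrow> \<zeta>' \<in> k_dual A k x \<Longrightarrow>
      F (\<lambda>\<xi>. s * \<zeta> \<xi> + t * \<zeta>' \<xi>) = s * F \<zeta> + t * F \<zeta>'"
  shows "represents (bidual_elem A k x F) F"
proof -
  obtain B \<theta> where \<theta>: "finite B" "B \<subseteq> kk" "\<forall>b\<in>B. \<theta> b \<in> k_dual A k x"
    "\<forall>v\<in>kk. (\<Sum>b\<in>B. \<theta> b (pt v) *\<^sub>R b) = v" by (rule dual_basis)
  define u where "u = (\<Sum>b\<in>B. F (\<theta> b) *\<^sub>R b)"
  have lin: "\<zeta> (pt (\<Sum>b\<in>B. r b *\<^sub>R b)) = (\<Sum>b\<in>B. r b * \<zeta> (pt b)) \<and> (\<Sum>b\<in>B. r b *\<^sub>R b) \<in> kk"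
    if \<zeta>: "\<zeta> \<in> k_dual A k x" for \<zeta> r
    using \<theta>(1,2)
  proof (induction B)
    case empty
    then show ?case using k_dualD(2)[OF \<zeta>, of 0 0] subspace_0[OF subspace_kk] by simp
  next
    case (insert b B)
    have b: "b \<in> kk" "r b *\<^sub>R b \<in> kk" using insert.prems subspace_scale[OF subspace_kk] by auto
    then show ?case
      using insert k_dualD(1)[OF \<zeta> b(2)] k_dualD(2)[OF \<zeta> b(1)] subspace_add[OF subspace_kk b(2)] by simp
  qed
  have u: "u \<in> kk" unfolding u_def by (intro subspace_sum subspace_scale subspace_kk) (use \<theta>(2) in auto)
  have "\<zeta> (pt u) = F \<zeta>" if \<zeta>: "\<zeta> \<in> k_dual A k x" for \<zeta>
  proof -
    have "\<zeta> = (\<lambda>\<xi>. \<Sum>b\<in>B. \<zeta> (pt b) * \<theta> b \<xi>)"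
    proof (rule k_dual_eqI[OF \<zeta> k_dual_sum[OF bspec[OF \<theta>(3)]]])
      fix v assume v: "v \<in> kk"
      have "\<zeta> (pt v) = \<zeta> (pt (\<Sum>b\<in>B. \<theta> b (pt v) *\<^sub>R b))" using bspec[OF \<theta>(4) v] by simp
      also have "\<dots> = (\<Sum>b\<in>B. \<theta> b (pt v) * \<zeta> (pt b))" using lin[OF \<zeta>, of "\<lambda>b. \<theta> b (pt v)"] by blast
      finally show "\<zeta> (pt v) = (\<Sum>b\<in>B. \<zeta> (pt b) * \<theta> b (pt v))" by (simp add: mult.commute)
    qed
    then have "F \<zeta> = F (\<lambda>\<xi>. \<Sum>b\<in>B. \<zeta> (pt b) * \<theta> b \<xi>)" by (rule arg_cong)
    also have "\<dots> = (\<Sum>b\<in>B. \<zeta> (pt b) * F (\<theta> b))" using F \<theta>(1) bspec[OF \<theta>(3)] by (rule linear_functional_sum)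
    finally show ?thesis using lin[OF \<zeta>, of "\<lambda>b. F (\<theta> b)"] by (simp add: u_def mult.commute)
  qed
  then have rep: "represents (pt u) F" using u by (simp add: represents_pt)
  have "bidual_elem A k x F = pt u"
    unfolding bidual_elem_def represents_def[symmetric]
    using rep represents_unique[OF _ rep refl] by (rule the_equality)
  with rep show ?thesis by simp
qed

lemma represents_scl:
  assumes "represents \<xi> F"
  shows "represents (scl A r \<xi>) (\<lambda>\<zeta>. r * F \<zeta>)"
proof -
  obtain b where b: "\<xi> = pt b" "b \<in> kk" "\<forall>\<zeta>\<in>k_dual A k x. \<zeta> (pt b) = F \<zeta>"
    using assms by (rule representsE)
  then show ?thesis by (simp add: scl_pt represents_pt k_dualD subspace_scale[OF subspace_kk])
qed

lemma represents_zero: "represents (zero A x) (\<lambda>\<zeta>. 0)"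
  using k_dualD(2)[of _ 0 0] subspace_0[OF subspace_kk] by (simp add: zero_pt represents_pt)

text \<open>In coordinates the fibre is a vector space, hence a commutative monoid, and the product
  defining \<open>fibre_sum\<close> can be taken apart by induction.\<close>

lemma represents_fibre_sum:
  assumes "\<And>i. i \<in> I \<Longrightarrow> represents (f i) (F i)" "finite I"
  shows "represents (fibre_sum A x f I) (\<lambda>\<zeta>. \<Sum>i\<in>I. F i \<zeta>)"
proof -
  let ?M = "\<lparr>carrier = fibre A x, monoid.mult = add A, one = zero A x\<rparr>"
  interpret M: comm_monoid ?M
  proof (rule comm_monoidI)
    fix a b e assume "a \<in> carrier ?M" "b \<in> carrier ?M" "e \<in> carrier ?M"
    then obtain a' b' e' where "a = pt a'" "b = pt b'" "e = pt e'" using fibre_cases by (metis partial_object.select_convs(1))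
    then show "a \<otimes>\<^bsub>?M\<^esub> b \<otimes>\<^bsub>?M\<^esub> e = a \<otimes>\<^bsub>?M\<^esub> (b \<otimes>\<^bsub>?M\<^esub> e)" by (simp add: add_pt add.assoc)
  next
    fix a b assume "a \<in> carrier ?M" "b \<in> carrier ?M"
    then obtain a' b' where ab: "a = pt a'" "b = pt b'" using fibre_cases by (metis partial_object.select_convs(1))
    then show "a \<otimes>\<^bsub>?M\<^esub> b \<in> carrier ?M" "a \<otimes>\<^bsub>?M\<^esub> b = b \<otimes>\<^bsub>?M\<^esub> a" by (simp_all add: add_pt add.commute)
  next
    fix a assume "a \<in> carrier ?M"
    then obtain a' where "a = pt a'" using fibre_cases by (metis partial_object.select_convs(1))
    then show "\<one>\<^bsub>?M\<^esub> \<otimes>\<^bsub>?M\<^esub> a = a" by (simp add: add_pt zero_pt)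
  qed (simp add: zero_pt)
  show ?thesis
    using assms(2,1)
  proof (induction I)
    case empty
    then show ?case using represents_zero by (simp add: fibre_sum_def)
  next
    case (insert i I)
    have car: "f j \<in> fibre A x" if "j \<in> insert i I" for j
      using insert.prems[OF that] by (auto elim!: representsE)
    have eq: "fibre_sum A x f (insert i I) = add A (f i) (fibre_sum A x f I)"
      unfolding fibre_sum_def using insert.hyps car by (subst M.finprod_insert) (auto simp: Pi_iff)
    obtain b where b: "f i = pt b" "b \<in> kk" "\<forall>\<zeta>\<in>k_dual A k x. \<zeta> (pt b) = F i \<zeta>"
      using insert.prems[of i] by (auto elim!: representsE)
    have "represents (fibre_sum A x f I) (\<lambda>\<zeta>. \<Sum>i\<in>I. F i \<zeta>)" using insert by simp
    then obtain b' where b': "fibre_sum A x f I = pt b'" "b' \<in> kk" "\<forall>\<zeta>\<in>k_dual A k x. \<zeta> (pt b') = (\<Sum>i\<in>I. F i \<zeta>)"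
      by (rule representsE)
    show ?case
      using insert.hyps b b' by (simp add: eq add_pt represents_pt k_dualD subspace_add[OF subspace_kk])
  qed
qed

subsection \<open>The evaluation map in a bundle chart\<close>

text \<open>Together with \<open>lift_vert\<close> an explicit form of the functions
  \<open>D\<close> and \<open>C\<close> that \<open>section_horizontal\<close> merely obtains; being
  defined for all sections at once, they can be handed to \<open>lift_rows\<close>.\<close>

definition lift_deriv :: "('m \<Rightarrow> 'a) \<Rightarrow> 'e \<Rightarrow> 'f" where
  "lift_deriv \<alpha> w = snd (snd (differential (base A) (total A) \<alpha> (bw w)) d)"

definition lift_vert :: "('m \<Rightarrow> 'a) \<Rightarrow> 'e \<Rightarrow> 'f" where
  "lift_vert \<alpha> w = cf (pair_C A k Q \<phi> E \<alpha> (bw w))"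

abbreviation "sec_rows \<equiv> lift_rows (\<lambda>\<alpha>. cf (\<alpha> x)) lift_deriv"
abbreviation "hor_rows \<equiv> lift_rows (\<lambda>\<alpha>. cf (\<alpha> x)) (\<lambda>\<alpha> u. lift_deriv \<alpha> u - lift_vert \<alpha> u)"

lemma section_lift:
  assumes "\<alpha> \<in> sections A"
  shows "lift_deriv \<alpha> 0 = 0" (is ?g1) and "lift_vert \<alpha> 0 = 0" (is ?g2) and "lift_vert \<alpha> w \<in> kk" (is ?g3)
    and "differential (base A) (total A) \<alpha> (bw w) = Tv (cf (\<alpha> x)) (w, lift_deriv \<alpha> w)" (is ?g4)
    and "pair_C A k Q \<phi> E \<alpha> (bw w) = pt (lift_vert \<alpha> w)" (is ?g5)
    and "hor_TA A Q \<phi> E (Tv (cf (\<alpha> x)) (w, lift_deriv \<alpha> w)) = Tv (cf (\<alpha> x)) (w, lift_deriv \<alpha> w - lift_vert \<alpha> w)" (is ?g6)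
proof -
  obtain D C where DC: "D 0 = 0" "C 0 = 0" "\<And>w. C w \<in> kk"
    "\<And>w. differential (base A) (total A) \<alpha> (bw w) = Tv (cf (\<alpha> x)) (w, D w)"
    "\<And>w. pair_C A k Q \<phi> E \<alpha> (bw w) = pt (C w)"
    "\<And>w. hor_TA A Q \<phi> E (Tv (cf (\<alpha> x)) (w, D w)) = Tv (cf (\<alpha> x)) (w, D w - C w)"
    using section_horizontal[OF assms] by blast
  have "lift_deriv \<alpha> = D" by (simp add: fun_eq_iff lift_deriv_def DC(4) Tv_def tvec_coord[OF atlas_total d])
  moreover have "lift_vert \<alpha> = C" by (simp add: fun_eq_iff lift_vert_def DC(5))
  ultimately show ?g1 ?g2 ?g3 ?g4 ?g5 ?g6 using DC by simp_all
qed

lemma section_pt: "\<alpha> \<in> sections A \<Longrightarrow> pt (cf (\<alpha> x)) = \<alpha> x"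
  using section_fibre[OF _ x_points] fibre_pt(2) by blast

text \<open>Ensures that the horizontal projection of a core row leaves its empty slots
  empty.\<close>

lemma vv_zero [simp]: "vv 0 = 0"
proof -
  have "(0, 0 - 0) \<in> E_at 0" using subspace_0[OF subspace_E_at] by (simp add: zero_prod_def)
  from nu_Tv[OF this subspace_0[OF subspace_kk]] show ?thesis
    by (simp add: vv_def pair_v_def core_vec_pt)
qed

lemma Z_lift_Mpt: "i < q \<Longrightarrow> Z_lift A i (pt b) (Mpt w \<zeta>) = Rpt w \<zeta> (0, single i b)"
  by (auto simp: Z_lift_def Mpt_def Rpt_def TM_zero core_vec_pt tadd_Tv zero_pt single_def)

lemma T_lift_Mpt: "\<alpha> \<in> sections A \<Longrightarrow> T_lift A \<alpha> (Mpt w \<zeta>) = Rpt w \<zeta> (cf (\<alpha> x), \<lambda>l. lift_deriv \<alpha> (w l))"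
  by (simp add: T_lift_def Mpt_def Rpt_def section_lift section_pt)

lemma hor_core_row:
  "apfst (map (hor_TA A Q \<phi> E)) (Rpt w \<zeta> (0, single i b)) = Rpt w \<zeta> (0, single i (b - vv b))"
  by (auto simp: Rpt_def hor_core single_def)

lemma hor_lift_row:
  "\<alpha> \<in> sections A \<Longrightarrow> apfst (map (hor_TA A Q \<phi> E)) (Rpt w \<zeta> (cf (\<alpha> x), \<lambda>l. lift_deriv \<alpha> (w l)))
    = Rpt w \<zeta> (cf (\<alpha> x), \<lambda>l. lift_deriv \<alpha> (w l) - lift_vert \<alpha> (w l))"
  by (simp add: Rpt_def section_lift)

lemma lifts_eq_rows:
  assumes args: "weil_args A p q i \<alpha>s x \<beta>s ws" and i: "i \<le> q"
    and w: "\<And>l. l < q \<Longrightarrow> (replicate i (tzero x) @ ws) ! l = bw (w l)" and b: "\<And>l. l < i \<Longrightarrow> \<beta>s ! l = pt (b l)"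
  shows "(replicate i (tzero x) @ ws, x, \<zeta>) = Mpt w \<zeta>"
    and "map (\<lambda>l. Z_lift A l (\<beta>s ! l) (Mpt w \<zeta>)) [0..<i] @ map (\<lambda>\<alpha>. T_lift A \<alpha> (Mpt w \<zeta>)) \<alpha>s
      = map (Rpt w \<zeta>) (core_rows b i @ sec_rows w \<alpha>s)" (is ?g2)
    and "map (apfst (map (hor_TA A Q \<phi> E)))
          (map (\<lambda>l. Z_lift A l (\<beta>s ! l) (Mpt w \<zeta>)) [0..<i] @ map (\<lambda>\<alpha>. T_lift A \<alpha> (Mpt w \<zeta>)) \<alpha>s)
      = map (Rpt w \<zeta>) (core_rows (\<lambda>l. b l - vv (b l)) i @ hor_rows w \<alpha>s)" (is ?g3)
proof -
  have len: "length ws = q - i" and sec: "set \<alpha>s \<subseteq> sections A" using args by (auto simp: weil_args_def)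
  have "replicate i (tzero x) @ ws = map (\<lambda>l. bw (w l)) [0..<q]"
    using w len i by (intro nth_equalityI) auto
  then show "(replicate i (tzero x) @ ws, x, \<zeta>) = Mpt w \<zeta>" by (simp add: Mpt_def)
  have Z: "map (\<lambda>l. Z_lift A l (\<beta>s ! l) (Mpt w \<zeta>)) [0..<i] = map (Rpt w \<zeta>) (core_rows b i)"
    using i b by (simp add: core_rows_def Z_lift_Mpt)
  have T: "map (\<lambda>\<alpha>. T_lift A \<alpha> (Mpt w \<zeta>)) \<alpha>s = map (Rpt w \<zeta>) (sec_rows w \<alpha>s)"
    using sec by (auto simp: lift_rows_def T_lift_Mpt)
  show ?g2
    unfolding Z T map_append ..
  have "map (apfst (map (hor_TA A Q \<phi> E))) (map (Rpt w \<zeta>) (core_rows b i))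
     = map (Rpt w \<zeta>) (core_rows (\<lambda>l. b l - vv (b l)) i)"
    by (simp add: core_rows_def hor_core_row)
  moreover have "map (apfst (map (hor_TA A Q \<phi> E))) (map (Rpt w \<zeta>) (sec_rows w \<alpha>s))
     = map (Rpt w \<zeta>) (hor_rows w \<alpha>s)"
    using sec by (auto simp: lift_rows_def hor_lift_row)
  ultimately show ?g3
    unfolding Z T map_append by (simp only:)
qed

text \<open>Linearity of \<open>Om\<close> in the functional yields the representing element. The
  projected cochain is handled as \<open>\<omega>\<close> evaluated on the projected rows, so the
  same linearity applies to it.\<close>

lemma ev_represents:
  assumes args: "weil_args A p q i \<alpha>s x \<beta>s ws" and i: "i \<le> q"
    and w: "\<And>l. l < q \<Longrightarrow> (replicate i (tzero x) @ ws) ! l = bw (w l)" and b: "\<And>l. l < i \<Longrightarrow> \<beta>s ! l = pt (b l)"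
  shows "represents (ev A k p q \<omega> i \<alpha>s x \<beta>s ws)
      (\<lambda>\<zeta>. Om w \<zeta> (core_rows b i @ sec_rows w \<alpha>s))" (is "represents ?l1 ?r1")
    and "represents (ev A k p q (hor_ext A Q \<phi> E \<omega>) i \<alpha>s x \<beta>s ws)
      (\<lambda>\<zeta>. Om w \<zeta> (core_rows (\<lambda>l. b l - vv (b l)) i @ hor_rows w \<alpha>s))" (is "represents ?l2 ?r2")
proof -
  note eq = lifts_eq_rows[OF assms]
  have len: "i + length \<alpha>s = p" using args by (auto simp: weil_args_def)
  have "?l1 = bidual_elem A k x ?r1"
    using args i by (simp only: ev_def if_True Let_def eq Om_def)
  then show "represents ?l1 ?r1"
    using len by (simp only:) (intro bidual_elem_represents Om_dual_linear, auto)
  have "?l2 = bidual_elem A k x ?r2"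
    using args i by (simp only: ev_def if_True Let_def eq(1,3) Om_def hor_ext_def)
  then show "represents ?l2 ?r2"
    using len by (simp only:) (intro bidual_elem_represents Om_dual_linear, auto)
qed

text \<open>The nested sums of \<open>hor_weil\<close> are converted from the inside out into
  representing functionals: the evaluation, the sum over permutations, the sum over shuffles, the
  sum over \<open>i\<close>. What remains is \<open>Om_horizontal_rows\<close> for each \<zeta>,
  where \<open>s = i - j\<close> counts the sections whose core part is chosen.\<close>

lemma ev_hor_eq_hor_ev:
  assumes args: "weil_args A p q j \<alpha>s x \<beta>s ws"
  shows "ev A k p q (hor_ext A Q \<phi> E \<omega>) j \<alpha>s x \<beta>s ws
    = hor_weil A (pair_C A k Q \<phi> E) (pair_v A k Q \<phi> E) p q (ev A k p q \<omega>) j \<alpha>s x \<beta>s ws"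
proof (cases "j \<le> q")
  case False
  \<comment> \<open>Negative form degree: \<open>ev\<close> is zero for \<open>j > q\<close> by
    definition, and every summand on the other side has index at least \<open>j\<close>.\<close>
  have "represents (hor_weil A (pair_C A k Q \<phi> E) (pair_v A k Q \<phi> E) p q (ev A k p q \<omega>) j \<alpha>s x \<beta>s ws)
      (\<lambda>\<zeta>. \<Sum>i\<in>{j..p}. 0)"
    unfolding hor_weil_def if_P[OF args]
    by (rule represents_fibre_sum) (use False in \<open>auto simp: represents_zero\<close>)
  from represents_unique[OF represents_zero this] show ?thesis using args False by (simp add: ev_def)
next
  case j: True
  have args': "j \<le> p" "length \<alpha>s = p - j" "set \<alpha>s \<subseteq> sections A" "length \<beta>s = j" "set \<beta>s \<subseteq> fibre A x"
     "length ws = q - j" "set ws \<subseteq> {w \<in> tangent (base A). fst w = x}"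
    using args by (auto simp: weil_args_def)
  define n where "n = p - j"
  have p: "p = j + length \<alpha>s" using args' by simp
  have "\<forall>l. \<exists>b. l < j \<longrightarrow> \<beta>s ! l = pt b"
    using args'(4,5) fibre_cases nth_mem by (metis (no_types, lifting) subsetD)
  then obtain b where b: "\<And>l. l < j \<Longrightarrow> \<beta>s ! l = pt (b l)" by metis
  have "\<forall>l. \<exists>u. l < q - j \<longrightarrow> ws ! l = bw u"
    using args'(6,7) bw_cases nth_mem by (metis (mono_tags, lifting) mem_Collect_eq subsetD)
  then obtain u where u: "\<And>l. l < q - j \<Longrightarrow> ws ! l = bw (u l)" by metis
  \<comment> \<open>The leading \<open>j\<close> components are the zero vectors that
    \<open>ev\<close> puts in front of \<open>ws\<close>.\<close>
  define w where "w l = (if l < j then 0 else u (l - j))" for l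
  have w: "(replicate j (tzero x) @ ws) ! l = bw (w l)" if "l < q" for l
    using that u[of "l - j"] by (auto simp: nth_append w_def tzero_x diff_less_mono)
  let ?b = "\<lambda>l. b l - vv (b l)"
  let ?h\<beta>s = "map (\<lambda>\<beta>. add A \<beta> (scl A (-1) (pair_v A k Q \<phi> E \<beta>))) \<beta>s"
  let ?inner = "\<lambda>s \<sigma> \<tau>. ev A k p q \<omega> (j + s) (map (\<lambda>m. \<alpha>s ! \<sigma> m) [s..<p - j]) x
      (?h\<beta>s
        @ map (\<lambda>m. (map (\<lambda>m. pair_C A k Q \<phi> E (\<alpha>s ! \<sigma> m)) [0..<s] ! m) (ws ! \<tau> m)) [0..<s])
      (map (\<lambda>m. ws ! \<tau> m) [s..<s + (q - (j + s))])"
  let ?G = "\<lambda>s \<sigma> \<tau> \<zeta>. Om (shifted w j s \<tau>) \<zeta>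
           (core_rows (\<lambda>i. if i < j then ?b i else lift_vert (\<alpha>s ! \<sigma> (i - j)) (w (j + \<tau> (i - j)))) (j + s)
            @ sec_rows (shifted w j s \<tau>) (map (\<lambda>m. \<alpha>s ! \<sigma> m) [s..<length \<alpha>s]))"
  \<comment> \<open>The \<open>s\<close> values of \<C> are appended behind the \<open>j\<close>
    given fibre elements, so in the evaluation at level \<open>j + s\<close> they become the core
    rows in the slots from \<open>j\<close> on.\<close>
  have inner: "represents (?inner s \<sigma> \<tau>) (?G s \<sigma> \<tau>)"
    if s: "j + s \<le> p" "j + s \<le> q" and \<sigma>: "\<sigma> \<in> shuffle_perms s (p - (j + s))" and \<tau>: "\<tau> permutes {..<q - j}" for s \<sigma> \<tau>
  proof -
    have "s + (p - (j + s)) = length \<alpha>s" using s args' by simp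
    then have \<sigma>p: "\<sigma> permutes {..<length \<alpha>s}" using \<sigma> unfolding shuffle_perms_def by auto
    have \<sigma>s: "\<alpha>s ! \<sigma> m \<in> sections A" if "m < length \<alpha>s" for m
      using permutes_in_image[OF \<sigma>p, of m] that args'(3) by (auto intro!: subsetD[OF args'(3)] nth_mem)
    have \<tau>l: "\<tau> m < q - j" if "m < q - j" for m using permutes_in_image[OF \<tau>, of m] that by simp
    let ?\<beta> = "?h\<beta>s
        @ map (\<lambda>m. (map (\<lambda>m. pair_C A k Q \<phi> E (\<alpha>s ! \<sigma> m)) [0..<s] ! m) (ws ! \<tau> m)) [0..<s]"
    let ?v = "\<lambda>i. if i < j then ?b i else lift_vert (\<alpha>s ! \<sigma> (i - j)) (w (j + \<tau> (i - j)))"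
    have \<beta>: "?\<beta> ! l = pt (?v l)" if l: "l < j + s" for l
    proof (cases "l < j")
      case True
      then show ?thesis using args'(4) b by (simp add: nth_append vv(1) scl_pt add_pt)
    next
      case False
      then have ls: "l - j < s" "\<tau> (l - j) < q - j" using l s \<tau>l[of "l - j"] by auto
      then show ?thesis
        using False args'(4) s p section_lift(5)[OF \<sigma>s[of "l - j"]] u[OF ls(2)] by (simp add: nth_append w_def)
    qed
    have len\<beta>: "length ?\<beta> = j + s" using args'(4) by simp
    have ev_args: "weil_args A p q (j + s) (map (\<lambda>m. \<alpha>s ! \<sigma> m) [s..<p - j]) x ?\<beta> (map (\<lambda>m. ws ! \<tau> m) [s..<s + (q - (j + s))])"
      unfolding weil_args_def
    proof (intro conjI)
      show "set (map (\<lambda>m. \<alpha>s ! \<sigma> m) [s..<p - j]) \<subseteq> sections A" using \<sigma>s args'(2) by auto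
      show "set ?\<beta> \<subseteq> fibre A x"
      proof
        fix y assume "y \<in> set ?\<beta>"
        then obtain l where "l < j + s" "y = ?\<beta> ! l" unfolding in_set_conv_nth len\<beta> by blast
        then show "y \<in> fibre A x" using \<beta> by simp
      qed
      show "set (map (\<lambda>m. ws ! \<tau> m) [s..<s + (q - (j + s))]) \<subseteq> {w \<in> tangent (base A). fst w = x}"
        using \<tau>l u s by auto
    qed (use s x_points len\<beta> in auto)
    have ev_w: "(replicate (j + s) (tzero x) @ map (\<lambda>m. ws ! \<tau> m) [s..<s + (q - (j + s))]) ! l = bw (shifted w j s \<tau> l)"
      if l: "l < q" for l
    proof (cases "l < j + s")
      case True
      then show ?thesis by (simp add: nth_append shifted_def tzero_x)
    next
      case False
      then have "l - j < q - j" using l by auto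
      have "[s..<q - j] ! (l - (j + s)) = l - j" using False l by (subst nth_upt) auto
      with u[OF \<tau>l[OF \<open>l - j < q - j\<close>]] show ?thesis using False l by (simp add: nth_append shifted_def w_def)
    qed
    show ?thesis using ev_represents(1)[OF ev_args s(2) ev_w \<beta>] args'(2) by simp
  qed
  let ?W = "\<lambda>s \<sigma>. wedge_dot A x (q - (j + s))
                 (\<lambda>\<xi>s. ev A k p q \<omega> (j + s) (map (\<lambda>m. \<alpha>s ! \<sigma> m) [s..<p - j]) x
                          (?h\<beta>s @ \<xi>s))
                 (map (\<lambda>m. pair_C A k Q \<phi> E (\<alpha>s ! \<sigma> m)) [0..<s]) ws"
  have wedge: "represents (?W s \<sigma>)
      (\<lambda>\<zeta>. 1 / fact (q - (j + s)) * (\<Sum>\<tau>\<in>{\<tau>. \<tau> permutes {..<q - j}}. of_int (sign \<tau>) * ?G s \<sigma> \<tau> \<zeta>))"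
    if s: "j + s \<le> p" "j + s \<le> q" and \<sigma>: "\<sigma> \<in> shuffle_perms s (p - (j + s))" for s \<sigma>
  proof -
    \<comment> \<open>The form degree \<open>q - (j + s)\<close> and the \<open>s\<close> one-forms
      add up to the number \<open>q - j\<close> of tangent vectors; for truncated subtraction this
      depends on \<open>j + s \<le> q\<close>.\<close>
    have N: "q - (j + s) + s = q - j" using s by simp
    show ?thesis
      unfolding wedge_dot_def Let_def length_map length_upt diff_zero N
      by (intro represents_scl represents_fibre_sum inner[OF s \<sigma>]) (simp_all add: finite_permutations)
  qed
  let ?rhs = "\<lambda>i \<zeta>. if i \<le> q then (- 1) ^ (i - j) * (\<Sum>\<sigma>\<in>shuffle_perms (i - j) (p - i). of_int (sign \<sigma>) *
        (1 / fact (q - i) * (\<Sum>\<tau>\<in>{\<tau>. \<tau> permutes {..<q - j}}. of_int (sign \<tau>) * ?G (i - j) \<sigma> \<tau> \<zeta>))) else 0"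
  have rhs: "represents (hor_weil A (pair_C A k Q \<phi> E) (pair_v A k Q \<phi> E) p q (ev A k p q \<omega>) j \<alpha>s x \<beta>s ws)
     (\<lambda>\<zeta>. \<Sum>i\<in>{j..p}. ?rhs i \<zeta>)"
    unfolding hor_weil_def if_P[OF args]
  proof (rule represents_fibre_sum[OF _ finite_atLeastAtMost], goal_cases)
    case (1 i)
    show ?case
    proof (cases "i \<le> q")
      case True
      have ij: "j + (i - j) = i" using 1 by simp
      have fin: "finite (shuffle_perms (i - j) (p - i))"
        unfolding shuffle_perms_def by (rule finite_subset[OF _ finite_permutations[of "{..<i - j + (p - i)}"]]) auto
      show ?thesis
        unfolding if_P[OF True] ij
        by (intro represents_scl represents_fibre_sum fin wedge[of "i - j", unfolded ij]) (use 1 True in auto)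
    next
      case False
      then show ?thesis by (simp add: represents_zero)
    qed
  qed
  show ?thesis
  proof (rule represents_unique[OF ev_represents(2)[OF args j w b] rhs])
    fix \<zeta> assume \<zeta>: "\<zeta> \<in> k_dual A k x"
    let ?t = "\<lambda>s. (- 1) ^ s * (\<Sum>\<sigma>\<in>shuffle_perms s (length \<alpha>s - s). of_int (sign \<sigma>) *
        (if s \<le> q - j then 1 / fact (q - j - s) * (\<Sum>\<tau>\<in>{\<tau>. \<tau> permutes {..<q - j}}. of_int (sign \<tau>) * ?G s \<sigma> \<tau> \<zeta>)
         else 0))"
    have D0: "lift_deriv \<alpha> 0 = 0" "lift_vert \<alpha> 0 = 0" if "\<alpha> \<in> set \<alpha>s" for \<alpha>
      using that args'(3) section_lift(1,2) by blast+
    have "Om w \<zeta> (core_rows ?b j @ hor_rows w \<alpha>s)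
      = (\<Sum>s\<le>length \<alpha>s. ?t s)"
      by (rule Om_horizontal_rows[OF \<zeta> p j]) (simp_all add: w_def D0)
    also have "\<dots> = (\<Sum>i\<in>{j..p}. ?t (i - j))"
    proof -
      \<comment> \<open>The index of \<open>hor_weil\<close> starts at \<open>j\<close>, that of the
        expansion at \<open>0\<close>.\<close>
      have "(\<Sum>s\<le>length \<alpha>s. g s) = (\<Sum>i\<in>{j..p}. g (i - j))" for g :: "nat \<Rightarrow> real"
        by (rule sum.reindex_bij_witness[where i = "\<lambda>i. i - j" and j = "\<lambda>s. j + s"]) (use p in auto)
      then show ?thesis .
    qed
    also have "\<dots> = (\<Sum>i\<in>{j..p}. ?rhs i \<zeta>)"
    proof (rule sum.cong)
      fix i assume i: "i \<in> {j..p}"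
      have e: "length \<alpha>s - (i - j) = p - i" "q - j - (i - j) = q - i" "i - j \<le> q - j \<longleftrightarrow> i \<le> q"
        using i p j by auto
      show "?t (i - j) = ?rhs i \<zeta>"
        unfolding e by (cases "i \<le> q") simp_all
    qed simp
    finally show "Om w \<zeta> (core_rows ?b j @ hor_rows w \<alpha>s)
      = (\<Sum>i\<in>{j..p}. ?rhs i \<zeta>)" .
  qed
qed

end

theorem theorem4p27:
  fixes A :: "('m, 'e::real_normed_vector, 'a, 'e \<times> 'f::real_normed_vector) vbundle"
    and \<rho> :: "'a \<Rightarrow> ('m, 'e) tvec"
    and br :: "('m \<Rightarrow> 'a) \<Rightarrow> ('m \<Rightarrow> 'a) \<Rightarrow> ('m \<Rightarrow> 'a)"
    and k :: "'a set"
    and Q :: "('m, 'e, 'b, 'e \<times> 'g::real_normed_vector) vbundle"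
    and \<phi> :: "'a \<Rightarrow> 'b"
    and E :: "('a, 'e \<times> 'f) tvec set"
  assumes "lie_algebroid A \<rho> br"
    and "bundle_of_ideals A \<rho> br k"
    and "quotient_bundle A k Q \<phi>"
    and "IM_connection A \<rho> br Q \<phi> E"
  shows "\<forall>p q. \<forall>\<omega> \<in> ext_cochains A k p q.
    ev A k p q (hor_ext A Q \<phi> E \<omega>)
      = hor_weil A (pair_C A k Q \<phi> E) (pair_v A k Q \<phi> E) p q (ev A k p q \<omega>)"
proof (intro allI ballI ext)
  fix p q \<omega> j \<alpha>s x \<beta>s ws
  assume \<omega>: "\<omega> \<in> ext_cochains A k p q"
  show "ev A k p q (hor_ext A Q \<phi> E \<omega>) j \<alpha>s x \<beta>s ws
      = hor_weil A (pair_C A k Q \<phi> E) (pair_v A k Q \<phi> E) p q (ev A k p q \<omega>) j \<alpha>s x \<beta>s ws"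
  proof (cases "weil_args A p q j \<alpha>s x \<beta>s ws")
    case args: True
    have V: "vector_bundle A" using assms(1) by (simp add: lie_algebroid_def)
    have VQ: "vector_bundle Q" and baseQ: "base Q = base A"
      using assms(3) by (auto simp: quotient_bundle_def)
    have "x \<in> points (base A)" using args by (simp add: weil_args_def)
    then obtain c' where c': "c' \<in> base A" "x \<in> fst c'" by (auto simp: points_def)
    obtain d c where A: "bundle_chart A d c c' x" using bundle_chart_exists[OF V c'] by blast
    obtain dQ cQ where Q: "bundle_chart Q dQ cQ c' x"
      using bundle_chart_exists[OF VQ, of c' x] c' baseQ by auto
    have "connection_chart A Q d c c' x dQ cQ k \<phi> E"
      using A Q assms(3,4) unfolding connection_chart_def connection_chart_axioms_def IM_connection_def by blast
    then interpret cochain_chart A Q d c c' x dQ cQ k \<phi> E p q \<omega>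
      using \<omega> by (simp add: cochain_chart_def cochain_chart_axioms_def)
    show ?thesis using ev_hor_eq_hor_ev[OF args] .
  next
    \<comment> \<open>Both maps return \<open>undefined\<close> outside the arguments of a Weil
      cochain, so they agree there as functions.\<close>
    case False
    then show ?thesis by (simp add: ev_def hor_weil_def)
  qed
qed

end
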